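(* Let $E\subset\mathfrak{LC}$ have $L^1_{loc}$-equicontinuous $m$-bounds, with associated suitable set of moduli of continuity $\Theta$ and associated suitable set of radii $\mathcal R$. Assume that $(f_n)_{n\ge1}\subset E$ converges to $f$ in $(\mathfrak{LC},\sigma_{\Theta\mathcal R})$ and $(z_n)_{n\ge1}\subset X$ converges to $z\in X$, as $n\to\infty$. Then the mild solutions $u_n(t):=u(t,f_n,z_n)$ converge uniformly as $n\to\infty$ to the mild solution $u(t):=u(t,f,z)$ on every time-interval $[0,T]\subset I_{f,z}$.
   Context: Setting. $M,N\ge 1$; $U\subset\mathbb R^M$ is a bounded, open, connected set with sufficiently smooth boundary; $|y|=|y_1|+\dots+|y_N|$ on $\mathbb R^N$; $B_j\subset\mathbb R^N$ is the closed ball of radius $j$ centered at $0$; $L^1_{loc}$ is the space of locally integrable functions $\mathbb R\to\mathbb R$; $\mathbb N=\{1,2,\dots\}$; $I=[q_1,q_2]$ always has rational endpoints $q_1<q_2$. One fixes Neumann, Robin or Dirichlet boundary conditions: for $1\le i\le N$, $\alpha_i(x)y_i+\kappa\,\partial y_i/\partial n=0$ on $\partial U$, with $\kappa=0,\alpha_i\equiv1$ (Dirichlet), $\kappa=1,\alpha_i\equiv 0$ (Neumann), or $\kappa=1$ and $\alpha_i:\partial U\to\mathbb R$ nonnegative and sufficiently regular (Robin). Put $Y=C(\overline U)$, $X=C(\overline U,\mathbb R^N)$ in the Neumann/Robin case, and $Y=C_0(\overline U)$, $X=C_0(\overline U,\mathbb R^N)$ (continuous functions vanishing on $\partial U$)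 in the Dirichlet case. $\|z\|=\sup_{x\in\overline U}|z(x)|$; $\mathcal B_j=C(\overline U,B_j)$ and $\mathcal B_j^X=\mathcal B_j\cap X$ (same notation for any real radius). Semigroup. $A_i$ is the closure in $Y$ of $A_i^0z_i=\Delta z_i$ with domain $\{z_i\in C^2(U)\cap C^1(\overline U): \Delta z_i\in C(\overline U),\ \alpha_i z_i+\partial z_i/\partial n=0 \text{ on }\partial U\}$ (Neumann/Robin), resp. $\{z_i\in C^2(U)\cap C_0(\overline U):\Delta z_i\in C_0(\overline U)\}$ (Dirichlet). It is a known fact (the regularity of $\partial U$ and $\alpha_i$ is assumed sufficient for it) that $A_i$ is sectorial and generates a strongly continuous analytic semigroup $(e^{tA_i})_{t\ge0}$ on $Y$, with $e^{tA_i}$ compact for $t>0$ and $\|e^{tA_i}\|\le1$. Then $A=\prod_{i=1}^N A_i$ on $X=Y^N$, $e^{tA}=\prod_i e^{tA_i}$, and $\|e^{tA}\|\le N$ for all $t\ge0$ in the operator norm associated to $\|\cdot\|$. Carathéodory maps. $f:\mathbb R\times\overline U\times\mathbb R^N\to\mathbb R^N$ is in $\mathfrak{SC}$ if it is Borel measurable; for every compact $K\subset\mathbb R^N$ there is a nonnegative $m^K\in L^1_{loc}$ (an $m$-bound on $K$) with, for a.e. $t$, $|f(t,x,y)|\le m^K(t)$ for all $x\in\overline U$, $y\in K$; and for a.e. $t$ the map $f(t,\cdot,\cdot)$ is continuous. $f\in\mathfrak{LC}$ if moreover for every compact $K$ there is a nonnegative $l^K\in L^1_{loc}$ such that for a.e.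 $t$, $|f(t,x,y_1)-f(t,x,y_2)|\le l^K(t)|y_1-y_2|$ for all $x\in\overline U$, $y_1,y_2\in K$. Functions differing on a negligible set are identified. In the Dirichlet case it is a standing assumption that all maps $f$ considered satisfy $f(t,x,0)=0$ for all $t\in\mathbb R$, $x\in\partial U$. Set $\tilde f(t,z)(x)=f(t,x,z(x))$. The optimal $m$-bound of $f$ on $B_j$ is $m_f^j(t)=\sup_{x\in\overline U,\,y\in B_j}|f(t,x,y)|$. $E\subset\mathfrak{LC}$ has $L^1_{loc}$-equicontinuous $m$-bounds if for every $j\in\mathbb N$ there is a set $S^j\subset L^1_{loc}$ of $m$-bounds on $B_j$ of the functions of $E$ (containing one for each $f\in E$) such that for all $r,\varepsilon>0$ there is $\delta>0$ with $\sup_{m\in S^j}\int_{t_1}^{t_2}m<\varepsilon$ whenever $-r\le t_1\le t_2\le r$, $t_2-t_1<\delta$. Associated $\Theta=(\Theta_1,\Theta_2)$ and $\mathcal R$. For such $E$, $j\in\mathbb N$, $I=[q_1,q_2]$, integer $\nu\ge1$ with $q_1+1/\nu<q_2$, and $s\ge0$: $\theta_j^I(s)=2N\sup_{t\in I,\,g\in E}\int_t^{t+s}m_g^j$; $\theta^{I,\nu}(s)=\sup\{\|e^{tA}-e^{(t+r)A}\|: t\in[1/\nu,q_2-q_1],\ r\in[0,s]\}$; $\theta_j^{I,\nu}(s)=j\,\theta^{I,\nu}(s)+\theta_j^I(s)+\theta^{I,\nu}(s)\sup_{g\in E}\int_I m_g^j$; $R_j^I=Nj+N\sup_{g\in E}\int_I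 m_g^j$. Then $\Theta_1=\{\theta_j^I\}$, $\Theta_2=\{\theta_j^{I,\nu}\}$, $\mathcal R=\{R_j^I\}$. Sets $\mathcal K_j^I$. $\mathcal K_j^I$ is the set of $v\in C(I,\mathcal B_j)$ such that for every $J=[r_1,r_2]\subseteq I$ with rational endpoints and every integer $\nu\ge1$ with $r_1+1/\nu<r_2$: (i) $\|v(t_1)-v(t_2)\|\le\theta_j^{J,\nu}(|t_1-t_2|)+\theta_j^J(1/\nu)$ for all $t_1,t_2\in[r_1+1/\nu,r_2]$; (ii) $\mathrm d\big(v(t),e^{\frac1\nu A}\mathcal B^X_{R_j^J}\big)\le\theta_j^J(1/\nu)$ for all $t\in[r_1+1/\nu,r_2]$, where $\mathrm d(z,F)=\inf_{\tilde z\in F}\|z-\tilde z\|$. Topology $\sigma_{\Theta\mathcal R}$: the topology on $\mathfrak{SC}$ (restricted to $\mathfrak{LC}$) generated by the seminorms $\tilde p_{I,j}(f)=\sup_{v\in\mathcal K_j^I}\|\int_I\tilde f(s,v(s))\,ds\|$, over $j\in\mathbb N$ and $I=[q_1,q_2]$ with rational endpoints. Mild solutions. For $f\in\mathfrak{LC}$, $z\in X$, a mild solution on $[0,\delta]$ of $u'=Au+\tilde f(t,u)$, $u(0)=z$, is $u\in C([0,\delta],X)$ with $u(t)=e^{tA}z+\int_0^t e^{(t-s)A}\tilde f(s,u(s))\,ds$ for $t\in[0,\delta]$ (Bochner integral); it is unique when it exists. $I_{f,z}$ is the union of all $[0,\delta]$ on which a mild solution exists and $u(\cdot,f,z)$ is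 the resulting maximal mild solution on $I_{f,z}$. "$u_n\to u$ uniformly on $[0,T]$" means that $u_n$ is defined on $[0,T]$ for all large $n$ and $\sup_{t\in[0,T]}\|u_n(t)-u(t)\|\to0$. *)

theory Defs
  imports "HOL-Analysis.Analysis" "HOL-Library.Function_Algebras"
begin

section \<open>Spaces of continuous functions on the closure of the domain\<close>

datatype bdry_cond = Dirichlet | Neumann | Robin

definition l1_norm :: "real ^ 'n \<Rightarrow> real" where
  "l1_norm y = (\<Sum>i\<in>UNIV. \<bar>y $ i\<bar>)"

definition l1_ball :: "real \<Rightarrow> (real ^ 'n) set" where
  "l1_ball r = {y. l1_norm y \<le> r}"

text \<open>A function on the closure of \<open>U\<close> is represented by its extension by \<open>0\<close>, so that equality of
  elements of the function spaces is equality in HOL and the pointwise operations restrict to them.\<close>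

definition Cbar :: "(real ^ 'm) set \<Rightarrow> (real ^ 'm \<Rightarrow> 'b::real_normed_vector) set" where
  "Cbar U = {z. continuous_on (closure U) z \<and> (\<forall>x. x \<notin> closure U \<longrightarrow> z x = 0)}"

text \<open>For codomain \<open>real\<close> this is \<open>Y\<close>, for \<open>real ^ 'n\<close> it is \<open>X\<close>, for \<open>complex\<close> it is the
  complexification of \<open>Y\<close>.\<close>

definition bc_space :: "(real ^ 'm) set \<Rightarrow> bdry_cond \<Rightarrow> (real ^ 'm \<Rightarrow> 'b::real_normed_vector) set" where
  "bc_space U bc = {z \<in> Cbar U. bc = Dirichlet \<longrightarrow> (\<forall>x\<in>frontier U. z x = 0)}"

definition sup_norm :: "(real ^ 'm) set \<Rightarrow> (real ^ 'm \<Rightarrow> 'b::real_normed_vector) \<Rightarrow> real" where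
  "sup_norm U z = (SUP x\<in>closure U. norm (z x))"

text \<open>On vector-valued functions the norm of the values is the \<open>l1\<close> norm, not the Euclidean norm.\<close>

definition Xnorm :: "(real ^ 'm) set \<Rightarrow> (real ^ 'm \<Rightarrow> real ^ 'n) \<Rightarrow> real" where
  "Xnorm U z = (SUP x\<in>closure U. l1_norm (z x))"

definition Cball :: "(real ^ 'm) set \<Rightarrow> real \<Rightarrow> (real ^ 'm \<Rightarrow> real ^ 'n) set" where
  "Cball U r = {z \<in> Cbar U. \<forall>x\<in>closure U. z x \<in> l1_ball r}"

definition X_opnorm ::
  "(real ^ 'm) set \<Rightarrow> bdry_cond \<Rightarrow> ((real ^ 'm \<Rightarrow> real ^ 'n) \<Rightarrow> real ^ 'm \<Rightarrow> real ^ 'n) \<Rightarrow> real" where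
  "X_opnorm U bc T = (SUP z\<in>{z \<in> bc_space U bc. Xnorm U z \<le> 1}. Xnorm U (T z))"


section \<open>The Laplacian with boundary conditions\<close>

definition grad :: "(real ^ 'm \<Rightarrow> real) \<Rightarrow> real ^ 'm \<Rightarrow> real ^ 'm" where
  "grad z x = (\<chi> i. frechet_derivative z (at x) (axis i 1))"

definition laplacian :: "(real ^ 'm \<Rightarrow> real) \<Rightarrow> real ^ 'm \<Rightarrow> real" where
  "laplacian z x = (\<Sum>i\<in>UNIV. frechet_derivative (\<lambda>y. grad z y $ i) (at x) (axis i 1))"

text \<open>The next two notions are meant for open \<open>V\<close>.\<close>

definition C1_on :: "(real ^ 'm) set \<Rightarrow> (real ^ 'm \<Rightarrow> real) \<Rightarrow> bool" where
  "C1_on V z \<longleftrightarrow> (\<forall>x\<in>V. z differentiable (at x)) \<and> continuous_on V (grad z)"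

definition C2_on :: "(real ^ 'm) set \<Rightarrow> (real ^ 'm \<Rightarrow> real) \<Rightarrow> bool" where
  "C2_on V z \<longleftrightarrow> C1_on V z \<and> (\<forall>i. C1_on V (\<lambda>x. grad z x $ i))"

definition is_outward_normal :: "(real ^ 'm) set \<Rightarrow> real ^ 'm \<Rightarrow> real ^ 'm \<Rightarrow> bool" where
  "is_outward_normal U x n \<longleftrightarrow>
    (\<exists>V \<phi>. open V \<and> x \<in> V \<and> C1_on V \<phi> \<and> grad \<phi> x \<noteq> 0 \<and>
       U \<inter> V = {y \<in> V. \<phi> y < 0} \<and> frontier U \<inter> V = {y \<in> V. \<phi> y = 0} \<and>
       n = grad \<phi> x /\<^sub>R norm (grad \<phi> x))"

definition outward_normal :: "(real ^ 'm) set \<Rightarrow> real ^ 'm \<Rightarrow> real ^ 'm" where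
  "outward_normal U x = (THE n. is_outward_normal U x n)"

text \<open>The domain lies locally on one side of a \<open>C\<^sup>1\<close> hypersurface. This is what is needed for the
  normal derivative to make sense; any further smoothness of the boundary and of the coefficients
  enters only through the generation property \<open>heat_semigroup\<close> below.\<close>

definition C1_boundary :: "(real ^ 'm) set \<Rightarrow> bool" where
  "C1_boundary U \<longleftrightarrow> (\<forall>x\<in>frontier U. \<exists>n. is_outward_normal U x n)"

definition boundary_coeff :: "(real ^ 'm) set \<Rightarrow> bdry_cond \<Rightarrow> (real ^ 'm \<Rightarrow> real) \<Rightarrow> bool" where
  "boundary_coeff U bc \<alpha> \<longleftrightarrow>
    (case bc of
       Dirichlet \<Rightarrow> (\<forall>x\<in>frontier U. \<alpha> x = 1)
     | Neumann \<Rightarrow> (\<forall>x\<in>frontier U. \<alpha> x = 0)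
     | Robin \<Rightarrow> continuous_on (frontier U) \<alpha> \<and> (\<forall>x\<in>frontier U. 0 \<le> \<alpha> x))"

text \<open>Unbounded operators on \<open>Y\<close> are represented by their graphs. The function \<open>G\<close> is the continuous
  extension of the gradient to the closure of \<open>U\<close>, whose existence means that \<open>z\<close> is \<open>C\<^sup>1\<close> up to
  the boundary. In the Dirichlet case the boundary condition is contained in \<open>bc_space\<close>.\<close>

definition laplace_graph ::
  "(real ^ 'm) set \<Rightarrow> bdry_cond \<Rightarrow> (real ^ 'm \<Rightarrow> real) \<Rightarrow>
    ((real ^ 'm \<Rightarrow> real) \<times> (real ^ 'm \<Rightarrow> real)) set" where
  "laplace_graph U bc \<alpha> =
    {(z, w). z \<in> bc_space U bc \<and> w \<in> bc_space U bc \<and> C2_on U z \<and> (\<forall>x\<in>U. w x = laplacian z x) \<and>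
       (bc \<noteq> Dirichlet \<longrightarrow>
         (\<exists>G. continuous_on (closure U) G \<and> (\<forall>x\<in>U. G x = grad z x) \<and>
           (\<forall>x\<in>frontier U. \<alpha> x * z x + G x \<bullet> outward_normal U x = 0)))}"

definition graph_closure ::
  "(real ^ 'm) set \<Rightarrow> bdry_cond \<Rightarrow> ((real ^ 'm \<Rightarrow> real) \<times> (real ^ 'm \<Rightarrow> real)) set \<Rightarrow>
    ((real ^ 'm \<Rightarrow> real) \<times> (real ^ 'm \<Rightarrow> real)) set" where
  "graph_closure U bc A =
    {(z, w). z \<in> bc_space U bc \<and> w \<in> bc_space U bc \<and>
       (\<exists>zs ws. (\<forall>k::nat. (zs k, ws k) \<in> A) \<and>
          (\<lambda>k. sup_norm U (zs k - z)) \<longlonglongrightarrow> 0 \<and> (\<lambda>k. sup_norm U (ws k - w)) \<longlonglongrightarrow> 0)}"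

definition complexify ::
  "((real ^ 'm \<Rightarrow> real) \<times> (real ^ 'm \<Rightarrow> real)) set \<Rightarrow>
    ((real ^ 'm \<Rightarrow> complex) \<times> (real ^ 'm \<Rightarrow> complex)) set" where
  "complexify A =
    {(z, w). (\<lambda>x. Re (z x), \<lambda>x. Re (w x)) \<in> A \<and> (\<lambda>x. Im (z x), \<lambda>x. Im (w x)) \<in> A}"

text \<open>The complexified operator has every \<open>\<mu>\<close> of a sector with vertex \<open>\<omega>\<close> and half-angle \<open>\<theta> > \<pi>/2\<close> in its
  resolvent set, with resolvent bounded by \<open>C / \<bar>\<mu> - \<omega>\<bar>\<close>.\<close>

definition sectorial ::
  "(real ^ 'm) set \<Rightarrow> bdry_cond \<Rightarrow> ((real ^ 'm \<Rightarrow> real) \<times> (real ^ 'm \<Rightarrow> real)) set \<Rightarrow> bool" where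
  "sectorial U bc A \<longleftrightarrow>
    (\<exists>(\<omega>::real) \<theta> C. pi / 2 < \<theta> \<and> \<theta> < pi \<and> C > 0 \<and>
      (\<forall>\<mu>::complex. \<mu> \<noteq> of_real \<omega> \<and> \<bar>Arg (\<mu> - of_real \<omega>)\<bar> < \<theta> \<longrightarrow>
         (\<forall>g \<in> bc_space U bc. \<exists>!z. (z, (\<lambda>x. \<mu> * z x - g x)) \<in> complexify A) \<and>
         (\<forall>(z, w) \<in> complexify A.
            sup_norm U z \<le> C / norm (\<mu> - of_real \<omega>) * sup_norm U (\<lambda>x. \<mu> * z x - w x))))"


section \<open>Semigroups\<close>

definition bounded_op_on_Y ::
  "(real ^ 'm) set \<Rightarrow> bdry_cond \<Rightarrow> ((real ^ 'm \<Rightarrow> real) \<Rightarrow> real ^ 'm \<Rightarrow> real) \<Rightarrow> bool" where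
  "bounded_op_on_Y U bc T \<longleftrightarrow>
    (\<forall>z \<in> bc_space U bc. T z \<in> bc_space U bc) \<and>
    (\<forall>z \<in> bc_space U bc. \<forall>w \<in> bc_space U bc. T (z + w) = T z + T w) \<and>
    (\<forall>z \<in> bc_space U bc. \<forall>c. T (\<lambda>x. c * z x) = (\<lambda>x. c * T z x)) \<and>
    (\<exists>C. \<forall>z \<in> bc_space U bc. sup_norm U (T z) \<le> C * sup_norm U z)"

definition Y_opnorm ::
  "(real ^ 'm) set \<Rightarrow> bdry_cond \<Rightarrow> ((real ^ 'm \<Rightarrow> real) \<Rightarrow> real ^ 'm \<Rightarrow> real) \<Rightarrow> real" where
  "Y_opnorm U bc T = (SUP z\<in>{z \<in> bc_space U bc. sup_norm U z \<le> 1}. sup_norm U (T z))"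

definition C0_semigroup ::
  "(real ^ 'm) set \<Rightarrow> bdry_cond \<Rightarrow> (real \<Rightarrow> (real ^ 'm \<Rightarrow> real) \<Rightarrow> real ^ 'm \<Rightarrow> real) \<Rightarrow> bool" where
  "C0_semigroup U bc S \<longleftrightarrow>
    (\<forall>t\<ge>0. bounded_op_on_Y U bc (S t)) \<and>
    (\<forall>z \<in> bc_space U bc. S 0 z = z) \<and>
    (\<forall>s\<ge>0. \<forall>t\<ge>0. \<forall>z \<in> bc_space U bc. S (s + t) z = S s (S t z)) \<and>
    (\<forall>z \<in> bc_space U bc. ((\<lambda>t. sup_norm U (S t z - z)) \<longlongrightarrow> 0) (at_right 0))"

definition generator ::
  "(real ^ 'm) set \<Rightarrow> bdry_cond \<Rightarrow> (real \<Rightarrow> (real ^ 'm \<Rightarrow> real) \<Rightarrow> real ^ 'm \<Rightarrow> real) \<Rightarrow>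
    ((real ^ 'm \<Rightarrow> real) \<times> (real ^ 'm \<Rightarrow> real)) set" where
  "generator U bc S =
    {(z, w). z \<in> bc_space U bc \<and> w \<in> bc_space U bc \<and>
       ((\<lambda>t. sup_norm U (\<lambda>x. (S t z x - z x) / t - w x)) \<longlongrightarrow> 0) (at_right 0)}"

text \<open>Analyticity of \<open>t \<mapsto> S t\<close> on \<open>(0, \<infinity>)\<close> as a map into the bounded operators: local power series
  expansions converging in operator norm.\<close>

definition analytic_semigroup ::
  "(real ^ 'm) set \<Rightarrow> bdry_cond \<Rightarrow> (real \<Rightarrow> (real ^ 'm \<Rightarrow> real) \<Rightarrow> real ^ 'm \<Rightarrow> real) \<Rightarrow> bool" where
  "analytic_semigroup U bc S \<longleftrightarrow>
    (\<forall>t0>0. \<exists>r>0. \<exists>C::nat \<Rightarrow> (real ^ 'm \<Rightarrow> real) \<Rightarrow> real ^ 'm \<Rightarrow> real.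
       (\<forall>k. bounded_op_on_Y U bc (C k)) \<and>
       (\<forall>t>0. \<bar>t - t0\<bar> < r \<longrightarrow>
          (\<lambda>n. Y_opnorm U bc (\<lambda>z x. S t z x - (\<Sum>k<n. (t - t0) ^ k * C k z x))) \<longlonglongrightarrow> 0))"

definition compact_op_on_Y ::
  "(real ^ 'm) set \<Rightarrow> bdry_cond \<Rightarrow> ((real ^ 'm \<Rightarrow> real) \<Rightarrow> real ^ 'm \<Rightarrow> real) \<Rightarrow> bool" where
  "compact_op_on_Y U bc T \<longleftrightarrow>
    (\<forall>zs::nat \<Rightarrow> real ^ 'm \<Rightarrow> real.
       (\<forall>k. zs k \<in> bc_space U bc \<and> sup_norm U (zs k) \<le> 1) \<longrightarrow>
       (\<exists>\<rho> w. strict_mono \<rho> \<and> w \<in> bc_space U bc \<and> (\<lambda>k. sup_norm U (T (zs (\<rho> k)) - w)) \<longlonglongrightarrow> 0))"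

text \<open>\<open>S t\<close> is \<open>e\<^sup>t\<^sup>A\<close> on \<open>Y\<close>, where \<open>A\<close> is the closure of the Laplacian with the given boundary
  condition. That such an \<open>S\<close> exists is the known generation result for which the boundary and
  the coefficient are assumed sufficiently regular; by uniqueness of the semigroup with a given
  generator, \<open>S t\<close> is determined on \<open>Y\<close> for all \<open>t \<ge> 0\<close>.\<close>

definition heat_semigroup ::
  "(real ^ 'm) set \<Rightarrow> bdry_cond \<Rightarrow> (real ^ 'm \<Rightarrow> real) \<Rightarrow>
    (real \<Rightarrow> (real ^ 'm \<Rightarrow> real) \<Rightarrow> real ^ 'm \<Rightarrow> real) \<Rightarrow> bool" where
  "heat_semigroup U bc \<alpha> S \<longleftrightarrow>
    sectorial U bc (graph_closure U bc (laplace_graph U bc \<alpha>)) \<and>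
    C0_semigroup U bc S \<and>
    generator U bc S = graph_closure U bc (laplace_graph U bc \<alpha>) \<and>
    analytic_semigroup U bc S \<and>
    (\<forall>t>0. compact_op_on_Y U bc (S t)) \<and>
    (\<forall>t\<ge>0. \<forall>z \<in> bc_space U bc. sup_norm U (S t z) \<le> sup_norm U z)"

definition product_semigroup ::
  "('n::finite \<Rightarrow> real \<Rightarrow> (real ^ 'm \<Rightarrow> real) \<Rightarrow> real ^ 'm \<Rightarrow> real) \<Rightarrow>
    real \<Rightarrow> (real ^ 'm \<Rightarrow> real ^ 'n) \<Rightarrow> real ^ 'm \<Rightarrow> real ^ 'n" where
  "product_semigroup S t z = (\<lambda>x. \<chi> i. S i t (\<lambda>x'. z x' $ i) x)"


section \<open>Bochner integral with values in the continuous functions on the closure\<close>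

text \<open>The Bochner integral of \<open>HOL-Analysis\<close> is available only for second countable types, which does
  not cover the set \<open>Cbar U\<close>. The definition is the usual one: the integrand is a.e. a limit of
  simple functions, and the integral is the limit of integrals of simple functions that
  approximate the integrand in mean.\<close>

definition simple_Cbar ::
  "(real ^ 'm) set \<Rightarrow> real measure \<Rightarrow> (real \<Rightarrow> real ^ 'm \<Rightarrow> real ^ 'n) \<Rightarrow> bool" where
  "simple_Cbar U M s \<longleftrightarrow>
    simple_function M s \<and> (\<forall>t\<in>space M. s t \<in> Cbar U) \<and> emeasure M {t \<in> space M. s t \<noteq> 0} \<noteq> \<infinity>"

definition simple_integral_Cbar ::
  "real measure \<Rightarrow> (real \<Rightarrow> real ^ 'm \<Rightarrow> real ^ 'n) \<Rightarrow> real ^ 'm \<Rightarrow> real ^ 'n" where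
  "simple_integral_Cbar M s =
    (\<lambda>x. \<Sum>w\<in>s ` space M. measure M {t \<in> space M. s t = w} *\<^sub>R w x)"

definition strongly_measurable ::
  "(real ^ 'm) set \<Rightarrow> real measure \<Rightarrow> (real \<Rightarrow> real ^ 'm \<Rightarrow> real ^ 'n) \<Rightarrow> bool" where
  "strongly_measurable U M \<phi> \<longleftrightarrow>
    (AE t in M. \<phi> t \<in> Cbar U) \<and>
    (\<exists>s. (\<forall>k::nat. simple_Cbar U M (s k)) \<and> (AE t in M. (\<lambda>k. Xnorm U (s k t - \<phi> t)) \<longlonglongrightarrow> 0))"

definition has_bochner_integral_Cbar ::
  "(real ^ 'm) set \<Rightarrow> real measure \<Rightarrow> (real \<Rightarrow> real ^ 'm \<Rightarrow> real ^ 'n) \<Rightarrow>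
    (real ^ 'm \<Rightarrow> real ^ 'n) \<Rightarrow> bool" where
  "has_bochner_integral_Cbar U M \<phi> w \<longleftrightarrow>
    strongly_measurable U M \<phi> \<and> w \<in> Cbar U \<and>
    (\<exists>s. (\<forall>k::nat. simple_Cbar U M (s k)) \<and>
       (\<lambda>k. \<integral>\<^sup>+ t. ennreal (Xnorm U (s k t - \<phi> t)) \<partial>M) \<longlonglongrightarrow> 0 \<and>
       (\<lambda>k. Xnorm U (simple_integral_Cbar M (s k) - w)) \<longlonglongrightarrow> 0)"

definition bochner_integral_Cbar ::
  "(real ^ 'm) set \<Rightarrow> real measure \<Rightarrow> (real \<Rightarrow> real ^ 'm \<Rightarrow> real ^ 'n) \<Rightarrow> real ^ 'm \<Rightarrow> real ^ 'n" where
  "bochner_integral_Cbar U M \<phi> = (THE w. has_bochner_integral_Cbar U M \<phi> w)"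


section \<open>Caratheodory maps\<close>

definition L1loc :: "(real \<Rightarrow> real) set" where
  "L1loc = {m. \<forall>a b. set_integrable lebesgue {a..b} m}"

definition m_bound ::
  "(real ^ 'm) set \<Rightarrow> (real \<Rightarrow> real ^ 'm \<Rightarrow> real ^ 'n \<Rightarrow> real ^ 'n) \<Rightarrow> (real ^ 'n) set \<Rightarrow>
    (real \<Rightarrow> real) \<Rightarrow> bool" where
  "m_bound U f K m \<longleftrightarrow>
    m \<in> L1loc \<and> (\<forall>t. 0 \<le> m t) \<and>
    (AE t in lebesgue. \<forall>x\<in>closure U. \<forall>y\<in>K. l1_norm (f t x y) \<le> m t)"

definition SC :: "(real ^ 'm) set \<Rightarrow> (real \<Rightarrow> real ^ 'm \<Rightarrow> real ^ 'n \<Rightarrow> real ^ 'n) set" where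
  "SC U = {f.
    (\<lambda>(t, x, y). f t x y) \<in> borel_measurable (restrict_space borel (UNIV \<times> closure U \<times> UNIV)) \<and>
    (\<forall>K. compact K \<longrightarrow> (\<exists>m. m_bound U f K m)) \<and>
    (AE t in lebesgue. continuous_on (closure U \<times> UNIV) (\<lambda>(x, y). f t x y))}"

definition LC :: "(real ^ 'm) set \<Rightarrow> (real \<Rightarrow> real ^ 'm \<Rightarrow> real ^ 'n \<Rightarrow> real ^ 'n) set" where
  "LC U = {f \<in> SC U. \<forall>K. compact K \<longrightarrow>
    (\<exists>l \<in> L1loc. (\<forall>t. 0 \<le> l t) \<and>
      (AE t in lebesgue. \<forall>x\<in>closure U. \<forall>y1\<in>K. \<forall>y2\<in>K.
         l1_norm (f t x y1 - f t x y2) \<le> l t * l1_norm (y1 - y2)))}"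

definition nemytskii ::
  "(real ^ 'm) set \<Rightarrow> (real \<Rightarrow> real ^ 'm \<Rightarrow> real ^ 'n \<Rightarrow> real ^ 'n) \<Rightarrow>
    real \<Rightarrow> (real ^ 'm \<Rightarrow> real ^ 'n) \<Rightarrow> real ^ 'm \<Rightarrow> real ^ 'n" where
  "nemytskii U f t z = (\<lambda>x. if x \<in> closure U then f t x (z x) else 0)"

definition opt_m_bound ::
  "(real ^ 'm) set \<Rightarrow> (real \<Rightarrow> real ^ 'm \<Rightarrow> real ^ 'n \<Rightarrow> real ^ 'n) \<Rightarrow> nat \<Rightarrow> real \<Rightarrow> real" where
  "opt_m_bound U f j t = (SUP (x, y)\<in>closure U \<times> l1_ball (real j). l1_norm (f t x y))"

definition L1loc_equicontinuous_m_bounds ::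
  "(real ^ 'm) set \<Rightarrow> (real \<Rightarrow> real ^ 'm \<Rightarrow> real ^ 'n \<Rightarrow> real ^ 'n) set \<Rightarrow> bool" where
  "L1loc_equicontinuous_m_bounds U E \<longleftrightarrow>
    (\<forall>j::nat. 1 \<le> j \<longrightarrow>
      (\<exists>\<S>. (\<forall>m\<in>\<S>. \<exists>g\<in>E. m_bound U g (l1_ball (real j)) m) \<and>
           (\<forall>g\<in>E. \<exists>m\<in>\<S>. m_bound U g (l1_ball (real j)) m) \<and>
           (\<forall>r>0. \<forall>\<epsilon>>0. \<exists>\<delta>>0. \<forall>t1 t2. - r \<le> t1 \<and> t1 \<le> t2 \<and> t2 \<le> r \<and> t2 - t1 < \<delta> \<longrightarrow>
              (SUP m\<in>\<S>. ereal (LINT s:{t1..t2}|lebesgue. m s)) < ereal \<epsilon>)))"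


section \<open>The associated moduli of continuity, radii, and topology\<close>

text \<open>In the following, an interval \<open>[q1, q2]\<close> is passed as the two arguments \<open>q1\<close> and \<open>q2\<close>.\<close>

definition theta1 ::
  "(real ^ 'm) set \<Rightarrow> (real \<Rightarrow> real ^ 'm \<Rightarrow> real ^ 'n \<Rightarrow> real ^ 'n) set \<Rightarrow>
    nat \<Rightarrow> real \<Rightarrow> real \<Rightarrow> real \<Rightarrow> real" where
  "theta1 U E j q1 q2 s =
    2 * real CARD('n) *
      (SUP (t, g)\<in>{q1..q2} \<times> E. LINT r:{t..t + s}|lebesgue. opt_m_bound U g j r)"

definition theta_sg ::
  "(real ^ 'm) set \<Rightarrow> bdry_cond \<Rightarrow> ('n::finite \<Rightarrow> real \<Rightarrow> (real ^ 'm \<Rightarrow> real) \<Rightarrow> real ^ 'm \<Rightarrow> real) \<Rightarrow>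
    real \<Rightarrow> real \<Rightarrow> nat \<Rightarrow> real \<Rightarrow> real" where
  "theta_sg U bc S q1 q2 \<nu> s =
    (SUP (t, r)\<in>{1 / real \<nu>..q2 - q1} \<times> {0..s}.
       X_opnorm U bc (\<lambda>z. product_semigroup S t z - product_semigroup S (t + r) z))"

definition theta2 ::
  "(real ^ 'm) set \<Rightarrow> bdry_cond \<Rightarrow> ('n::finite \<Rightarrow> real \<Rightarrow> (real ^ 'm \<Rightarrow> real) \<Rightarrow> real ^ 'm \<Rightarrow> real) \<Rightarrow>
    (real \<Rightarrow> real ^ 'm \<Rightarrow> real ^ 'n \<Rightarrow> real ^ 'n) set \<Rightarrow>
    nat \<Rightarrow> real \<Rightarrow> real \<Rightarrow> nat \<Rightarrow> real \<Rightarrow> real" where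
  "theta2 U bc S E j q1 q2 \<nu> s =
    real j * theta_sg U bc S q1 q2 \<nu> s + theta1 U E j q1 q2 s +
    theta_sg U bc S q1 q2 \<nu> s * (SUP g\<in>E. LINT r:{q1..q2}|lebesgue. opt_m_bound U g j r)"

definition radius ::
  "(real ^ 'm) set \<Rightarrow> (real \<Rightarrow> real ^ 'm \<Rightarrow> real ^ 'n \<Rightarrow> real ^ 'n) set \<Rightarrow>
    nat \<Rightarrow> real \<Rightarrow> real \<Rightarrow> real" where
  "radius U E j q1 q2 =
    real CARD('n) * real j +
    real CARD('n) * (SUP g\<in>E. LINT r:{q1..q2}|lebesgue. opt_m_bound U g j r)"

definition Xdist ::
  "(real ^ 'm) set \<Rightarrow> (real ^ 'm \<Rightarrow> real ^ 'n) \<Rightarrow> (real ^ 'm \<Rightarrow> real ^ 'n) set \<Rightarrow> real" where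
  "Xdist U z F = (INF w\<in>F. Xnorm U (z - w))"

text \<open>Continuity on \<open>D\<close> with respect to the sup norm (the topology of the function type itself is
  that of pointwise convergence).\<close>

definition norm_continuous_on ::
  "(real ^ 'm) set \<Rightarrow> real set \<Rightarrow> (real \<Rightarrow> real ^ 'm \<Rightarrow> real ^ 'n) \<Rightarrow> bool" where
  "norm_continuous_on U D v \<longleftrightarrow>
    (\<forall>t\<in>D. ((\<lambda>s. Xnorm U (v s - v t)) \<longlongrightarrow> 0) (at t within D))"

definition K_set ::
  "(real ^ 'm) set \<Rightarrow> bdry_cond \<Rightarrow> ('n::finite \<Rightarrow> real \<Rightarrow> (real ^ 'm \<Rightarrow> real) \<Rightarrow> real ^ 'm \<Rightarrow> real) \<Rightarrow>
    (nat \<Rightarrow> real \<Rightarrow> real \<Rightarrow> real \<Rightarrow> real) \<Rightarrow> (nat \<Rightarrow> real \<Rightarrow> real \<Rightarrow> nat \<Rightarrow> real \<Rightarrow> real) \<Rightarrow>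
    (nat \<Rightarrow> real \<Rightarrow> real \<Rightarrow> real) \<Rightarrow> nat \<Rightarrow> real \<Rightarrow> real \<Rightarrow> (real \<Rightarrow> real ^ 'm \<Rightarrow> real ^ 'n) set" where
  "K_set U bc S \<Theta>1 \<Theta>2 R j q1 q2 =
    {v. (\<forall>t\<in>{q1..q2}. v t \<in> Cball U (real j)) \<and> norm_continuous_on U {q1..q2} v \<and>
      (\<forall>r1 r2. \<forall>\<nu>::nat. r1 \<in> \<rat> \<and> r2 \<in> \<rat> \<and> {r1..r2} \<subseteq> {q1..q2} \<and> 1 \<le> \<nu> \<and> r1 + 1 / real \<nu> < r2 \<longrightarrow>
        (\<forall>t1\<in>{r1 + 1 / real \<nu>..r2}. \<forall>t2\<in>{r1 + 1 / real \<nu>..r2}.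
           Xnorm U (v t1 - v t2) \<le> \<Theta>2 j r1 r2 \<nu> \<bar>t1 - t2\<bar> + \<Theta>1 j r1 r2 (1 / real \<nu>)) \<and>
        (\<forall>t\<in>{r1 + 1 / real \<nu>..r2}.
           Xdist U (v t)
             (product_semigroup S (1 / real \<nu>) ` (Cball U (R j r1 r2) \<inter> bc_space U bc))
             \<le> \<Theta>1 j r1 r2 (1 / real \<nu>)))}"

definition seminorm_K ::
  "(real ^ 'm) set \<Rightarrow> (real \<Rightarrow> real ^ 'm \<Rightarrow> real ^ 'n) set \<Rightarrow> real \<Rightarrow> real \<Rightarrow>
    (real \<Rightarrow> real ^ 'm \<Rightarrow> real ^ 'n \<Rightarrow> real ^ 'n) \<Rightarrow> real" where
  "seminorm_K U \<K> q1 q2 f =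
    (SUP v\<in>\<K>. Xnorm U (bochner_integral_Cbar U (lebesgue_on {q1..q2}) (\<lambda>s. nemytskii U f s (v s))))"

definition sigma_topology ::
  "(real ^ 'm) set \<Rightarrow> bdry_cond \<Rightarrow> ('n::finite \<Rightarrow> real \<Rightarrow> (real ^ 'm \<Rightarrow> real) \<Rightarrow> real ^ 'm \<Rightarrow> real) \<Rightarrow>
    (nat \<Rightarrow> real \<Rightarrow> real \<Rightarrow> real \<Rightarrow> real) \<Rightarrow> (nat \<Rightarrow> real \<Rightarrow> real \<Rightarrow> nat \<Rightarrow> real \<Rightarrow> real) \<Rightarrow>
    (nat \<Rightarrow> real \<Rightarrow> real \<Rightarrow> real) \<Rightarrow> (real \<Rightarrow> real ^ 'm \<Rightarrow> real ^ 'n \<Rightarrow> real ^ 'n) topology" where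
  "sigma_topology U bc S \<Theta>1 \<Theta>2 R =
    topology_generated_by
      {{g \<in> SC U. seminorm_K U (K_set U bc S \<Theta>1 \<Theta>2 R j q1 q2) q1 q2 (g - h) < \<epsilon>} | h j q1 q2 \<epsilon>.
        h \<in> SC U \<and> 1 \<le> j \<and> q1 \<in> \<rat> \<and> q2 \<in> \<rat> \<and> q1 < q2 \<and> 0 < \<epsilon>}"


section \<open>Mild solutions\<close>

definition mild_solution ::
  "(real ^ 'm) set \<Rightarrow> bdry_cond \<Rightarrow> ('n::finite \<Rightarrow> real \<Rightarrow> (real ^ 'm \<Rightarrow> real) \<Rightarrow> real ^ 'm \<Rightarrow> real) \<Rightarrow>
    (real \<Rightarrow> real ^ 'm \<Rightarrow> real ^ 'n \<Rightarrow> real ^ 'n) \<Rightarrow> (real ^ 'm \<Rightarrow> real ^ 'n) \<Rightarrow> real \<Rightarrow>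
    (real \<Rightarrow> real ^ 'm \<Rightarrow> real ^ 'n) \<Rightarrow> bool" where
  "mild_solution U bc S f z \<delta> u \<longleftrightarrow>
    (\<forall>t\<in>{0..\<delta>}. u t \<in> bc_space U bc) \<and> norm_continuous_on U {0..\<delta>} u \<and>
    (\<forall>t\<in>{0..\<delta>}. \<exists>w.
       has_bochner_integral_Cbar U (lebesgue_on {0..t})
         (\<lambda>s. product_semigroup S (t - s) (nemytskii U f s (u s))) w \<and>
       u t = product_semigroup S t z + w)"

definition mild_interval ::
  "(real ^ 'm) set \<Rightarrow> bdry_cond \<Rightarrow> ('n::finite \<Rightarrow> real \<Rightarrow> (real ^ 'm \<Rightarrow> real) \<Rightarrow> real ^ 'm \<Rightarrow> real) \<Rightarrow>
    (real \<Rightarrow> real ^ 'm \<Rightarrow> real ^ 'n \<Rightarrow> real ^ 'n) \<Rightarrow> (real ^ 'm \<Rightarrow> real ^ 'n) \<Rightarrow> real set" where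
  "mild_interval U bc S f z = \<Union>{{0..\<delta>} | \<delta>. 0 < \<delta> \<and> (\<exists>u. mild_solution U bc S f z \<delta> u)}"

definition maximal_mild_solution ::
  "(real ^ 'm) set \<Rightarrow> bdry_cond \<Rightarrow> ('n::finite \<Rightarrow> real \<Rightarrow> (real ^ 'm \<Rightarrow> real) \<Rightarrow> real ^ 'm \<Rightarrow> real) \<Rightarrow>
    (real \<Rightarrow> real ^ 'm \<Rightarrow> real ^ 'n \<Rightarrow> real ^ 'n) \<Rightarrow> (real ^ 'm \<Rightarrow> real ^ 'n) \<Rightarrow>
    real \<Rightarrow> real ^ 'm \<Rightarrow> real ^ 'n" where
  "maximal_mild_solution U bc S f z t =
    (THE w. \<exists>\<delta> u. 0 < \<delta> \<and> t \<in> {0..\<delta>} \<and> mild_solution U bc S f z \<delta> u \<and> u t = w)"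

end

(*
  Since the f n have equi-integrable m-bounds, a solution u n with norm at most j belongs to the sets
  K_j^I, so convergence in the topology controls the integral of (f n - f)(s, u n s) over every rational
  interval. Operator norm continuity of the semigroup away from 0 (a consequence of compactness)
  makes e^((t - s)A) nearly constant on the cells of a fine rational grid, except for s close to t,
  where equi-integrability helps. Hence the integral of e^((t - s)A) (f n - f)(s, u n s) over [0, t]
  is small uniformly in t, and the Lipschitz bound of f together with Gronwall's inequality gives
  u n -> u as long as u n has norm at most j. With j > sup |u| + 1 a first exit argument removes this
  proviso. For existence, u n is taken as the global solution of the equation truncated at level j,
  so that no continuation argument is needed. Integrals in C(closure U) are handled pointwise in x.
*)
theory Submission
  imports Defs
begin

section \<open>Norms and function spaces\<close>

text \<open>The limit \<open>f\<close> need not lie in \<open>E\<close>, and the Lipschitz functions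
  of different maps of \<open>E\<close> may be unrelated. The difference of the nonlinear terms is
  therefore always split as f n - f along the trajectory of f n, where membership in the sets K is
  available, plus the increment of \<open>f\<close> between the two trajectories. The seminorms see
  integrals of f n - f without the semigroup. Freezing the operator on a grid cell must not depend
  on the integrand, which ranges over a set that is bounded only in mean; strong continuity would
  not suffice, operator norm continuity does. Since integrals are taken at each x separately, this
  commutation is the technical core: a function is approximated by finitely many fixed functions
  with its values at finitely many points as coefficients, so that operators and integrals meet only
  in finite sums. The same device yields measurability and the link to the Bochner integral. The
  factor CARD('n) in most estimates is the bound N of e^(tA) for the l1 norm.\<close>

lemma l1_norm_nonneg [simp]: "0 \<le> l1_norm y"
  by (simp add: l1_norm_def sum_nonneg)

lemma l1_norm_zero [simp]: "l1_norm 0 = 0"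
  by (simp add: l1_norm_def)

lemma l1_norm_triangle: "l1_norm (x + y) \<le> l1_norm x + l1_norm y"
  unfolding l1_norm_def by (simp add: sum.distrib [symmetric] sum_mono abs_triangle_ineq)

lemma l1_norm_uminus [simp]: "l1_norm (- y) = l1_norm y"
  by (simp add: l1_norm_def)

lemma l1_norm_minus_commute: "l1_norm (x - y) = l1_norm (y - x)"
  unfolding l1_norm_def by (simp add: abs_minus_commute)

lemma l1_norm_diff_triangle: "l1_norm (x - z) \<le> l1_norm (x - y) + l1_norm (y - z)"
  using l1_norm_triangle [of "x - y" "y - z"] by simp

lemma l1_norm_scaleR: "l1_norm (c *\<^sub>R y) = \<bar>c\<bar> * l1_norm y"
  by (simp add: l1_norm_def abs_mult sum_distrib_left)

lemma l1_norm_sum: "l1_norm (sum f A) \<le> (\<Sum>i\<in>A. l1_norm (f i))"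
proof (induction A rule: infinite_finite_induct)
  case (insert x F)
  then show ?case using l1_norm_triangle [of "f x" "sum f F"] by simp
qed auto

lemma component_le_l1_norm: "\<bar>y $ i\<bar> \<le> l1_norm y"
  unfolding l1_norm_def by (rule member_le_sum) auto

lemma norm_le_l1_norm: "norm y \<le> l1_norm y"
  unfolding l1_norm_def by (rule norm_le_l1_cart)

lemma l1_norm_le_norm: "l1_norm (y :: real ^ 'n) \<le> real CARD('n) * norm y"
proof -
  have "l1_norm y \<le> (\<Sum>i\<in>(UNIV :: 'n set). norm y)"
    unfolding l1_norm_def by (intro sum_mono component_le_norm_cart)
  then show ?thesis by simp
qed

lemma l1_norm_eq_0_iff [simp]: "l1_norm y = 0 \<longleftrightarrow> y = 0"
  using norm_le_l1_norm [of y] by auto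

lemma continuous_on_l1_norm [continuous_intros]:
  "continuous_on S f \<Longrightarrow> continuous_on S (\<lambda>x. l1_norm (f x))"
  unfolding l1_norm_def by (intro continuous_intros)

lemma tendsto_l1_norm [tendsto_intros]:
  "(f \<longlongrightarrow> l) F \<Longrightarrow> ((\<lambda>x. l1_norm (f x)) \<longlongrightarrow> l1_norm l) F"
  unfolding l1_norm_def by (intro tendsto_intros)

lemma borel_measurable_l1_norm [measurable]:
  "f \<in> borel_measurable M \<Longrightarrow> (\<lambda>x. l1_norm (f x)) \<in> borel_measurable M"
  by (rule borel_measurable_continuous_onI [THEN measurable_compose_rev]) (auto intro: continuous_intros)

lemma compact_l1_ball: "compact (l1_ball r :: (real ^ 'n) set)"
proof (rule compact_eq_bounded_closed [THEN iffD2], intro conjI)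
  show "bounded (l1_ball r :: (real ^ 'n) set)"
    unfolding bounded_iff l1_ball_def
    by (intro exI [of _ r]) (auto intro: order_trans [OF norm_le_l1_norm])
  show "closed (l1_ball r :: (real ^ 'n) set)"
    unfolding l1_ball_def by (intro closed_Collect_le continuous_intros)
qed

lemma integrable_l1_norm:
  fixes f :: "'a \<Rightarrow> real ^ 'n"
  assumes "integrable M f" shows "integrable M (\<lambda>x. l1_norm (f x))"
proof (rule Bochner_Integration.integrable_bound)
  show "integrable M (\<lambda>x. real CARD('n) * norm (f x))" using assms by simp
  show "(\<lambda>x. l1_norm (f x)) \<in> borel_measurable M" using assms by measurable
  show "AE x in M. norm (l1_norm (f x)) \<le> norm (real CARD('n) * norm (f x))"
    using l1_norm_le_norm by (intro AE_I2) (simp add: abs_mult)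
qed

text \<open>The l1 norm is a sum over components, so the scalar inequality is applied in each of
  them. A detour through the Euclidean norm would cost a factor CARD('n) and spoil the exact
  constants of the moduli \<open>theta1\<close> and \<open>theta2\<close>.\<close>

lemma l1_norm_integral_le:
  fixes f :: "'a \<Rightarrow> real ^ 'n"
  assumes "integrable M f"
  shows "l1_norm (integral\<^sup>L M f) \<le> (\<integral>x. l1_norm (f x) \<partial>M)"
proof -
  have comp: "integrable M (\<lambda>x. f x $ i)" for i
    using integrable_bounded_linear [OF bounded_linear_vec_nth assms] .
  have "l1_norm (integral\<^sup>L M f) = (\<Sum>i\<in>UNIV. \<bar>\<integral>x. f x $ i \<partial>M\<bar>)"
    unfolding l1_norm_def
    using integral_bounded_linear [OF bounded_linear_vec_nth assms] by simp
  also have "\<dots> \<le> (\<Sum>i\<in>UNIV. (\<integral>x. \<bar>f x $ i\<bar> \<partial>M))"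
    by (intro sum_mono integral_abs_bound)
  also have "\<dots> = (\<integral>x. l1_norm (f x) \<partial>M)"
    unfolding l1_norm_def using comp by (subst Bochner_Integration.integral_sum) auto
  finally show ?thesis .
qed

section \<open>Closure properties of the function spaces\<close>

lemma bc_space_subset_Cbar: "bc_space U bc \<subseteq> Cbar U"
  by (auto simp: bc_space_def)

text \<open>Statements about \<open>Cbar\<close> become instances of those about
  \<open>bc_space\<close>: below, \<open>Neumann\<close> serves as the boundary condition that
  demands nothing.\<close>

lemma bc_space_Neumann: "bc_space U Neumann = Cbar U"
  by (auto simp: bc_space_def)

lemma bc_space_zero [simp]: "0 \<in> bc_space U bc"
  by (simp add: bc_space_def Cbar_def)

lemma bc_space_add: "z \<in> bc_space U bc \<Longrightarrow> w \<in> bc_space U bc \<Longrightarrow> z + w \<in> bc_space U bc"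
  by (auto simp: bc_space_def Cbar_def plus_fun_def intro!: continuous_intros)

lemma bc_space_diff: "z \<in> bc_space U bc \<Longrightarrow> w \<in> bc_space U bc \<Longrightarrow> z - w \<in> bc_space U bc"
  by (auto simp: bc_space_def Cbar_def fun_diff_def intro!: continuous_intros)

lemma bc_space_scaleR: "z \<in> bc_space U bc \<Longrightarrow> (\<lambda>x. c *\<^sub>R z x) \<in> bc_space U bc"
  by (auto simp: bc_space_def Cbar_def intro!: continuous_intros)

lemma bc_space_mult: "z \<in> bc_space U bc \<Longrightarrow> (\<lambda>x. c * z x :: real) \<in> bc_space U bc"
  using bc_space_scaleR [of z U bc c] by simp

lemma bc_space_scaleR_left: "z \<in> bc_space U bc \<Longrightarrow> (\<lambda>x. z x *\<^sub>R y) \<in> bc_space U bc"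
  by (auto simp: bc_space_def Cbar_def intro!: continuous_intros)

lemma bc_space_sum: "(\<And>i. i \<in> A \<Longrightarrow> z i \<in> bc_space U bc) \<Longrightarrow> (\<lambda>x. \<Sum>i\<in>A. z i x) \<in> bc_space U bc"
  by (auto simp: bc_space_def Cbar_def intro!: continuous_intros sum.neutral)

lemma bc_space_component:
  fixes z :: "real ^ 'm \<Rightarrow> real ^ 'n"
  shows "z \<in> bc_space U bc \<Longrightarrow> (\<lambda>x. z x $ i) \<in> bc_space U bc"
  by (auto simp: bc_space_def Cbar_def intro!: continuous_intros)

lemma bc_space_vec:
  fixes z :: "'n::finite \<Rightarrow> real ^ 'm \<Rightarrow> real"
  assumes "\<And>i. z i \<in> bc_space U bc"
  shows "(\<lambda>x. \<chi> i. z i x) \<in> bc_space U bc"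
  using assms unfolding bc_space_def Cbar_def
  by (auto simp: vec_eq_iff intro!: continuous_on_vec_lambda)

text \<open>Continuity survives by uniform convergence; vanishing outside the closure and, for
  Dirichlet, on the boundary survives pointwise. This is the completeness behind the Picard
  iteration.\<close>

lemma bc_space_uniform_limit:
  fixes z :: "real ^ 'm \<Rightarrow> real ^ 'n"
  assumes "\<And>k. zs k \<in> bc_space U bc"
    and lim: "uniform_limit UNIV zs z sequentially"
  shows "z \<in> bc_space U bc"
proof -
  have ptw: "(\<lambda>k. zs k x) \<longlonglongrightarrow> z x" for x
    using tendsto_uniform_limitI [OF lim] by simp
  have "continuous_on (closure U) z"
    using assms(1) uniform_limit_on_subset [OF lim, of "closure U"]
    by (intro uniform_limit_theorem [where f = zs and F = sequentially])
       (auto simp: bc_space_def Cbar_def)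
  moreover have "z x = 0" if "\<And>k. zs k x = 0" for x
    using ptw [of x] that by (simp add: LIMSEQ_const_iff)
  ultimately show ?thesis
    using assms(1) by (auto simp: bc_space_def Cbar_def)
qed

section \<open>Sup norms over the closure of the domain\<close>

locale bounded_domain =
  fixes U :: "(real ^ 'm) set"
  assumes bounded_U: "bounded U" and open_U: "open U" and nonempty_U: "U \<noteq> {}"
begin

declare nonempty_U [simp] bounded_U [simp]

lemma obtain_point: obtains x0 where "x0 \<in> closure U"
  using nonempty_U closure_subset by blast

lemma compact_closure_U [simp]: "compact (closure U)"
  using bounded_U by simp

lemma bdd_above_continuous_image:
  fixes g :: "real ^ 'm \<Rightarrow> real"
  shows "continuous_on (closure U) g \<Longrightarrow> bdd_above (g ` closure U)"
  by (meson bounded_imp_bdd_above compact_closure_U compact_continuous_image compact_imp_bounded)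

lemma l1_norm_le_Xnorm:
  assumes "z \<in> bc_space U bc"
  shows "l1_norm (z x) \<le> Xnorm U z"
proof (cases "x \<in> closure U")
  case True
  then show ?thesis
    using assms unfolding Xnorm_def bc_space_def Cbar_def
    by (intro cSUP_upper bdd_above_continuous_image continuous_intros) auto
next
  case False
  \<comment> \<open>Here \<open>z x = 0\<close>; a point of the closure is taken only to see that
    the supremum is nonnegative.\<close>
  obtain x0 where x0: "x0 \<in> closure U" by (rule obtain_point)
  have "0 \<le> l1_norm (z x0)" by simp
  also have "\<dots> \<le> Xnorm U z"
    using assms x0 unfolding Xnorm_def bc_space_def Cbar_def
    by (intro cSUP_upper bdd_above_continuous_image continuous_intros) auto
  finally show ?thesis using False assms by (simp add: bc_space_def Cbar_def)
qed

lemma Xnorm_le: "(\<And>x. x \<in> closure U \<Longrightarrow> l1_norm (z x) \<le> c) \<Longrightarrow> Xnorm U z \<le> c"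
  unfolding Xnorm_def by (intro cSUP_least) auto

text \<open>The pointwise bound holds at every point of the space, so any one, here
  \<open>undefined\<close>, will do.\<close>

lemma Xnorm_nonneg: "z \<in> bc_space U bc \<Longrightarrow> 0 \<le> Xnorm U z"
  using l1_norm_le_Xnorm [of z bc undefined] l1_norm_nonneg [of "z undefined"] by linarith

lemma Xnorm_zero [simp]: "Xnorm U 0 = 0" "Xnorm U (\<lambda>x. 0) = 0"
  by (simp_all add: Xnorm_def zero_fun_def)

lemma Xnorm_triangle:
  assumes "z \<in> bc_space U bc" "w \<in> bc_space U bc"
  shows "Xnorm U (z + w) \<le> Xnorm U z + Xnorm U w"
proof (rule Xnorm_le)
  fix x
  show "l1_norm ((z + w) x) \<le> Xnorm U z + Xnorm U w"
    using l1_norm_le_Xnorm [OF assms(1), of x] l1_norm_le_Xnorm [OF assms(2), of x]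
      l1_norm_triangle [of "z x" "w x"] by simp
qed

lemma Xnorm_minus_commute: "Xnorm U (z - w) = Xnorm U (w - z)"
  unfolding Xnorm_def by (simp add: l1_norm_minus_commute)

lemma Xnorm_diff_triangle:
  assumes "x \<in> bc_space U bc" "y \<in> bc_space U bc" "z \<in> bc_space U bc"
  shows "Xnorm U (x - z) \<le> Xnorm U (x - y) + Xnorm U (y - z)"
  using Xnorm_triangle [OF bc_space_diff [OF assms(1,2)] bc_space_diff [OF assms(2,3)]]
  by (simp add: algebra_simps)

lemma Xnorm_diff_le:
  assumes "x \<in> bc_space U bc" "y \<in> bc_space U bc"
  shows "Xnorm U (x - y) \<le> Xnorm U x + Xnorm U y"
  using Xnorm_diff_triangle [OF assms(1) bc_space_zero assms(2)] Xnorm_minus_commute [of 0 y]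
  by simp

lemma Xnorm_scaleR:
  assumes "z \<in> bc_space U bc"
  shows "Xnorm U (\<lambda>x. c *\<^sub>R z x) = \<bar>c\<bar> * Xnorm U z"
proof (rule antisym)
  show "Xnorm U (\<lambda>x. c *\<^sub>R z x) \<le> \<bar>c\<bar> * Xnorm U z"
    by (intro Xnorm_le) (simp add: l1_norm_scaleR mult_left_mono l1_norm_le_Xnorm [OF assms])
  show "\<bar>c\<bar> * Xnorm U z \<le> Xnorm U (\<lambda>x. c *\<^sub>R z x)"
  proof (cases "c = 0")
    case False
    have "Xnorm U z \<le> Xnorm U (\<lambda>x. c *\<^sub>R z x) / \<bar>c\<bar>"
    proof (intro Xnorm_le)
      fix x
      have "\<bar>c\<bar> * l1_norm (z x) \<le> Xnorm U (\<lambda>x. c *\<^sub>R z x)"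
        using l1_norm_le_Xnorm [OF bc_space_scaleR [OF assms, of c], of x] by (simp add: l1_norm_scaleR)
      then show "l1_norm (z x) \<le> Xnorm U (\<lambda>x. c *\<^sub>R z x) / \<bar>c\<bar>"
        using False by (simp add: field_simps)
    qed
    then show ?thesis using False by (simp add: field_simps)
  qed simp
qed

lemma Xnorm_eq_0D:
  assumes "z \<in> bc_space U bc" "Xnorm U z \<le> 0"
  shows "z = 0"
proof
  fix x
  show "z x = 0 x"
    using l1_norm_le_Xnorm [OF assms(1), of x] assms(2) l1_norm_nonneg [of "z x"]
    by (metis l1_norm_eq_0_iff order_antisym order_trans zero_fun_apply)
qed

lemma abs_le_sup_norm:
  fixes z :: "real ^ 'm \<Rightarrow> real"
  assumes "z \<in> bc_space U bc"
  shows "\<bar>z x\<bar> \<le> sup_norm U z"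
proof -
  have le: "\<bar>z y\<bar> \<le> sup_norm U z" if "y \<in> closure U" for y
    using assms that unfolding sup_norm_def bc_space_def Cbar_def real_norm_def
    by (intro cSUP_upper bdd_above_continuous_image continuous_intros) auto
  obtain x0 where x0: "x0 \<in> closure U" by (rule obtain_point)
  show ?thesis
    using le [of x] le [OF x0] abs_ge_zero [of "z x0"] assms
    by (cases "x \<in> closure U") (auto simp: bc_space_def Cbar_def)
qed

lemma sup_norm_nonneg:
  fixes z :: "real ^ 'm \<Rightarrow> real"
  shows "z \<in> bc_space U bc \<Longrightarrow> 0 \<le> sup_norm U z"
  using abs_le_sup_norm [of z bc undefined] by linarith

lemma sup_norm_le:
  fixes z :: "real ^ 'm \<Rightarrow> real"
  shows "(\<And>x. x \<in> closure U \<Longrightarrow> \<bar>z x\<bar> \<le> c) \<Longrightarrow> sup_norm U z \<le> c"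
  unfolding sup_norm_def by (intro cSUP_least) auto

lemma sup_norm_triangle:
  fixes z w :: "real ^ 'm \<Rightarrow> real"
  assumes "z \<in> bc_space U bc" "w \<in> bc_space U bc"
  shows "sup_norm U (z + w) \<le> sup_norm U z + sup_norm U w"
proof (rule sup_norm_le)
  fix x
  show "\<bar>(z + w) x\<bar> \<le> sup_norm U z + sup_norm U w"
    using abs_le_sup_norm [OF assms(1), of x] abs_le_sup_norm [OF assms(2), of x] by simp
qed

lemma sup_norm_component_le_Xnorm:
  fixes z :: "real ^ 'm \<Rightarrow> real ^ 'n"
  assumes "z \<in> bc_space U bc"
  shows "sup_norm U (\<lambda>x. z x $ i) \<le> Xnorm U z"
  by (intro sup_norm_le order_trans [OF component_le_l1_norm l1_norm_le_Xnorm [OF assms]])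

lemma Xnorm_le_sum_sup_norm:
  fixes z :: "real ^ 'm \<Rightarrow> real ^ 'n"
  assumes "z \<in> bc_space U bc"
  shows "Xnorm U z \<le> (\<Sum>i\<in>UNIV. sup_norm U (\<lambda>x. z x $ i))"
proof (rule Xnorm_le)
  fix x
  show "l1_norm (z x) \<le> (\<Sum>i\<in>UNIV. sup_norm U (\<lambda>x. z x $ i))"
    unfolding l1_norm_def
    by (intro sum_mono) (rule abs_le_sup_norm [OF bc_space_component [OF assms]])
qed

lemma Cball_Xnorm_iff: "z \<in> Cball U r \<longleftrightarrow> z \<in> Cbar U \<and> Xnorm U z \<le> r"
proof
  show "z \<in> Cbar U \<and> Xnorm U z \<le> r \<Longrightarrow> z \<in> Cball U r"
    using l1_norm_le_Xnorm [of z Neumann]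
    by (auto simp: Cball_def l1_ball_def bc_space_Neumann intro: order_trans)
qed (auto simp: Cball_def l1_ball_def intro: Xnorm_le)

text \<open>A partition of unity subordinate to a fine cover gives finite-rank approximations of the
  identity. In the Dirichlet case the functions of the partition that do not vanish on the boundary
  are dropped, which is harmless because \<open>z\<close> is small where they live.\<close>

lemma finite_rank_approximation:
  "\<exists>I \<phi>. (\<forall>k. finite (I k)) \<and> (\<forall>k. I k \<subseteq> closure U) \<and>
     (\<forall>k. \<forall>i\<in>I k. \<phi> k i \<in> bc_space U bc) \<and> (\<forall>k. \<forall>i\<in>I k. \<forall>x. 0 \<le> (\<phi> k i x :: real)) \<and>
     (\<forall>k x. (\<Sum>i\<in>I k. \<phi> k i x) \<le> 1) \<and>
     (\<forall>z\<in>bc_space U bc. \<forall>\<epsilon>>0. \<forall>\<^sub>F k in sequentially. \<forall>x.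
        l1_norm ((\<Sum>i\<in>I k. \<phi> k i x *\<^sub>R z i) - (z x :: real ^ 'n)) \<le> \<epsilon>)"
proof -
  define r where "r k = 1 / real (Suc k)" for k
  have r: "r k > 0" for k by (simp add: r_def)
  have "\<exists>C. finite C \<and> C \<subseteq> closure U \<and> closure U \<subseteq> (\<Union>x\<in>C. ball x (r k))" for k
  proof -
    have "closure U \<subseteq> (\<Union>x\<in>closure U. ball x (r k))" using r by auto
    from compactE_image [OF compact_closure_U _ this] show ?thesis by (metis open_ball)
  qed
  then obtain C where C: "\<And>k. finite (C k)" "\<And>k. C k \<subseteq> closure U"
    "\<And>k. closure U \<subseteq> (\<Union>x\<in>C k. ball x (r k))" by metis
  \<comment> \<open>Tent functions around the centres. Their sum is positive on the closure because
    the balls cover it, and dividing by it gives the partition \<psi>.\<close>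
  define h where "h k i x = max 0 (r k - dist i x)" for k and i x :: "real ^ 'm"
  have h0: "0 \<le> h k i x" for k i x by (simp add: h_def)
  have hpos: "0 < (\<Sum>i\<in>C k. h k i x)" if "x \<in> closure U" for k x
  proof -
    obtain i where i: "i \<in> C k" "dist i x < r k" using C(3) [of k] \<open>x \<in> closure U\<close> by auto
    then have "0 < h k i x" by (simp add: h_def)
    then show ?thesis using i(1) C(1) h0 by (intro sum_pos2 [of _ i]) auto
  qed
  define \<psi> where "\<psi> k i x = (if x \<in> closure U then h k i x / (\<Sum>i\<in>C k. h k i x) else 0)" for k i x
  have \<psi>0: "0 \<le> \<psi> k i x" for k i x
    unfolding \<psi>_def by (auto intro!: divide_nonneg_nonneg sum_nonneg h0)
  have \<psi>1: "(\<Sum>i\<in>C k. \<psi> k i x) = 1" if "x \<in> closure U" for k x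
    using that hpos [OF that, of k] by (simp add: \<psi>_def sum_divide_distrib [symmetric])
  have \<psi>_near: "dist i x < r k" if "\<psi> k i x \<noteq> 0" for k i x
    using that by (auto simp: \<psi>_def h_def split: if_splits)
  have \<psi>_cont: "continuous_on (closure U) (\<psi> k i)" for k i
  proof -
    have "continuous_on (closure U) (\<lambda>x. h k i x / (\<Sum>i\<in>C k. h k i x))"
      unfolding h_def using hpos [of _ k] unfolding h_def
      by (intro continuous_intros) force
    then show ?thesis by (rule continuous_on_eq) (simp add: \<psi>_def)
  qed
  define I where "I k = {i \<in> C k. bc = Dirichlet \<longrightarrow> (\<forall>x\<in>frontier U. \<psi> k i x = 0)}" for k
  have IC: "I k \<subseteq> C k" for k by (auto simp: I_def)
  have \<psi>_bc: "\<psi> k i \<in> bc_space U bc" if "i \<in> I k" for k i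
    using that \<psi>_cont unfolding bc_space_def Cbar_def by (auto simp: I_def \<psi>_def)
  have sum1: "(\<Sum>i\<in>I k. \<psi> k i x) \<le> 1" for k x
  proof (cases "x \<in> closure U")
    case True
    have "(\<Sum>i\<in>I k. \<psi> k i x) \<le> (\<Sum>i\<in>C k. \<psi> k i x)"
      using IC C(1) \<psi>0 by (intro sum_mono2) auto
    then show ?thesis using \<psi>1 [OF True] by simp
  qed (simp add: \<psi>_def)
  have approx: "\<forall>\<^sub>F k in sequentially. \<forall>x. l1_norm ((\<Sum>i\<in>I k. \<psi> k i x *\<^sub>R z i) - z x) \<le> \<epsilon>"
    if z: "z \<in> bc_space U bc" and \<epsilon>: "\<epsilon> > 0" for z :: "real ^ 'm \<Rightarrow> real ^ 'n" and \<epsilon>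
  proof -
    have "uniformly_continuous_on (closure U) z"
      using z by (intro compact_uniformly_continuous) (auto simp: bc_space_def Cbar_def)
    \<comment> \<open>The 2 leaves room for two errors, that of averaging \<open>z\<close> and that
      of the dropped functions; CARD('n) pays for the passage from the Euclidean to the l1
      norm.\<close>
    then have "\<exists>d>0. \<forall>x\<in>closure U. \<forall>y\<in>closure U. dist y x < d \<longrightarrow> dist (z y) (z x) < \<epsilon> / (2 * CARD('n))"
      using \<epsilon> unfolding uniformly_continuous_on_def by simp
    then obtain d where d: "d > 0"
      "\<And>x y. x \<in> closure U \<Longrightarrow> y \<in> closure U \<Longrightarrow> dist y x < d \<Longrightarrow> dist (z y) (z x) < \<epsilon> / (2 * CARD('n))"
      by blast
    have close: "l1_norm (z y - z x) \<le> \<epsilon> / 2"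
      if "x \<in> closure U" "y \<in> closure U" "dist y x < d" for x y
    proof -
      have "l1_norm (z y - z x) \<le> real CARD('n) * norm (z y - z x)" by (rule l1_norm_le_norm)
      also have "\<dots> \<le> real CARD('n) * (\<epsilon> / (2 * CARD('n)))"
        using d(2) [OF that] by (intro mult_left_mono) (auto simp: dist_norm)
      finally show ?thesis by simp
    qed
    have "r \<longlonglongrightarrow> 0" unfolding r_def by (rule LIMSEQ_Suc [OF lim_1_over_n])
    then have "\<forall>\<^sub>F k in sequentially. r k < d" using d(1) by (rule order_tendstoD)
    then show ?thesis
    proof eventually_elim
      case (elim k)
      show ?case
      proof
        fix x
        show "l1_norm ((\<Sum>i\<in>I k. \<psi> k i x *\<^sub>R z i) - z x) \<le> \<epsilon>"
        proof (cases "x \<in> closure U")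
          case False
          then show ?thesis using z \<epsilon> by (simp add: \<psi>_def bc_space_def Cbar_def)
        next
          case x: True
          \<comment> \<open>Averaging over the whole partition and subtracting the dropped terms
            keeps the weights summing to 1, so the first sum contains only differences
            \<open>z i - z x\<close>.\<close>
          have eq: "(\<Sum>i\<in>I k. \<psi> k i x *\<^sub>R z i) - z x
              = (\<Sum>i\<in>C k. \<psi> k i x *\<^sub>R (z i - z x)) - (\<Sum>i\<in>C k - I k. \<psi> k i x *\<^sub>R z i)"
          proof -
            have "(\<Sum>i\<in>C k. \<psi> k i x *\<^sub>R (z i - z x)) = (\<Sum>i\<in>C k. \<psi> k i x *\<^sub>R z i) - (\<Sum>i\<in>C k. \<psi> k i x) *\<^sub>R z x"
              by (simp add: scaleR_diff_right sum_subtractf scaleR_sum_left)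
            also have "(\<Sum>i\<in>C k. \<psi> k i x *\<^sub>R z i) = (\<Sum>i\<in>I k. \<psi> k i x *\<^sub>R z i) + (\<Sum>i\<in>C k - I k. \<psi> k i x *\<^sub>R z i)"
              by (simp add: sum.subset_diff [OF IC C(1)])
            finally show ?thesis using \<psi>1 [OF x] by simp
          qed
          have 1: "l1_norm (\<psi> k i x *\<^sub>R (z i - z x)) \<le> \<psi> k i x * (\<epsilon> / 2)" if "i \<in> C k" for i
          proof (cases "\<psi> k i x = 0")
            case False
            then have "dist i x < d" using \<psi>_near elim by force
            then have "l1_norm (z i - z x) \<le> \<epsilon> / 2" using close [OF x, of i] that C(2) by auto
            from mult_left_mono [OF this \<psi>0 [of k i x]] show ?thesis
              using \<psi>0 [of k i x] by (simp add: l1_norm_scaleR)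
          qed simp
          have 2: "l1_norm (\<psi> k i x *\<^sub>R z i) \<le> \<psi> k i x * (\<epsilon> / 2)" if i: "i \<in> C k - I k" for i
          proof -
            \<comment> \<open>A dropped function is nonzero at some boundary point \<open>p\<close>,
              which lies within \<open>r k\<close> of the centre \<open>i\<close>. As
              \<open>z\<close> vanishes at \<open>p\<close>, the value \<open>z i\<close> is itself
              small.\<close>
            obtain p where p: "p \<in> frontier U" "\<psi> k i p \<noteq> 0" "bc = Dirichlet"
              using i by (auto simp: I_def)
            then have "z p = 0" "p \<in> closure U" using z by (auto simp: bc_space_def frontier_def)
            moreover have "dist i p < d" using \<psi>_near p(2) elim by force
            moreover have "i \<in> closure U" using i C(2) by auto
            ultimately have "l1_norm (z i) \<le> \<epsilon> / 2" using close [of p i] by simp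
            from mult_left_mono [OF this \<psi>0 [of k i x]] show ?thesis
              using \<psi>0 [of k i x] by (simp add: l1_norm_scaleR)
          qed
          have "l1_norm ((\<Sum>i\<in>I k. \<psi> k i x *\<^sub>R z i) - z x)
              \<le> l1_norm (\<Sum>i\<in>C k. \<psi> k i x *\<^sub>R (z i - z x)) + l1_norm (\<Sum>i\<in>C k - I k. \<psi> k i x *\<^sub>R z i)"
            unfolding eq by (rule order_trans [OF l1_norm_diff_triangle [where y = 0]]) simp
          also have "\<dots> \<le> (\<Sum>i\<in>C k. \<psi> k i x * (\<epsilon> / 2)) + (\<Sum>i\<in>C k - I k. \<psi> k i x * (\<epsilon> / 2))"
            by (intro add_mono order_trans [OF l1_norm_sum] sum_mono 1 2)
          also have "\<dots> \<le> (\<Sum>i\<in>C k. \<psi> k i x * (\<epsilon> / 2)) + (\<Sum>i\<in>C k. \<psi> k i x * (\<epsilon> / 2))"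
            using C(1) \<psi>0 \<epsilon> by (intro add_left_mono sum_mono2) auto
          also have "\<dots> = \<epsilon>"
            using \<psi>1 [OF x, of k] by (simp add: sum_distrib_right [symmetric] sum_divide_distrib [symmetric])
          finally show ?thesis .
        qed
      qed
    qed
  qed
  show ?thesis
    by (intro exI [of _ I] exI [of _ \<psi>] conjI allI ballI impI sum1 approx \<psi>_bc \<psi>0)
      (rule finite_subset [OF IC C(1)] subset_trans [OF IC C(2)])+
qed

end

section \<open>Bochner integrals in the space of continuous functions\<close>

lemma AE_lebesgue_on_iff:
  fixes a b :: real
  shows "(AE s in lebesgue_on {a..b}. P s) \<longleftrightarrow> (AE s in lebesgue. s \<in> {a..b} \<longrightarrow> P s)"
  by (rule AE_restrict_space_iff) auto

lemma AE_lebesgue_on_subset: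
  fixes a b c d :: real
  assumes "AE s in lebesgue_on {a..b}. P s" "{c..d} \<subseteq> {a..b}"
  shows "AE s in lebesgue_on {c..d}. P s"
  using assms unfolding AE_lebesgue_on_iff by (auto elim: eventually_mono)

lemma integrable_lebesgue_on_subset:
  fixes f :: "real \<Rightarrow> 'a::euclidean_space"
  assumes "integrable (lebesgue_on {a..b}) f" "{c..d} \<subseteq> {a..b}"
  shows "integrable (lebesgue_on {c..d}) f"
proof -
  have "set_integrable lebesgue {a..b} f"
    using assms(1) by (simp add: set_integrable_def integrable_restrict_space)
  then have "set_integrable lebesgue {c..d} f"
    by (rule set_integrable_subset) (use assms(2) in auto)
  then show ?thesis by (simp add: set_integrable_def integrable_restrict_space)
qed

lemma integral_lebesgue_on_combine:
  fixes f :: "real \<Rightarrow> 'a::euclidean_space"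
  assumes "integrable (lebesgue_on {a..b}) f" "a \<le> c" "c \<le> b"
  shows "integral\<^sup>L (lebesgue_on {a..b}) f
    = integral\<^sup>L (lebesgue_on {a..c}) f + integral\<^sup>L (lebesgue_on {c..b}) f"
proof -
  have "(f has_integral integral\<^sup>L (lebesgue_on {a..c}) f) {a..c}"
    "(f has_integral integral\<^sup>L (lebesgue_on {c..b}) f) {c..b}"
    "(f has_integral integral\<^sup>L (lebesgue_on {a..b}) f) {a..b}"
    using assms by (auto intro!: has_integral_integral_lebesgue_on integrable_lebesgue_on_subset [OF assms(1)])
  then show ?thesis
    using has_integral_combine [OF assms(2,3)] has_integral_unique by blast
qed

lemma integral_lebesgue_on_mono_set:
  fixes f :: "real \<Rightarrow> real"
  assumes "integrable (lebesgue_on {a..b}) f" "{c..d} \<subseteq> {a..b}" "AE s in lebesgue_on {a..b}. 0 \<le> f s"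
  shows "integral\<^sup>L (lebesgue_on {c..d}) f \<le> integral\<^sup>L (lebesgue_on {a..b}) f"
  by (rule integral_mono_lebesgue_on_AE) (use assms in auto)

lemma LINT_lebesgue_on: "(LINT s:{a..b}|lebesgue. f s) = integral\<^sup>L (lebesgue_on {a..b}) f"
  for f :: "real \<Rightarrow> real"
  by (simp add: set_lebesgue_integral_def integral_restrict_space)

lemma set_integrable_lebesgue_on:
  fixes f :: "real \<Rightarrow> real"
  shows "set_integrable lebesgue {a..b} f \<longleftrightarrow> integrable (lebesgue_on {a..b}) f"
  by (simp add: set_integrable_def integrable_restrict_space)

text \<open>Lebesgue measure is complete, so a change on a null set preserves measurability.
  Continuity and bounds of Caratheodory maps hold only for almost every time, which makes this
  indispensable.\<close>

lemma measurable_lebesgue_on_AE_cong: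
  fixes f g :: "real \<Rightarrow> 'a::topological_space"
  assumes f: "f \<in> borel_measurable (lebesgue_on {a..b})"
    and eq: "AE s in lebesgue_on {a..b}. f s = g s"
  shows "g \<in> borel_measurable (lebesgue_on {a..b})"
proof (rule measurableI)
  fix B :: "'a set" assume "B \<in> sets borel"
  then have "f -` B \<inter> {a..b} \<in> sets (lebesgue_on {a..b})"
    using measurable_sets [OF f] by simp
  then have A: "f -` B \<inter> {a..b} \<in> sets lebesgue"
    by (simp add: sets_restrict_space_iff)
  have "g -` B \<inter> {a..b} \<in> sets lebesgue"
    by (rule completion.in_sets_AE [OF _ A])
       (use eq in \<open>auto simp: AE_lebesgue_on_iff elim!: eventually_mono\<close>)
  then show "g -` B \<inter> space (lebesgue_on {a..b}) \<in> sets (lebesgue_on {a..b})"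
    by (simp add: sets_restrict_space_iff)
qed auto

lemma measurable_lebesgue_on_AE_lim:
  fixes g :: "real \<Rightarrow> 'a::{banach, second_countable_topology}"
  assumes "\<And>k. f k \<in> borel_measurable (lebesgue_on {a..b})"
    and "AE s in lebesgue_on {a..b}. (\<lambda>k. f k s) \<longlonglongrightarrow> g s"
  shows "g \<in> borel_measurable (lebesgue_on {a..b})"
proof (rule measurable_lebesgue_on_AE_cong)
  show "(\<lambda>s. lim (\<lambda>k. f k s)) \<in> borel_measurable (lebesgue_on {a..b})"
    using assms(1) by measurable
  show "AE s in lebesgue_on {a..b}. lim (\<lambda>k. f k s) = g s"
    using assms(2) by eventually_elim (rule limI)
qed

lemma SUP_dense_subset:
  fixes h :: "'p::first_countable_topology \<Rightarrow> real"
  assumes "continuous_on K h" "bdd_above (h ` K)" "D \<subseteq> K" "K \<subseteq> closure D" "K \<noteq> {}"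
  shows "(SUP p\<in>D. h p) = (SUP p\<in>K. h p)"
proof (rule antisym)
  have "D \<noteq> {}" using assms(4,5) by auto
  then show "(SUP p\<in>D. h p) \<le> (SUP p\<in>K. h p)"
    using assms by (intro cSUP_subset_mono) auto
  have bdd: "bdd_above (h ` D)" using assms(2,3) by (meson bdd_above_mono image_mono)
  show "(SUP p\<in>K. h p) \<le> (SUP p\<in>D. h p)"
  proof (rule cSUP_least [OF assms(5)])
    fix p assume p: "p \<in> K"
    then obtain q where q: "\<And>n. q n \<in> D" "q \<longlonglongrightarrow> p"
      using assms(4) by (meson closure_sequential subsetD)
    have "(\<lambda>n. h (q n)) \<longlonglongrightarrow> h p"
      using assms(3) p q(1)
      by (intro continuous_on_tendsto_compose [OF assms(1) q(2)] always_eventually) auto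
    then show "h p \<le> (SUP p\<in>D. h p)"
      by (rule LIMSEQ_le_const2) (use bdd q(1) in \<open>auto intro!: cSUP_upper\<close>)
  qed
qed

text \<open>For continuous functions the supremum may be restricted to the countable set
  \<open>D\<close>. The auxiliary \<open>g\<close> is set to 0 at exceptional times, so that the
  suprema over \<open>D\<close> are over bounded sets at every time and not just at almost every
  one.\<close>

lemma measurable_SUP_continuous:
  fixes h :: "real \<Rightarrow> 'p::metric_space \<Rightarrow> real"
  assumes sep: "D \<subseteq> K" "K \<subseteq> closure D" "countable D" "K \<noteq> {}"
    and meas: "\<And>p. p \<in> K \<Longrightarrow> (\<lambda>s. h s p) \<in> borel_measurable (lebesgue_on {a..b})"
    and cont: "AE s in lebesgue_on {a..b}. continuous_on K (h s) \<and> bdd_above (h s ` K)"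
  shows "(\<lambda>s. SUP p\<in>K. h s p) \<in> borel_measurable (lebesgue_on {a..b})"
proof -
  define g where "g s p = (if continuous_on K (h s) \<and> bdd_above (h s ` K) then h s p else 0)" for s p
  have "(\<lambda>s. SUP p\<in>D. g s p) \<in> borel_measurable (lebesgue_on {a..b})"
  proof (rule borel_measurable_cSUP [OF sep(3)])
    fix p assume "p \<in> D"
    then have "p \<in> K" using sep(1) by auto
    have "AE s in lebesgue_on {a..b}. h s p = g s p"
      using cont by eventually_elim (simp add: g_def)
    then show "(\<lambda>s. g s p) \<in> borel_measurable (lebesgue_on {a..b})"
      by (rule measurable_lebesgue_on_AE_cong [OF meas [OF \<open>p \<in> K\<close>]])
  next
    fix s
    show "bdd_above ((\<lambda>p. g s p) ` D)"
      using sep(1) by (auto simp: g_def intro: bdd_above_mono [OF _ image_mono])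
  qed
  then show ?thesis
  proof (rule measurable_lebesgue_on_AE_cong)
    show "AE s in lebesgue_on {a..b}. (SUP p\<in>D. g s p) = (SUP p\<in>K. h s p)"
      using cont
    proof eventually_elim
      case (elim s)
      then show ?case using SUP_dense_subset [OF _ _ sep(1,2,4), of "h s"] by (simp add: g_def)
    qed
  qed
qed

lemma finite_lebesgue_on: "finite_measure (lebesgue_on {a..b::real})"
  by (rule finite_measure_lebesgue_on) simp

text \<open>Rounding towards zero on the grid of mesh 1 / k, with cut-off outside [-k, k]. The range
  is finite, which produces simple functions, and absolute values never increase, so the majorant of
  the original function still dominates.\<close>

definition trunc_grid :: "nat \<Rightarrow> real \<Rightarrow> real" where
  "trunc_grid k a = (if \<bar>a\<bar> \<le> real k then sgn a * real_of_int \<lfloor>\<bar>a\<bar> * real k\<rfloor> / real k else 0)"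

lemma trunc_grid_abs_le: "\<bar>trunc_grid k a\<bar> \<le> \<bar>a\<bar>"
proof (cases "k = 0 \<or> a = 0")
  case False
  have "0 \<le> real_of_int \<lfloor>\<bar>a\<bar> * real k\<rfloor>" "real_of_int \<lfloor>\<bar>a\<bar> * real k\<rfloor> \<le> \<bar>a\<bar> * real k" by simp_all
  then show ?thesis using False
    by (auto simp: trunc_grid_def abs_mult abs_sgn_eq divide_simps)
qed (auto simp: trunc_grid_def)

lemma trunc_grid_approx:
  assumes "\<bar>a\<bar> \<le> real k"
  shows "\<bar>trunc_grid k a - a\<bar> \<le> 1 / real k"
proof (cases "k = 0 \<or> a = 0")
  case False
  have *: "real_of_int \<lfloor>\<bar>a\<bar> * real k\<rfloor> \<le> \<bar>a\<bar> * real k" "\<bar>a\<bar> * real k < real_of_int \<lfloor>\<bar>a\<bar> * real k\<rfloor> + 1"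
    by linarith+
  have "trunc_grid k a - a = sgn a * (real_of_int \<lfloor>\<bar>a\<bar> * real k\<rfloor> / real k - \<bar>a\<bar>)"
    using assms by (simp add: trunc_grid_def right_diff_distrib mult_sgn_abs)
  also have "real_of_int \<lfloor>\<bar>a\<bar> * real k\<rfloor> / real k - \<bar>a\<bar> = (real_of_int \<lfloor>\<bar>a\<bar> * real k\<rfloor> - \<bar>a\<bar> * real k) / real k"
    using False by (simp add: diff_divide_distrib)
  also have "\<bar>sgn a * \<dots>\<bar> = \<bar>real_of_int \<lfloor>\<bar>a\<bar> * real k\<rfloor> - \<bar>a\<bar> * real k\<bar> / real k"
    using False by (simp add: abs_mult abs_sgn_eq)
  also have "\<dots> \<le> 1 / real k"
    using * by (intro divide_right_mono) linarith+
  finally show ?thesis .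
qed (use assms in \<open>auto simp: trunc_grid_def\<close>)

lemma finite_range_trunc_grid: "finite (range (trunc_grid k))"
proof (rule finite_subset)
  let ?F = "(\<lambda>(s, n). s * real_of_int n / real k) ` ({-1, 0, 1} \<times> {0..int (k * k)})"
  show "range (trunc_grid k) \<subseteq> insert 0 ?F"
  proof
    fix y assume "y \<in> range (trunc_grid k)"
    then obtain a where y: "y = trunc_grid k a" by auto
    show "y \<in> insert 0 ?F"
    proof (cases "\<bar>a\<bar> \<le> real k")
      case True
      have "\<bar>a\<bar> * real k \<le> real k * real k" using True by (intro mult_right_mono) auto
      then have "\<lfloor>\<bar>a\<bar> * real k\<rfloor> \<in> {0..int (k * k)}" by (simp add: floor_le_iff)
      moreover have "sgn a \<in> {-1, 0, 1}" by (simp add: sgn_real_def)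
      ultimately have "(sgn a, \<lfloor>\<bar>a\<bar> * real k\<rfloor>) \<in> {-1, 0, 1} \<times> {0..int (k * k)}" by blast
      from imageI [OF this, of "\<lambda>(s, n). s * real_of_int n / real k"] show ?thesis
        unfolding y trunc_grid_def using True by simp
    qed (simp add: y trunc_grid_def)
  qed
qed simp

lemma borel_measurable_trunc_grid [measurable]: "trunc_grid k \<in> borel_measurable borel"
  unfolding trunc_grid_def by measurable

definition vec_trunc_grid :: "nat \<Rightarrow> real ^ 'n \<Rightarrow> real ^ 'n" where
  "vec_trunc_grid k y = (\<chi> c. trunc_grid k (y $ c))"

lemma l1_norm_vec_trunc_grid_le: "l1_norm (vec_trunc_grid k y) \<le> l1_norm y"
  unfolding l1_norm_def vec_trunc_grid_def by (simp add: sum_mono trunc_grid_abs_le)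

lemma vec_trunc_grid_approx:
  fixes y :: "real ^ 'n"
  assumes "l1_norm y \<le> real k"
  shows "l1_norm (vec_trunc_grid k y - y) \<le> real CARD('n) / real k"
proof -
  have "l1_norm (vec_trunc_grid k y - y) \<le> (\<Sum>i\<in>(UNIV::'n set). 1 / real k)"
    unfolding l1_norm_def vec_trunc_grid_def
    by (intro sum_mono) (auto intro!: trunc_grid_approx order_trans [OF component_le_l1_norm assms])
  then show ?thesis by simp
qed

lemma borel_measurable_vec_nth [measurable (raw)]:
  "f \<in> borel_measurable M \<Longrightarrow> (\<lambda>x. f x $ c) \<in> borel_measurable M" for f :: "'a \<Rightarrow> real ^ 'n"
  by (rule borel_measurable_continuous_on [OF _ ]) (auto intro: continuous_intros)

lemma borel_measurable_vec_lambda: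
  fixes f :: "'a \<Rightarrow> real ^ 'n"
  assumes "\<And>c. (\<lambda>x. f x $ c) \<in> borel_measurable M"
  shows "f \<in> borel_measurable M"
  using assms by (subst borel_measurable_euclidean_space) (auto simp: Basis_vec_def inner_axis)

lemma simple_function_vec_trunc_grid:
  fixes f :: "'a \<Rightarrow> real ^ 'n"
  assumes [measurable]: "f \<in> borel_measurable M"
  shows "simple_function M (\<lambda>s. vec_trunc_grid k (f s))"
proof (rule simple_function_borel_measurable)
  show "(\<lambda>s. vec_trunc_grid k (f s)) \<in> borel_measurable M"
    by (rule borel_measurable_vec_lambda) (simp add: vec_trunc_grid_def)
  have "(\<lambda>s. vec_trunc_grid k (f s)) ` space M \<subseteq> {y. \<forall>c. y $ c \<in> range (trunc_grid k)}"
    by (auto simp: vec_trunc_grid_def)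
  moreover have "finite {y :: real ^ 'n. \<forall>c. y $ c \<in> range (trunc_grid k)}"
  proof (rule finite_subset)
    show "{y :: real ^ 'n. \<forall>c. y $ c \<in> range (trunc_grid k)}
        \<subseteq> vec_lambda ` (UNIV \<rightarrow>\<^sub>E range (trunc_grid k))"
    proof
      fix y :: "real ^ 'n" assume "y \<in> {y. \<forall>c. y $ c \<in> range (trunc_grid k)}"
      then have "y = vec_lambda (vec_nth y)" "vec_nth y \<in> UNIV \<rightarrow>\<^sub>E range (trunc_grid k)" by auto
      then show "y \<in> vec_lambda ` (UNIV \<rightarrow>\<^sub>E range (trunc_grid k))" by blast
    qed
  qed (simp add: finite_PiE finite_range_trunc_grid)
  ultimately show "finite ((\<lambda>s. vec_trunc_grid k (f s)) ` space M)" by (rule finite_subset)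
qed

text \<open>Integration at each point \<open>x\<close> separately, so that the ordinary integral of
  functions with values in \<open>real ^ 'n\<close> applies.
  \<open>has_bochner_integral_pint\<close> identifies it with the Bochner integral.\<close>

definition pint :: "real \<Rightarrow> real \<Rightarrow> (real \<Rightarrow> real ^ 'm \<Rightarrow> real ^ 'n) \<Rightarrow> real ^ 'm \<Rightarrow> real ^ 'n" where
  "pint a b \<phi> = (\<lambda>x. \<integral>s. \<phi> s x \<partial>lebesgue_on {a..b})"

section \<open>Pointwise integrals of families with an integrable majorant\<close>

context bounded_domain
begin

lemma Xnorm_borel_measurable:
  fixes \<phi> :: "real \<Rightarrow> real ^ 'm \<Rightarrow> real ^ 'n"
  assumes "\<And>x. (\<lambda>s. \<phi> s x) \<in> borel_measurable (lebesgue_on {a..b})"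
    and "AE s in lebesgue_on {a..b}. \<phi> s \<in> bc_space U bc"
  shows "(\<lambda>s. Xnorm U (\<phi> s)) \<in> borel_measurable (lebesgue_on {a..b})"
proof -
  obtain D where D: "countable D" "D \<subseteq> closure U" "closure U \<subseteq> closure D"
    using separable [of "closure U"] by blast
  show ?thesis unfolding Xnorm_def
  proof (rule measurable_SUP_continuous [OF D(2,3,1)])
    show "AE s in lebesgue_on {a..b}. continuous_on (closure U) (\<lambda>x. l1_norm (\<phi> s x)) \<and>
        bdd_above ((\<lambda>x. l1_norm (\<phi> s x)) ` closure U)"
      using assms(2)
      by eventually_elim (auto simp: bc_space_def Cbar_def intro!: bdd_above_continuous_image continuous_intros)
    show "(\<lambda>s. l1_norm (\<phi> s p)) \<in> borel_measurable (lebesgue_on {a..b})" for p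
      using assms(1) by measurable
  qed simp
qed

text \<open>Measurability at each point \<open>x\<close> suffices for strong measurability, because the continuous functions
  on the compact closure of \<open>U\<close> form a separable space.\<close>

definition bint ::
  "bdry_cond \<Rightarrow> real \<Rightarrow> real \<Rightarrow> (real \<Rightarrow> real ^ 'm \<Rightarrow> real ^ 'n) \<Rightarrow> (real \<Rightarrow> real) \<Rightarrow> bool" where
  "bint bc a b \<phi> m \<longleftrightarrow>
    (\<forall>x. (\<lambda>s. \<phi> s x) \<in> borel_measurable (lebesgue_on {a..b})) \<and>
    (AE s in lebesgue_on {a..b}. \<phi> s \<in> bc_space U bc \<and> Xnorm U (\<phi> s) \<le> m s) \<and>
    integrable (lebesgue_on {a..b}) m"

lemma bint_measurable: "bint bc a b \<phi> m \<Longrightarrow> (\<lambda>s. \<phi> s x) \<in> borel_measurable (lebesgue_on {a..b})"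
  by (simp add: bint_def)

lemma bint_AE: "bint bc a b \<phi> m \<Longrightarrow> AE s in lebesgue_on {a..b}. \<phi> s \<in> bc_space U bc \<and> Xnorm U (\<phi> s) \<le> m s"
  by (simp add: bint_def)

lemma bint_bound_integrable: "bint bc a b \<phi> m \<Longrightarrow> integrable (lebesgue_on {a..b}) m"
  by (simp add: bint_def)

lemma bint_AE_ptw:
  assumes "bint bc a b \<phi> m"
  shows "AE s in lebesgue_on {a..b}. \<forall>x. l1_norm (\<phi> s x) \<le> m s"
  using bint_AE [OF assms] by eventually_elim (auto intro: order_trans [OF l1_norm_le_Xnorm])

lemma bint_integrable:
  assumes "bint bc a b \<phi> m"
  shows "integrable (lebesgue_on {a..b}) (\<lambda>s. \<phi> s x)"
proof (rule Bochner_Integration.integrable_bound [OF bint_bound_integrable [OF assms] bint_measurable [OF assms]])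
  show "AE s in lebesgue_on {a..b}. norm (\<phi> s x) \<le> norm (m s)"
    using bint_AE_ptw [OF assms]
  proof eventually_elim
    case (elim s)
    then show ?case using norm_le_l1_norm [of "\<phi> s x"] by (smt (verit) real_norm_def)
  qed
qed

lemma bint_subset:
  assumes "bint bc a b \<phi> m" "{c..d} \<subseteq> {a..b}"
  shows "bint bc c d \<phi> m"
  using assms unfolding bint_def
  by (auto intro: AE_lebesgue_on_subset integrable_lebesgue_on_subset measurable_restrict_mono)

lemma bint_Neumann:
  assumes "bint bc a b \<phi> m" shows "bint Neumann a b \<phi> m"
  unfolding bint_def
proof (intro conjI allI bint_measurable [OF assms] bint_bound_integrable [OF assms])
  show "AE s in lebesgue_on {a..b}. \<phi> s \<in> bc_space U Neumann \<and> Xnorm U (\<phi> s) \<le> m s"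
    using bint_AE [OF assms] by eventually_elim (use bc_space_subset_Cbar bc_space_Neumann in fast)
qed

text \<open>A crude majorant first secures integrability of the pieces of a difference; a sharper
  one, found by a specific estimate, is then substituted here.\<close>

lemma bint_mono:
  assumes "bint bc a b \<phi> m" "integrable (lebesgue_on {a..b}) m'"
    "AE s in lebesgue_on {a..b}. Xnorm U (\<phi> s) \<le> m' s"
  shows "bint bc a b \<phi> m'"
  unfolding bint_def
proof (intro conjI allI bint_measurable [OF assms(1)] assms(2))
  show "AE s in lebesgue_on {a..b}. \<phi> s \<in> bc_space U bc \<and> Xnorm U (\<phi> s) \<le> m' s"
    using bint_AE [OF assms(1)] assms(3) by eventually_elim simp
qed

lemma bint_diff:
  assumes "bint bc a b \<phi> m" "bint bc a b \<psi> m'"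
  shows "bint bc a b (\<lambda>s. \<phi> s - \<psi> s) (\<lambda>s. m s + m' s)"
  unfolding bint_def
proof (intro conjI allI)
  show "AE s in lebesgue_on {a..b}. \<phi> s - \<psi> s \<in> bc_space U bc \<and> Xnorm U (\<phi> s - \<psi> s) \<le> m s + m' s"
    using bint_AE [OF assms(1)] bint_AE [OF assms(2)]
    by eventually_elim (auto intro: bc_space_diff order_trans [OF Xnorm_diff_le] add_mono)
next
  show "(\<lambda>s. (\<phi> s - \<psi> s) x) \<in> borel_measurable (lebesgue_on {a..b})" for x
    using bint_measurable [OF assms(1), of x] bint_measurable [OF assms(2), of x] by simp
qed (use assms in \<open>auto simp: bint_def\<close>)

lemma bint_Xnorm_integrable:
  assumes "bint bc a b \<phi> m"
  shows "integrable (lebesgue_on {a..b}) (\<lambda>s. Xnorm U (\<phi> s))"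
proof (rule Bochner_Integration.integrable_bound [OF bint_bound_integrable [OF assms]])
  show "(\<lambda>s. Xnorm U (\<phi> s)) \<in> borel_measurable (lebesgue_on {a..b})"
  proof (rule Xnorm_borel_measurable [OF bint_measurable [OF assms]])
    show "AE s in lebesgue_on {a..b}. \<phi> s \<in> bc_space U bc"
      using bint_AE [OF assms] by eventually_elim simp
  qed
  show "AE s in lebesgue_on {a..b}. norm (Xnorm U (\<phi> s)) \<le> norm (m s)"
    using bint_AE [OF assms] by eventually_elim (auto dest: Xnorm_nonneg)
qed

text \<open>Dominated convergence along sequences gives continuity in \<open>x\<close>. Points where
  all members of the space vanish, be they outside the closure or on a Dirichlet boundary, are
  treated together: there the integrand is 0 at almost every time.\<close>

lemma pint_in_bc_space:
  fixes \<phi> :: "real \<Rightarrow> real ^ 'm \<Rightarrow> real ^ 'n"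
  assumes "bint bc a b \<phi> m"
  shows "pint a b \<phi> \<in> bc_space U bc"
proof -
  have zero: "pint a b \<phi> x = 0" if "\<And>z :: real ^ 'm \<Rightarrow> real ^ 'n. z \<in> bc_space U bc \<Longrightarrow> z x = 0" for x
    unfolding pint_def
  proof (rule integral_eq_zero_AE)
    show "AE s in lebesgue_on {a..b}. \<phi> s x = 0"
      using bint_AE [OF assms] by eventually_elim (simp add: that)
  qed
  have "continuous_on (closure U) (pint a b \<phi>)"
  proof (clarsimp simp: continuous_on_sequentially pint_def comp_def)
    fix q x assume q: "\<forall>n. q n \<in> closure U" "q \<longlonglongrightarrow> x" and x: "x \<in> closure U"
    show "(\<lambda>n. \<integral>s. \<phi> s (q n) \<partial>lebesgue_on {a..b}) \<longlonglongrightarrow> (\<integral>s. \<phi> s x \<partial>lebesgue_on {a..b})"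
    proof (rule integral_dominated_convergence [where w = m])
      show "AE s in lebesgue_on {a..b}. (\<lambda>n. \<phi> s (q n)) \<longlonglongrightarrow> \<phi> s x"
        using bint_AE [OF assms]
      proof eventually_elim
        case (elim s)
        then have "continuous_on (closure U) (\<phi> s)" by (simp add: bc_space_def Cbar_def)
        then show ?case using q x by (intro continuous_on_tendsto_compose [OF _ q(2)]) auto
      qed
      show "AE s in lebesgue_on {a..b}. norm (\<phi> s (q n)) \<le> m s" for n
        using bint_AE_ptw [OF assms] by eventually_elim (meson norm_le_l1_norm order_trans)
    qed (use assms in \<open>auto simp: bint_def\<close>)
  qed
  then show ?thesis
    using zero by (auto simp: bc_space_def Cbar_def)
qed

lemma Xnorm_pint_le:
  assumes "bint bc a b \<phi> m"
  shows "Xnorm U (pint a b \<phi>) \<le> integral\<^sup>L (lebesgue_on {a..b}) m"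
proof (rule Xnorm_le)
  fix x
  have "l1_norm (pint a b \<phi> x) \<le> (\<integral>s. l1_norm (\<phi> s x) \<partial>lebesgue_on {a..b})"
    unfolding pint_def by (rule l1_norm_integral_le [OF bint_integrable [OF assms]])
  also have "\<dots> \<le> integral\<^sup>L (lebesgue_on {a..b}) m"
  proof (intro integral_mono_AE integrable_l1_norm bint_integrable [OF assms] bint_bound_integrable [OF assms])
    show "AE s in lebesgue_on {a..b}. l1_norm (\<phi> s x) \<le> m s"
      using bint_AE_ptw [OF assms] by eventually_elim simp
  qed
  finally show "l1_norm (pint a b \<phi> x) \<le> integral\<^sup>L (lebesgue_on {a..b}) m" .
qed

lemma pint_combine:
  assumes "bint bc a b \<phi> m" "a \<le> c" "c \<le> b"
  shows "pint a b \<phi> = pint a c \<phi> + pint c b \<phi>"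
  unfolding pint_def plus_fun_def
  by (intro ext integral_lebesgue_on_combine bint_integrable [OF assms(1)] assms)

lemma pint_diff:
  assumes "bint bc a b \<phi> m" "bint bc a b \<psi> m'"
  shows "pint a b (\<lambda>s. \<phi> s - \<psi> s) = pint a b \<phi> - pint a b \<psi>"
  unfolding pint_def fun_diff_def
  by (intro ext Bochner_Integration.integral_diff bint_integrable [OF assms(1)] bint_integrable [OF assms(2)])

section \<open>Bounded linear operators under the integral\<close>

definition bdd_linear :: "bdry_cond \<Rightarrow> real \<Rightarrow> ((real ^ 'm \<Rightarrow> real ^ 'n) \<Rightarrow> real ^ 'm \<Rightarrow> real ^ 'n) \<Rightarrow> bool" where
  "bdd_linear bc C T \<longleftrightarrow>
    (\<forall>z \<in> bc_space U bc. T z \<in> bc_space U bc \<and> Xnorm U (T z) \<le> C * Xnorm U z) \<and>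
    (\<forall>z \<in> bc_space U bc. \<forall>w \<in> bc_space U bc. T (z + w) = T z + T w) \<and>
    (\<forall>z \<in> bc_space U bc. \<forall>c. T (\<lambda>x. c *\<^sub>R z x) = (\<lambda>x. c *\<^sub>R T z x))"

lemma bdd_linear_zero:
  fixes T :: "(real ^ 'm \<Rightarrow> real ^ 'n) \<Rightarrow> real ^ 'm \<Rightarrow> real ^ 'n"
  assumes "bdd_linear bc C T" shows "T 0 = 0"
proof -
  have "T (\<lambda>x. 0 *\<^sub>R (0 :: real ^ 'm \<Rightarrow> real ^ 'n) x) = (\<lambda>x. 0 *\<^sub>R T 0 x)"
    using assms unfolding bdd_linear_def by (metis bc_space_zero)
  then show ?thesis by (simp add: zero_fun_def)
qed

lemma bdd_linear_diff:
  assumes T: "bdd_linear bc C T" and z: "z \<in> bc_space U bc" and w: "w \<in> bc_space U bc"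
  shows "T (z - w) = T z - T w"
proof -
  have "T z = T (z - w) + T w"
    using T bc_space_diff [OF z w] w unfolding bdd_linear_def by (metis diff_add_cancel)
  then show ?thesis by simp
qed

lemma bdd_linear_sum:
  assumes T: "bdd_linear bc C T" and "finite A" and w: "\<And>i. i \<in> A \<Longrightarrow> w i \<in> bc_space U bc"
  shows "T (\<lambda>x. \<Sum>i\<in>A. c i *\<^sub>R w i x) = (\<lambda>x. \<Sum>i\<in>A. c i *\<^sub>R T (w i) x)"
  using assms(2) w
proof (induction A)
  case empty
  then show ?case using bdd_linear_zero [OF T] by (simp add: zero_fun_def)
next
  case (insert i A)
  have "T (\<lambda>x. \<Sum>i\<in>insert i A. c i *\<^sub>R w i x) = T ((\<lambda>x. c i *\<^sub>R w i x) + (\<lambda>x. \<Sum>i\<in>A. c i *\<^sub>R w i x))"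
    using insert by (simp add: plus_fun_def)
  also have "\<dots> = T (\<lambda>x. c i *\<^sub>R w i x) + T (\<lambda>x. \<Sum>i\<in>A. c i *\<^sub>R w i x)"
    using T insert.prems unfolding bdd_linear_def by (simp add: bc_space_scaleR bc_space_sum)
  also have "\<dots> = (\<lambda>x. \<Sum>i\<in>insert i A. c i *\<^sub>R T (w i) x)"
    using T insert unfolding bdd_linear_def by (simp add: plus_fun_def)
  finally show ?case .
qed

lemma Xnorm_bdd_linear_le:
  "bdd_linear bc C T \<Longrightarrow> z \<in> bc_space U bc \<Longrightarrow> Xnorm U (T z) \<le> C * Xnorm U z"
  by (simp add: bdd_linear_def)

lemma bdd_linear_in: "bdd_linear bc C T \<Longrightarrow> z \<in> bc_space U bc \<Longrightarrow> T z \<in> bc_space U bc"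
  by (simp add: bdd_linear_def)

text \<open>A finite-rank operator that reads \<open>y\<close> only at the nodes in
  \<open>I\<close>. The argument \<open>y\<close> is an arbitrary function, so truncated node values
  can be inserted as well.\<close>

definition interp ::
  "(real ^ 'm) set \<Rightarrow> (real ^ 'm \<Rightarrow> real ^ 'm \<Rightarrow> real) \<Rightarrow> (real ^ 'm \<Rightarrow> real ^ 'n) \<Rightarrow> real ^ 'm \<Rightarrow> real ^ 'n" where
  "interp I \<phi> y = (\<lambda>x. \<Sum>i\<in>I. \<phi> i x *\<^sub>R y i)"

lemma interp_in_bc_space:
  "(\<And>i. i \<in> I \<Longrightarrow> \<phi> i \<in> bc_space U bc) \<Longrightarrow> interp I \<phi> y \<in> bc_space U bc"
  unfolding interp_def by (intro bc_space_sum bc_space_scaleR_left)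

lemma l1_norm_interp_le:
  assumes "\<And>i. i \<in> I \<Longrightarrow> 0 \<le> \<phi> i x" "(\<Sum>i\<in>I. \<phi> i x) \<le> 1" "\<And>i. i \<in> I \<Longrightarrow> l1_norm (y i) \<le> c" "0 \<le> c"
  shows "l1_norm (interp I \<phi> y x) \<le> c"
proof -
  have "l1_norm (interp I \<phi> y x) \<le> (\<Sum>i\<in>I. \<phi> i x * c)"
    unfolding interp_def
    by (intro order_trans [OF l1_norm_sum] sum_mono) (simp add: l1_norm_scaleR assms mult_left_mono)
  also have "\<dots> \<le> c" using assms(2,4) by (simp add: sum_distrib_right [symmetric] mult_left_le_one_le sum_nonneg assms(1))
  finally show ?thesis .
qed

text \<open>Expanding the node values in the standard basis leaves scalar coefficients times the
  images under \<open>T\<close> of finitely many fixed functions. Measurability in time and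
  integration then concern the scalars only.\<close>

lemma bdd_linear_interp:
  assumes T: "bdd_linear bc C T" and "finite I" and \<phi>: "\<And>i. i \<in> I \<Longrightarrow> \<phi> i \<in> bc_space U bc"
  shows "T (interp I \<phi> y) x = (\<Sum>(i, c)\<in>I \<times> UNIV. (y i $ c) *\<^sub>R T (\<lambda>x. \<phi> i x *\<^sub>R axis c 1) x)"
proof -
  have "interp I \<phi> y = (\<lambda>x. \<Sum>p\<in>I \<times> UNIV. (y (fst p) $ snd p) *\<^sub>R (\<phi> (fst p) x *\<^sub>R axis (snd p) 1))"
  proof
    fix x
    have "\<phi> i x *\<^sub>R y i = (\<Sum>c\<in>UNIV. (y i $ c) *\<^sub>R (\<phi> i x *\<^sub>R axis c 1))" for i
    proof -
      have "\<phi> i x *\<^sub>R y i = \<phi> i x *\<^sub>R (\<Sum>c\<in>UNIV. (y i $ c) *\<^sub>R axis c 1)"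
        using basis_expansion [of "y i"] by (simp add: scalar_mult_eq_scaleR)
      also have "\<dots> = (\<Sum>c\<in>UNIV. (y i $ c) *\<^sub>R (\<phi> i x *\<^sub>R axis c 1))"
        unfolding scaleR_sum_right by (intro sum.cong refl scaleR_left_commute)
      finally show ?thesis .
    qed
    then show "interp I \<phi> y x = (\<Sum>p\<in>I \<times> UNIV. (y (fst p) $ snd p) *\<^sub>R (\<phi> (fst p) x *\<^sub>R axis (snd p) 1))"
      unfolding interp_def by (simp add: sum.cartesian_product case_prod_unfold)
  qed
  moreover have "T (\<lambda>x. \<Sum>p\<in>I \<times> UNIV. (y (fst p) $ snd p) *\<^sub>R (\<phi> (fst p) x *\<^sub>R axis (snd p) 1))
      = (\<lambda>x. \<Sum>p\<in>I \<times> UNIV. (y (fst p) $ snd p) *\<^sub>R T (\<lambda>x. \<phi> (fst p) x *\<^sub>R axis (snd p) 1) x)"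
    using assms by (intro bdd_linear_sum [OF T]) (auto intro: bc_space_scaleR_left)
  ultimately show ?thesis by (simp add: case_prod_unfold)
qed

lemma interp_approximation:
  "\<exists>I \<psi>. (\<forall>k. finite (I k)) \<and> (\<forall>k. I k \<subseteq> closure U) \<and>
     (\<forall>k. \<forall>i\<in>I k. \<psi> k i \<in> bc_space U bc) \<and> (\<forall>k. \<forall>i\<in>I k. \<forall>x. 0 \<le> (\<psi> k i x :: real)) \<and>
     (\<forall>k x. (\<Sum>i\<in>I k. \<psi> k i x) \<le> 1) \<and>
     (\<forall>z\<in>bc_space U bc. (\<lambda>k. Xnorm U (interp (I k) (\<psi> k) z - (z :: real ^ 'm \<Rightarrow> real ^ 'n))) \<longlonglongrightarrow> 0)"
proof -
  obtain I and \<psi> :: "nat \<Rightarrow> real ^ 'm \<Rightarrow> real ^ 'm \<Rightarrow> real"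
    where I [rule_format]: "\<forall>k. finite (I k)" "\<forall>k. I k \<subseteq> closure U"
    and \<psi> [rule_format]: "\<forall>k. \<forall>i\<in>I k. \<psi> k i \<in> bc_space U bc" "\<forall>k. \<forall>i\<in>I k. \<forall>x. 0 \<le> \<psi> k i x"
      "\<forall>k x. (\<Sum>i\<in>I k. \<psi> k i x) \<le> 1"
    and approx [rule_format]: "\<forall>z\<in>bc_space U bc. \<forall>\<epsilon>>0. \<forall>\<^sub>F k in sequentially. \<forall>x.
        l1_norm ((\<Sum>i\<in>I k. \<psi> k i x *\<^sub>R z i) - (z x :: real ^ 'n)) \<le> \<epsilon>"
    using finite_rank_approximation [of bc, where 'n = 'n] by (elim exE conjE) (rule that; assumption)
  show ?thesis
  proof (intro exI [of _ I] exI [of _ \<psi>] conjI allI ballI I \<psi>)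
    fix z :: "real ^ 'm \<Rightarrow> real ^ 'n" assume z: "z \<in> bc_space U bc"
    show "(\<lambda>k. Xnorm U (interp (I k) (\<psi> k) z - z)) \<longlonglongrightarrow> 0"
    proof (rule tendstoI)
      fix \<epsilon> :: real assume "\<epsilon> > 0"
      then have "\<epsilon> / 2 > 0" by simp
      from approx [OF z this]
      show "\<forall>\<^sub>F k in sequentially. dist (Xnorm U (interp (I k) (\<psi> k) z - z)) 0 < \<epsilon>"
      proof eventually_elim
        case (elim k)
        then have "Xnorm U (interp (I k) (\<psi> k) z - z) \<le> \<epsilon> / 2"
          by (intro Xnorm_le) (simp add: interp_def)
        moreover have "0 \<le> Xnorm U (interp (I k) (\<psi> k) z - z)"
          using \<psi>(1) z by (intro Xnorm_nonneg [of _ bc] bc_space_diff interp_in_bc_space)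
        ultimately show ?case using \<open>\<epsilon> > 0\<close> by simp
      qed
    qed
  qed
qed

lemma tendsto_bdd_linear_interp:
  assumes T: "bdd_linear bc C T" and z: "z \<in> bc_space U bc"
    and \<psi>: "\<And>k i. i \<in> I k \<Longrightarrow> \<psi> k i \<in> bc_space U bc"
    and lim: "(\<lambda>k. Xnorm U (interp (I k) (\<psi> k) z - z)) \<longlonglongrightarrow> 0"
  shows "(\<lambda>k. T (interp (I k) (\<psi> k) z) x) \<longlonglongrightarrow> T z x"
proof (rule Lim_null_comparison [THEN Lim_null [THEN iffD2]])
  show "\<forall>\<^sub>F k in sequentially. norm (T (interp (I k) (\<psi> k) z) x - T z x)
      \<le> C * Xnorm U (interp (I k) (\<psi> k) z - z)"
  proof (rule always_eventually, rule allI)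
    fix k
    have Q: "interp (I k) (\<psi> k) z \<in> bc_space U bc" by (rule interp_in_bc_space) (rule \<psi>)
    have "norm (T (interp (I k) (\<psi> k) z) x - T z x) \<le> l1_norm (T (interp (I k) (\<psi> k) z - z) x)"
      using norm_le_l1_norm by (simp add: bdd_linear_diff [OF T Q z])
    also have "\<dots> \<le> Xnorm U (T (interp (I k) (\<psi> k) z - z))"
      by (rule l1_norm_le_Xnorm [OF bdd_linear_in [OF T bc_space_diff [OF Q z]]])
    also have "\<dots> \<le> C * Xnorm U (interp (I k) (\<psi> k) z - z)"
      by (rule Xnorm_bdd_linear_le [OF T bc_space_diff [OF Q z]])
    finally show "norm (T (interp (I k) (\<psi> k) z) x - T z x) \<le> C * Xnorm U (interp (I k) (\<psi> k) z - z)" .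
  qed
  show "(\<lambda>k. C * Xnorm U (interp (I k) (\<psi> k) z - z)) \<longlonglongrightarrow> 0"
    using tendsto_mult_left [OF lim, of C] by simp
qed

text \<open>Measurability is the point. \<open>T s\<close> is applied to interpolants of
  \<open>\<phi> s\<close>; the results are finite sums of products of measurable functions of
  \<open>s\<close>, and by boundedness of \<open>T s\<close> they converge to
  \<open>T s (\<phi> s)\<close> for almost every \<open>s\<close>.\<close>

lemma bint_bdd_linear_family:
  fixes \<phi> :: "real \<Rightarrow> real ^ 'm \<Rightarrow> real ^ 'n"
  assumes \<phi>: "bint bc a b \<phi> m" and T: "\<And>s. s \<in> {a..b} \<Longrightarrow> bdd_linear bc C (T s)" and "0 \<le> C"
    and meas: "\<And>z x. z \<in> bc_space U bc \<Longrightarrow> (\<lambda>s. T s z x) \<in> borel_measurable (lebesgue_on {a..b})"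
  shows "bint bc a b (\<lambda>s. T s (\<phi> s)) (\<lambda>s. C * m s)"
proof -
  obtain I and \<psi> :: "nat \<Rightarrow> real ^ 'm \<Rightarrow> real ^ 'm \<Rightarrow> real"
    where I [rule_format]: "\<forall>k. finite (I k)" and "\<forall>k. I k \<subseteq> closure U"
    and \<psi> [rule_format]: "\<forall>k. \<forall>i\<in>I k. \<psi> k i \<in> bc_space U bc"
    and \<psi>' [rule_format]: "\<forall>k. \<forall>i\<in>I k. \<forall>x. 0 \<le> \<psi> k i x" "\<forall>k x. (\<Sum>i\<in>I k. \<psi> k i x) \<le> 1"
    and approx [rule_format]: "\<forall>z\<in>bc_space U bc.
        (\<lambda>k. Xnorm U (interp (I k) (\<psi> k) z - (z :: real ^ 'm \<Rightarrow> real ^ 'n))) \<longlonglongrightarrow> 0"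
    using interp_approximation [of bc, where 'n = 'n] by (elim exE conjE) (rule that; assumption)
  have in_ab: "AE s in lebesgue_on {a..b}. s \<in> {a..b}" by (rule AE_I2) simp
  have "(\<lambda>s. T s (\<phi> s) x) \<in> borel_measurable (lebesgue_on {a..b})" for x
  proof (rule measurable_lebesgue_on_AE_lim)
    show "AE s in lebesgue_on {a..b}. (\<lambda>k. T s (interp (I k) (\<psi> k) (\<phi> s)) x) \<longlonglongrightarrow> T s (\<phi> s) x"
      using bint_AE [OF \<phi>] in_ab
      by eventually_elim (intro tendsto_bdd_linear_interp [OF T] approx \<psi>; simp)
    fix k
    have "(\<lambda>s. \<Sum>(i, c)\<in>I k \<times> UNIV. (\<phi> s i $ c) *\<^sub>R T s (\<lambda>x. \<psi> k i x *\<^sub>R axis c 1) x)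
        \<in> borel_measurable (lebesgue_on {a..b})"
      unfolding case_prod_unfold
    proof (rule borel_measurable_sum)
      fix p assume "p \<in> I k \<times> (UNIV :: 'n set)"
      then have "fst p \<in> I k" by auto
      then have "(\<lambda>s. T s (\<lambda>x. \<psi> k (fst p) x *\<^sub>R axis (snd p) 1) x) \<in> borel_measurable (lebesgue_on {a..b})"
        by (intro meas bc_space_scaleR_left \<psi>)
      then show "(\<lambda>s. (\<phi> s (fst p) $ snd p) *\<^sub>R T s (\<lambda>x. \<psi> k (fst p) x *\<^sub>R axis (snd p) 1) x)
          \<in> borel_measurable (lebesgue_on {a..b})"
        using bint_measurable [OF \<phi>, of "fst p"] by measurable
    qed
    then show "(\<lambda>s. T s (interp (I k) (\<psi> k) (\<phi> s)) x) \<in> borel_measurable (lebesgue_on {a..b})"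
      by (subst measurable_lebesgue_cong) (rule bdd_linear_interp [OF T I \<psi>])
  qed
  moreover have "AE s in lebesgue_on {a..b}. T s (\<phi> s) \<in> bc_space U bc \<and> Xnorm U (T s (\<phi> s)) \<le> C * m s"
    using bint_AE [OF \<phi>] in_ab
  proof eventually_elim
    case (elim s)
    then have "Xnorm U (T s (\<phi> s)) \<le> C * Xnorm U (\<phi> s)" by (intro Xnorm_bdd_linear_le [OF T]) auto
    also have "\<dots> \<le> C * m s" using elim \<open>0 \<le> C\<close> by (intro mult_left_mono) auto
    finally show ?case using elim bdd_linear_in [OF T] by simp
  qed
  ultimately show ?thesis
    using bint_bound_integrable [OF \<phi>] by (simp add: bint_def)
qed

text \<open>On interpolants both sides are the same finite sum. The limit passes through
  \<open>T\<close> by boundedness and through the integral by dominated convergence; interpolation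
  does not increase the norm, hence the majorant \<open>C * m s\<close>.\<close>

lemma pint_bdd_linear:
  fixes \<phi> :: "real \<Rightarrow> real ^ 'm \<Rightarrow> real ^ 'n"
  assumes \<phi>: "bint bc a b \<phi> m" and T: "bdd_linear bc C T" and "0 \<le> C"
  shows "T (pint a b \<phi>) = pint a b (\<lambda>s. T (\<phi> s))"
proof
  fix x
  obtain I and \<psi> :: "nat \<Rightarrow> real ^ 'm \<Rightarrow> real ^ 'm \<Rightarrow> real"
    where I [rule_format]: "\<forall>k. finite (I k)" and "\<forall>k. I k \<subseteq> closure U"
    and \<psi> [rule_format]: "\<forall>k. \<forall>i\<in>I k. \<psi> k i \<in> bc_space U bc"
    and \<psi>' [rule_format]: "\<forall>k. \<forall>i\<in>I k. \<forall>x. 0 \<le> \<psi> k i x" "\<forall>k x. (\<Sum>i\<in>I k. \<psi> k i x) \<le> 1"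
    and approx [rule_format]: "\<forall>z\<in>bc_space U bc.
        (\<lambda>k. Xnorm U (interp (I k) (\<psi> k) z - (z :: real ^ 'm \<Rightarrow> real ^ 'n))) \<longlonglongrightarrow> 0"
    using interp_approximation [of bc, where 'n = 'n] by (elim exE conjE) (rule that; assumption)
  let ?Q = "\<lambda>k z. interp (I k) (\<psi> k) z"
  have int: "integrable (lebesgue_on {a..b}) (\<lambda>s. (\<phi> s i $ c) *\<^sub>R y)" for i c and y :: "real ^ 'n"
    using integrable_bounded_linear [OF bounded_linear_vec_nth bint_integrable [OF \<phi>, of i], of c] by simp
  have eq: "T (?Q k (pint a b \<phi>)) x = (\<integral>s. T (?Q k (\<phi> s)) x \<partial>lebesgue_on {a..b})" for k
  proof -
    have "(\<integral>s. T (?Q k (\<phi> s)) x \<partial>lebesgue_on {a..b})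
      = (\<integral>s. (\<Sum>p\<in>I k \<times> UNIV. (\<phi> s (fst p) $ snd p) *\<^sub>R T (\<lambda>x. \<psi> k (fst p) x *\<^sub>R axis (snd p) 1) x) \<partial>lebesgue_on {a..b})"
      using bdd_linear_interp [OF T I \<psi>] by (simp add: case_prod_unfold)
    also have "\<dots> = (\<Sum>p\<in>I k \<times> UNIV. (\<integral>s. (\<phi> s (fst p) $ snd p) *\<^sub>R T (\<lambda>x. \<psi> k (fst p) x *\<^sub>R axis (snd p) 1) x \<partial>lebesgue_on {a..b}))"
      by (rule Bochner_Integration.integral_sum) (rule int)
    also have "\<dots> = (\<Sum>p\<in>I k \<times> UNIV. (pint a b \<phi> (fst p) $ snd p) *\<^sub>R T (\<lambda>x. \<psi> k (fst p) x *\<^sub>R axis (snd p) 1) x)"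
      unfolding pint_def
      using integrable_bounded_linear [OF bounded_linear_vec_nth bint_integrable [OF \<phi>]]
        integral_bounded_linear [OF bounded_linear_vec_nth bint_integrable [OF \<phi>]]
      by (intro sum.cong refl) (subst integral_scaleR_left; simp)
    finally show ?thesis
      using bdd_linear_interp [OF T I \<psi>, where y = "pint a b \<phi>"] by (simp add: case_prod_unfold)
  qed
  have "(\<lambda>k. T (?Q k (pint a b \<phi>)) x) \<longlonglongrightarrow> T (pint a b \<phi>) x"
    using pint_in_bc_space [OF \<phi>] by (intro tendsto_bdd_linear_interp [OF T] \<psi> approx)
  moreover have "(\<lambda>k. \<integral>s. T (?Q k (\<phi> s)) x \<partial>lebesgue_on {a..b}) \<longlonglongrightarrow> (\<integral>s. T (\<phi> s) x \<partial>lebesgue_on {a..b})"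
  proof (rule integral_dominated_convergence [where w = "\<lambda>s. C * m s"])
    show "AE s in lebesgue_on {a..b}. (\<lambda>k. T (?Q k (\<phi> s)) x) \<longlonglongrightarrow> T (\<phi> s) x"
      using bint_AE [OF \<phi>] by eventually_elim (intro tendsto_bdd_linear_interp [OF T] approx \<psi>; simp)
    show "AE s in lebesgue_on {a..b}. norm (T (?Q k (\<phi> s)) x) \<le> C * m s" for k
      using bint_AE [OF \<phi>]
    proof eventually_elim
      case (elim s)
      have Q: "?Q k (\<phi> s) \<in> bc_space U bc" by (rule interp_in_bc_space) (rule \<psi>)
      have "norm (T (?Q k (\<phi> s)) x) \<le> Xnorm U (T (?Q k (\<phi> s)))"
        using norm_le_l1_norm l1_norm_le_Xnorm [OF bdd_linear_in [OF T Q]] by (rule order_trans)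
      also have "\<dots> \<le> C * Xnorm U (?Q k (\<phi> s))" by (rule Xnorm_bdd_linear_le [OF T Q])
      also have "Xnorm U (?Q k (\<phi> s)) \<le> Xnorm U (\<phi> s)"
        using elim by (intro Xnorm_le l1_norm_interp_le \<psi>' l1_norm_le_Xnorm Xnorm_nonneg; blast)
      also have "C * Xnorm U (\<phi> s) \<le> C * m s" using elim \<open>0 \<le> C\<close> by (intro mult_left_mono) auto
      finally show ?case using \<open>0 \<le> C\<close> by (simp add: mult_left_mono)
    qed
    show "(\<lambda>s. T (?Q k (\<phi> s)) x) \<in> borel_measurable (lebesgue_on {a..b})" for k
    proof -
      have "(\<lambda>s. \<Sum>(i, c)\<in>I k \<times> UNIV. (\<phi> s i $ c) *\<^sub>R T (\<lambda>x. \<psi> k i x *\<^sub>R axis c 1) x)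
          \<in> borel_measurable (lebesgue_on {a..b})"
        unfolding case_prod_unfold by (rule borel_measurable_sum) (rule borel_measurable_integrable [OF int])
      then show ?thesis by (subst measurable_lebesgue_cong) (rule bdd_linear_interp [OF T I \<psi>])
    qed
    show "(\<lambda>s. T (\<phi> s) x) \<in> borel_measurable (lebesgue_on {a..b})"
      using bint_bdd_linear_family [of bc a b \<phi> m C "\<lambda>_. T"] \<phi> T \<open>0 \<le> C\<close> by (simp add: bint_def)
    show "integrable (lebesgue_on {a..b}) (\<lambda>s. C * m s)"
      using bint_bound_integrable [OF \<phi>] by simp
  qed
  ultimately have "T (pint a b \<phi>) x = (\<integral>s. T (\<phi> s) x \<partial>lebesgue_on {a..b})"
    unfolding eq by (rule LIMSEQ_unique)
  then show "T (pint a b \<phi>) x = pint a b (\<lambda>s. T (\<phi> s)) x"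
    unfolding pint_def .
qed

section \<open>Agreement of pointwise and Bochner integrals\<close>

lemma simple_Cbar_bochner:
  assumes "simple_Cbar U (lebesgue_on {a..b}) \<sigma>"
  shows "integrable (lebesgue_on {a..b}) (\<lambda>s. \<sigma> s x)"
    and "simple_integral_Cbar (lebesgue_on {a..b}) \<sigma> = pint a b \<sigma>"
proof -
  interpret finite_measure "lebesgue_on {a..b}" by (rule finite_lebesgue_on)
  have \<sigma>: "simple_function (lebesgue_on {a..b}) \<sigma>" using assms by (simp add: simple_Cbar_def)
  have int: "Bochner_Integration.simple_bochner_integrable (lebesgue_on {a..b}) (\<lambda>s. \<sigma> s x)" for x
    by (rule simple_bochner_integrable.intros [OF simple_function_compose1 [OF \<sigma>, of "\<lambda>w. w x"]]) simp
  show "integrable (lebesgue_on {a..b}) (\<lambda>s. \<sigma> s x)"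
    using has_bochner_integral_simple_bochner_integrable [OF int] by (rule integrable.intros)
  show "simple_integral_Cbar (lebesgue_on {a..b}) \<sigma> = pint a b \<sigma>"
  proof
    fix x
    have "pint a b \<sigma> x = Bochner_Integration.simple_bochner_integral (lebesgue_on {a..b}) (\<lambda>s. \<sigma> s x)"
      unfolding pint_def by (rule simple_bochner_integrable_eq_integral [OF int, symmetric])
    also have "\<dots> = (\<Sum>w\<in>\<sigma> ` space (lebesgue_on {a..b}).
        measure (lebesgue_on {a..b}) {s \<in> space (lebesgue_on {a..b}). \<sigma> s = w} *\<^sub>R w x)"
      by (rule simple_bochner_integral_partition [OF int \<sigma>]) auto
    finally show "simple_integral_Cbar (lebesgue_on {a..b}) \<sigma> x = pint a b \<sigma> x"
      by (simp add: simple_integral_Cbar_def)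
  qed
qed

text \<open>The error of the integrals at \<open>x\<close> is at most the mean sup-norm distance of
  the integrands, which does not depend on \<open>x\<close>. Convergence in mean therefore gives
  convergence of the integrals in the sup norm.\<close>

lemma tendsto_pint_simple:
  fixes \<phi> :: "real \<Rightarrow> real ^ 'm \<Rightarrow> real ^ 'n"
  assumes \<phi>: "bint bc a b \<phi> m" and \<sigma>: "\<And>k. simple_Cbar U (lebesgue_on {a..b}) (\<sigma> k)"
    and lim: "(\<lambda>k. \<integral>\<^sup>+ t. ennreal (Xnorm U (\<sigma> k t - \<phi> t)) \<partial>lebesgue_on {a..b}) \<longlonglongrightarrow> 0"
  shows "(\<lambda>k. Xnorm U (simple_integral_Cbar (lebesgue_on {a..b}) (\<sigma> k) - pint a b \<phi>)) \<longlonglongrightarrow> 0"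
proof -
  let ?M = "lebesgue_on {a..b}"
  let ?N = "\<lambda>k. \<integral>\<^sup>+ t. ennreal (Xnorm U (\<sigma> k t - \<phi> t)) \<partial>?M"
  have le: "ennreal (Xnorm U (pint a b (\<sigma> k) - pint a b \<phi>)) \<le> ?N k" for k
  proof -
    have ptw: "ennreal (l1_norm (pint a b (\<sigma> k) x - pint a b \<phi> x)) \<le> ?N k" for x
    proof -
      have int: "integrable ?M (\<lambda>s. \<sigma> k s x - \<phi> s x)"
        by (intro Bochner_Integration.integrable_diff simple_Cbar_bochner [OF \<sigma>] bint_integrable [OF \<phi>])
      have "l1_norm (pint a b (\<sigma> k) x - pint a b \<phi> x) = l1_norm (\<integral>s. \<sigma> k s x - \<phi> s x \<partial>?M)"
        unfolding pint_def
        by (subst Bochner_Integration.integral_diff [OF simple_Cbar_bochner(1) [OF \<sigma>] bint_integrable [OF \<phi>]]) simp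
      also have "\<dots> \<le> (\<integral>s. l1_norm (\<sigma> k s x - \<phi> s x) \<partial>?M)" by (rule l1_norm_integral_le [OF int])
      finally have "ennreal (l1_norm (pint a b (\<sigma> k) x - pint a b \<phi> x))
          \<le> ennreal (\<integral>s. l1_norm (\<sigma> k s x - \<phi> s x) \<partial>?M)" by (rule ennreal_leI)
      also have "\<dots> = (\<integral>\<^sup>+ s. ennreal (l1_norm (\<sigma> k s x - \<phi> s x)) \<partial>?M)"
        by (rule nn_integral_eq_integral [symmetric]) (auto intro: integrable_l1_norm [OF int])
      also have "\<dots> \<le> ?N k"
      proof (rule nn_integral_mono_AE)
        have "AE s in ?M. s \<in> {a..b}" by (rule AE_I2) simp
        with bint_AE [OF bint_Neumann [OF \<phi>]]
        show "AE s in ?M. ennreal (l1_norm (\<sigma> k s x - \<phi> s x)) \<le> ennreal (Xnorm U (\<sigma> k s - \<phi> s))"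
        proof eventually_elim
          case (elim s)
          then have "\<sigma> k s - \<phi> s \<in> bc_space U Neumann"
            using \<sigma> [of k] by (intro bc_space_diff) (auto simp: simple_Cbar_def bc_space_Neumann)
          from l1_norm_le_Xnorm [OF this, of x] show ?case by (intro ennreal_leI) simp
        qed
      qed
      finally show ?thesis .
    qed
    \<comment> \<open>The pointwise bounds live in \<open>ennreal\<close>. An infinite common bound
      makes the claim trivial; a finite one is a real number, and the supremum over \<open>x\<close>
      can be taken.\<close>
    show ?thesis
    proof (cases "?N k = top")
      case False
      then obtain r where r: "?N k = ennreal r" "0 \<le> r" by (cases "?N k") auto
      then show ?thesis using ptw by (auto intro!: ennreal_leI Xnorm_le)
    qed simp
  qed
  have "(\<lambda>k. ennreal (Xnorm U (pint a b (\<sigma> k) - pint a b \<phi>))) \<longlonglongrightarrow> 0"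
    by (rule tendsto_sandwich [OF _ _ tendsto_const lim]) (auto intro: always_eventually le)
  moreover have "0 \<le> Xnorm U (pint a b (\<sigma> k) - pint a b \<phi>)" for k
    using l1_norm_nonneg
  proof (rule order_trans)
    have "pint a b (\<sigma> k) \<in> bc_space U Neumann"
    proof -
      have *: "pint a b (\<sigma> k) = simple_integral_Cbar ?M (\<sigma> k)" using simple_Cbar_bochner(2) [OF \<sigma>] by simp
      have "\<sigma> k ` {a..b} \<subseteq> bc_space U Neumann" using \<sigma> [of k] by (auto simp: simple_Cbar_def bc_space_Neumann)
      then show ?thesis unfolding * simple_integral_Cbar_def
        by (intro bc_space_sum bc_space_scaleR) auto
    qed
    then show "l1_norm ((pint a b (\<sigma> k) - pint a b \<phi>) undefined) \<le> Xnorm U (pint a b (\<sigma> k) - pint a b \<phi>)"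
      using pint_in_bc_space [OF bint_Neumann [OF \<phi>]] by (intro l1_norm_le_Xnorm bc_space_diff)
  qed
  ultimately have "(\<lambda>k. Xnorm U (pint a b (\<sigma> k) - pint a b \<phi>)) \<longlonglongrightarrow> 0"
    using tendsto_ennreal_iff [where f = "\<lambda>k. Xnorm U (pint a b (\<sigma> k) - pint a b \<phi>)" and F = sequentially and x = 0]
    by (simp add: always_eventually)
  then show ?thesis using simple_Cbar_bochner(2) [OF \<sigma>] by simp
qed

text \<open>The simple functions \<sigma> interpolate node values that were first truncated to a
  grid. Finitely many nodes with finitely many values each make them simple, and neither operation
  increases the norm, so \<open>2 * m s\<close> dominates the errors.\<close>

theorem has_bochner_integral_pint:
  fixes \<phi> :: "real \<Rightarrow> real ^ 'm \<Rightarrow> real ^ 'n"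
  assumes \<phi>: "bint bc a b \<phi> m"
  shows "has_bochner_integral_Cbar U (lebesgue_on {a..b}) \<phi> (pint a b \<phi>)"
proof -
  let ?M = "lebesgue_on {a..b}"
  obtain I and \<psi> :: "nat \<Rightarrow> real ^ 'm \<Rightarrow> real ^ 'm \<Rightarrow> real"
    where I [rule_format]: "\<forall>k. finite (I k)" and "\<forall>k. I k \<subseteq> closure U"
    and \<psi> [rule_format]: "\<forall>k. \<forall>i\<in>I k. \<psi> k i \<in> bc_space U bc"
    and \<psi>' [rule_format]: "\<forall>k. \<forall>i\<in>I k. \<forall>x. 0 \<le> \<psi> k i x" "\<forall>k x. (\<Sum>i\<in>I k. \<psi> k i x) \<le> 1"
    and approx [rule_format]: "\<forall>z\<in>bc_space U bc.
        (\<lambda>k. Xnorm U (interp (I k) (\<psi> k) z - (z :: real ^ 'm \<Rightarrow> real ^ 'n))) \<longlonglongrightarrow> 0"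
    using interp_approximation [of bc, where 'n = 'n] by (elim exE conjE) (rule that; assumption)
  define \<sigma> where "\<sigma> k s = interp (I k) (\<psi> k) (\<lambda>i. vec_trunc_grid k (\<phi> s i))" for k s
  have \<sigma>_in: "\<sigma> k s \<in> bc_space U bc" for k s
    unfolding \<sigma>_def by (rule interp_in_bc_space) (rule \<psi>)
  interpret finite_measure ?M by (rule finite_lebesgue_on)
  have \<sigma>: "simple_Cbar U ?M (\<sigma> k)" for k
  proof -
    have "simple_function ?M (\<lambda>s. \<Sum>i\<in>I k. (\<lambda>x. \<psi> k i x *\<^sub>R vec_trunc_grid k (\<phi> s i)))"
      by (intro simple_function_sum simple_function_compose1
          [OF simple_function_vec_trunc_grid [OF bint_measurable [OF \<phi>]]])
    moreover have "(\<lambda>s. \<Sum>i\<in>I k. (\<lambda>x. \<psi> k i x *\<^sub>R vec_trunc_grid k (\<phi> s i))) = \<sigma> k"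
    proof (intro ext)
      fix s x
      have "(\<Sum>i\<in>A. f i) x = (\<Sum>i\<in>A. f i x)" for A and f :: "real ^ 'm \<Rightarrow> real ^ 'm \<Rightarrow> real ^ 'n"
        by (induction A rule: infinite_finite_induct) auto
      then show "(\<Sum>i\<in>I k. (\<lambda>x. \<psi> k i x *\<^sub>R vec_trunc_grid k (\<phi> s i))) x = \<sigma> k s x"
        by (simp add: \<sigma>_def interp_def)
    qed
    ultimately show ?thesis
      unfolding simple_Cbar_def using subsetD [OF bc_space_subset_Cbar \<sigma>_in] by auto
  qed
  have Xm: "Xnorm U (\<sigma> k s - \<phi> s) \<le> 2 * m s" if "\<phi> s \<in> bc_space U bc" "Xnorm U (\<phi> s) \<le> m s" for k s
  proof -
    have "Xnorm U (\<sigma> k s) \<le> Xnorm U (\<phi> s)" unfolding \<sigma>_def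
      by (intro Xnorm_le l1_norm_interp_le \<psi>' order_trans [OF l1_norm_vec_trunc_grid_le]
          l1_norm_le_Xnorm [OF that(1)] Xnorm_nonneg [OF that(1)]) auto
    then show ?thesis using Xnorm_diff_le [OF \<sigma>_in that(1), of k s] that(2) by linarith
  qed
  have conv: "(\<lambda>k. Xnorm U (\<sigma> k s - \<phi> s)) \<longlonglongrightarrow> 0" if s: "\<phi> s \<in> bc_space U bc" for s
  proof (rule tendsto_sandwich [OF _ _ tendsto_const])
    show "\<forall>\<^sub>F k in sequentially. 0 \<le> Xnorm U (\<sigma> k s - \<phi> s)"
      using \<sigma>_in s by (intro always_eventually allI Xnorm_nonneg [of _ bc] bc_space_diff)
    have "\<forall>\<^sub>F k in sequentially. Xnorm U (\<phi> s) \<le> real k"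
      using eventually_ge_at_top [of "nat \<lceil>Xnorm U (\<phi> s)\<rceil>"] by eventually_elim linarith
    \<comment> \<open>Two errors: truncation of the node values, at most CARD('n) / k once
      \<open>k\<close> is at least the norm of \<open>\<phi> s\<close>, and interpolation.\<close>
    then show "\<forall>\<^sub>F k in sequentially. Xnorm U (\<sigma> k s - \<phi> s)
        \<le> real CARD('n) / real k + Xnorm U (interp (I k) (\<psi> k) (\<phi> s) - \<phi> s)"
    proof eventually_elim
      case (elim k)
      have Q: "interp (I k) (\<psi> k) (\<phi> s) \<in> bc_space U bc" by (rule interp_in_bc_space) (rule \<psi>)
      have "Xnorm U (\<sigma> k s - interp (I k) (\<psi> k) (\<phi> s)) \<le> real CARD('n) / real k"
      proof (rule Xnorm_le)
        fix x
        have "(\<sigma> k s - interp (I k) (\<psi> k) (\<phi> s)) x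
            = interp (I k) (\<psi> k) (\<lambda>i. vec_trunc_grid k (\<phi> s i) - \<phi> s i) x"
          by (simp add: \<sigma>_def interp_def scaleR_diff_right sum_subtractf)
        also have "l1_norm \<dots> \<le> real CARD('n) / real k"
          by (intro l1_norm_interp_le \<psi>' vec_trunc_grid_approx order_trans [OF l1_norm_le_Xnorm [OF s] elim]) auto
        finally show "l1_norm ((\<sigma> k s - interp (I k) (\<psi> k) (\<phi> s)) x) \<le> real CARD('n) / real k" .
      qed
      then show ?case using Xnorm_diff_triangle [OF \<sigma>_in Q s, of k s] by linarith
    qed
    have "(\<lambda>k. real CARD('n) / real k) \<longlonglongrightarrow> 0" by (rule lim_const_over_n)
    from tendsto_add [OF this approx [OF s]]
    show "(\<lambda>k. real CARD('n) / real k + Xnorm U (interp (I k) (\<psi> k) (\<phi> s) - \<phi> s)) \<longlonglongrightarrow> 0" by simp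
  qed
  have AE_conv: "AE s in ?M. (\<lambda>k. Xnorm U (\<sigma> k s - \<phi> s)) \<longlonglongrightarrow> 0"
    using bint_AE [OF \<phi>] by eventually_elim (simp add: conv)
  have meas: "(\<lambda>s. Xnorm U (\<sigma> k s - \<phi> s)) \<in> borel_measurable ?M" for k
  proof (rule Xnorm_borel_measurable [where bc = bc])
    show "(\<lambda>s. (\<sigma> k s - \<phi> s) x) \<in> borel_measurable ?M" for x
      using borel_measurable_integrable [OF simple_Cbar_bochner(1) [OF \<sigma>, of k x]] bint_measurable [OF \<phi>, of x] by simp
    show "AE s in ?M. \<sigma> k s - \<phi> s \<in> bc_space U bc"
      using bint_AE [OF \<phi>] by eventually_elim (auto intro: bc_space_diff \<sigma>_in)
  qed
  have lim: "(\<lambda>k. \<integral>\<^sup>+ t. ennreal (Xnorm U (\<sigma> k t - \<phi> t)) \<partial>?M) \<longlonglongrightarrow> (\<integral>\<^sup>+ t. 0 \<partial>?M)"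
  proof (rule nn_integral_dominated_convergence [where w = "\<lambda>s. ennreal (2 * m s)"])
    show "AE s in ?M. ennreal (Xnorm U (\<sigma> k s - \<phi> s)) \<le> ennreal (2 * m s)" for k
      using bint_AE [OF \<phi>] by eventually_elim (auto intro: ennreal_leI Xm)
    have int: "integrable ?M (\<lambda>s. 2 * m s)" using bint_bound_integrable [OF \<phi>] by simp
    have "AE s in ?M. 0 \<le> 2 * m s"
      using bint_AE [OF \<phi>] by eventually_elim (auto dest: Xnorm_nonneg)
    from nn_integral_eq_integral [OF int this] show "(\<integral>\<^sup>+ s. ennreal (2 * m s) \<partial>?M) < \<infinity>" by simp
    show "(\<lambda>s. ennreal (2 * m s)) \<in> borel_measurable ?M" using int by measurable
    show "AE s in ?M. (\<lambda>k. ennreal (Xnorm U (\<sigma> k s - \<phi> s))) \<longlonglongrightarrow> 0"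
      using AE_conv by eventually_elim (auto dest: tendsto_ennrealI)
  qed (use meas in measurable)
  have "strongly_measurable U ?M \<phi>"
    unfolding strongly_measurable_def
  proof (intro conjI exI allI)
    show "AE t in ?M. \<phi> t \<in> Cbar U"
      using bint_AE [OF \<phi>] by eventually_elim (use bc_space_subset_Cbar in blast)
  qed (rule \<sigma> AE_conv)+
  moreover have "(\<lambda>k. \<integral>\<^sup>+ t. ennreal (Xnorm U (\<sigma> k t - \<phi> t)) \<partial>?M) \<longlonglongrightarrow> 0" using lim by simp
  ultimately show ?thesis
    unfolding has_bochner_integral_Cbar_def
    using \<sigma> tendsto_pint_simple [of bc a b \<phi> m \<sigma>, OF \<phi> \<sigma>] subsetD [OF bc_space_subset_Cbar pint_in_bc_space [OF \<phi>]]
    by blast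
qed

text \<open>Any sequence of simple functions admissible for \<open>w\<close> has integrals
  converging to \<open>pint a b \<phi>\<close> too, so the two limits agree. This makes the definite
  description in \<open>bochner_integral_Cbar\<close> proper.\<close>

lemma has_bochner_integral_eq_pint:
  fixes \<phi> :: "real \<Rightarrow> real ^ 'm \<Rightarrow> real ^ 'n"
  assumes \<phi>: "bint bc a b \<phi> m" and w: "has_bochner_integral_Cbar U (lebesgue_on {a..b}) \<phi> w"
  shows "w = pint a b \<phi>"
proof -
  let ?M = "lebesgue_on {a..b}"
  obtain \<sigma> where \<sigma>: "\<And>k. simple_Cbar U ?M (\<sigma> k)"
    and lim: "(\<lambda>k. \<integral>\<^sup>+ t. ennreal (Xnorm U (\<sigma> k t - \<phi> t)) \<partial>?M) \<longlonglongrightarrow> 0"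
    and lim_w: "(\<lambda>k. Xnorm U (simple_integral_Cbar ?M (\<sigma> k) - w)) \<longlonglongrightarrow> 0"
    and wC: "w \<in> bc_space U Neumann"
    using w unfolding has_bochner_integral_Cbar_def bc_space_Neumann by blast
  have p: "pint a b \<phi> \<in> bc_space U Neumann" by (rule pint_in_bc_space [OF bint_Neumann [OF \<phi>]])
  have si: "simple_integral_Cbar ?M (\<sigma> k) \<in> bc_space U Neumann" for k
    using \<sigma> [of k] unfolding simple_integral_Cbar_def
    by (intro bc_space_sum bc_space_scaleR) (auto simp: simple_Cbar_def bc_space_Neumann)
  have "Xnorm U (w - pint a b \<phi>) \<le> 0"
  proof (rule LIMSEQ_le_const)
    show "(\<lambda>k. Xnorm U (simple_integral_Cbar ?M (\<sigma> k) - w)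
        + Xnorm U (simple_integral_Cbar ?M (\<sigma> k) - pint a b \<phi>)) \<longlonglongrightarrow> 0"
      using tendsto_add [OF lim_w tendsto_pint_simple [OF \<phi> \<sigma> lim]] by simp
    show "\<exists>N. \<forall>k\<ge>N. Xnorm U (w - pint a b \<phi>) \<le> Xnorm U (simple_integral_Cbar ?M (\<sigma> k) - w)
        + Xnorm U (simple_integral_Cbar ?M (\<sigma> k) - pint a b \<phi>)"
      using Xnorm_diff_triangle [OF wC si p] by (auto simp: Xnorm_minus_commute [of w])
  qed
  then have "w - pint a b \<phi> = 0" by (rule Xnorm_eq_0D [OF bc_space_diff [OF wC p]])
  then show ?thesis by simp
qed

lemma bochner_integral_eq_pint:
  fixes \<phi> :: "real \<Rightarrow> real ^ 'm \<Rightarrow> real ^ 'n"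
  assumes "bint bc a b \<phi> m"
  shows "bochner_integral_Cbar U (lebesgue_on {a..b}) \<phi> = pint a b \<phi>"
  unfolding bochner_integral_Cbar_def
  using has_bochner_integral_pint [OF assms] has_bochner_integral_eq_pint [OF assms] by (rule the_equality)

end

section \<open>The semigroup on the product space\<close>

context bounded_domain
begin

lemma bounded_op_mult:
  "bounded_op_on_Y U bc T \<Longrightarrow> z \<in> bc_space U bc \<Longrightarrow> T (\<lambda>x. c * z x) = (\<lambda>x. c * T z x)"
  by (simp add: bounded_op_on_Y_def)

lemma bounded_op_diff:
  assumes T: "bounded_op_on_Y U bc T" and z: "z \<in> bc_space U bc" and w: "w \<in> bc_space U bc"
  shows "T (z - w) = T z - T w"
proof -
  have "T z = T (z - w) + T w"
    using T bc_space_diff [OF z w] w unfolding bounded_op_on_Y_def by (metis diff_add_cancel)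
  then show ?thesis by simp
qed

text \<open>Otherwise there are normalised \<open>w k\<close> and times \<open>h k\<close> tending
  to 0 that violate the estimate at \<eta>. By compactness \<open>S \<eta> (w k)\<close> converges
  along a subsequence, and strong continuity at the limit \<open>v\<close> contradicts the
  violation. Later times follow by applying the contraction \<open>S (t - \<eta>)\<close>.\<close>

lemma heat_semigroup_norm_continuous:
  assumes S: "heat_semigroup U bc \<alpha> S" and \<eta>: "0 < \<eta>" and \<epsilon>: "0 < \<epsilon>"
  shows "\<exists>\<delta>>0. \<forall>h\<in>{0..\<delta>}. \<forall>t\<ge>\<eta>. \<forall>z\<in>bc_space U bc.
    sup_norm U (S (t + h) z - S t z) \<le> \<epsilon> * sup_norm U z"
proof -
  have op: "bounded_op_on_Y U bc (S t)" if "0 \<le> t" for t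
    using S that by (simp add: heat_semigroup_def C0_semigroup_def)
  have S_in: "S t z \<in> bc_space U bc" if "0 \<le> t" "z \<in> bc_space U bc" for t z
    using op [OF that(1)] that(2) by (simp add: bounded_op_on_Y_def)
  have contr: "sup_norm U (S t z) \<le> sup_norm U z" if "0 \<le> t" "z \<in> bc_space U bc" for t z
    using S that by (simp add: heat_semigroup_def)
  have S0: "S 0 z = z" if "z \<in> bc_space U bc" for z
    using S that by (simp add: heat_semigroup_def C0_semigroup_def)
  have S_add: "S (s + t) z = S s (S t z)" if "0 \<le> s" "0 \<le> t" "z \<in> bc_space U bc" for s t z
    using S that by (simp add: heat_semigroup_def C0_semigroup_def)
  have "\<exists>\<delta>>0. \<forall>h\<in>{0..\<delta>}. \<forall>z\<in>bc_space U bc. sup_norm U (S (\<eta> + h) z - S \<eta> z) \<le> \<epsilon> * sup_norm U z"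
  proof (rule ccontr)
    assume neg: "\<not> ?thesis"
    have "\<exists>h z. h \<in> {0..1 / real (Suc k)} \<and> z \<in> bc_space U bc \<and>
        \<epsilon> * sup_norm U z < sup_norm U (S (\<eta> + h) z - S \<eta> z)" for k
    proof -
      have "1 / real (Suc k) > 0" by simp
      with neg show ?thesis by (meson not_le)
    qed
    then obtain h z where hz: "\<And>k. h k \<in> {0..1 / real (Suc k)}" "\<And>k. z k \<in> bc_space U bc"
      "\<And>k. \<epsilon> * sup_norm U (z k) < sup_norm U (S (\<eta> + h k) (z k) - S \<eta> (z k))" by metis
    have h0: "0 \<le> h k" for k using hz(1) [of k] by simp
    \<comment> \<open>Both operators send 0 to 0, so a violating \<open>z k\<close> cannot vanish
      and may be normalised.\<close>
    have pos: "0 < sup_norm U (z k)" for k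
    proof (rule ccontr)
      assume "\<not> ?thesis"
      then have *: "sup_norm U (z k) = 0" using sup_norm_nonneg [OF hz(2), of k] by simp
      then have "z k = 0" using abs_le_sup_norm [OF hz(2) [of k]] by (auto simp: fun_eq_iff)
      moreover have "S t 0 = 0" if "0 \<le> t" for t
        using bounded_op_diff [OF op [OF that], of 0 0] by simp
      ultimately show False using hz(3) [of k] h0 [of k] \<eta> by (simp add: sup_norm_def)
    qed
    define w where "w k = (\<lambda>x. (1 / sup_norm U (z k)) * z k x)" for k
    have w_in: "w k \<in> bc_space U bc" for k unfolding w_def by (rule bc_space_mult [OF hz(2)])
    have w1: "sup_norm U (w k) \<le> 1" for k
    proof (rule sup_norm_le)
      fix x
      show "\<bar>w k x\<bar> \<le> 1"
        using abs_le_sup_norm [OF hz(2) [of k], of x] pos [of k] by (simp add: w_def abs_mult divide_simps)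
    qed
    have w_big: "\<epsilon> \<le> sup_norm U (S (\<eta> + h k) (w k) - S \<eta> (w k))" for k
    proof -
      have sc: "S t (w k) = (\<lambda>x. (1 / sup_norm U (z k)) * S t (z k) x)" if "0 \<le> t" for t
        using op [OF that] hz(2) [of k] unfolding bounded_op_on_Y_def w_def by blast
      have d_in: "S (\<eta> + h k) (w k) - S \<eta> (w k) \<in> bc_space U bc"
        using \<eta> h0 [of k] w_in by (intro bc_space_diff S_in) auto
      have "sup_norm U (S (\<eta> + h k) (z k) - S \<eta> (z k))
          \<le> sup_norm U (z k) * sup_norm U (S (\<eta> + h k) (w k) - S \<eta> (w k))"
      proof (rule sup_norm_le)
        fix x
        have "(S (\<eta> + h k) (z k) - S \<eta> (z k)) x
            = sup_norm U (z k) * (S (\<eta> + h k) (w k) - S \<eta> (w k)) x"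
          using \<eta> h0 [of k] pos [of k] by (simp add: sc field_simps)
        then show "\<bar>(S (\<eta> + h k) (z k) - S \<eta> (z k)) x\<bar>
            \<le> sup_norm U (z k) * sup_norm U (S (\<eta> + h k) (w k) - S \<eta> (w k))"
          using abs_le_sup_norm [OF d_in, of x] pos [of k] by (simp add: abs_mult)
      qed
      with hz(3) [of k] have "\<epsilon> * sup_norm U (z k) \<le> sup_norm U (z k) * sup_norm U (S (\<eta> + h k) (w k) - S \<eta> (w k))"
        by linarith
      then show ?thesis using pos [of k] by (simp add: mult.commute)
    qed
    have "compact_op_on_Y U bc (S \<eta>)" using S \<eta> by (simp add: heat_semigroup_def)
    then obtain \<rho> v where \<rho>: "strict_mono \<rho>" and v: "v \<in> bc_space U bc"
      and lim: "(\<lambda>k. sup_norm U (S \<eta> (w (\<rho> k)) - v)) \<longlonglongrightarrow> 0"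
      unfolding compact_op_on_Y_def using w_in w1 by meson
    have "((\<lambda>t. sup_norm U (S t v - v)) \<longlongrightarrow> 0) (at_right 0)"
      using S v by (simp add: heat_semigroup_def C0_semigroup_def)
    then have "\<forall>\<^sub>F t in at_right 0. sup_norm U (S t v - v) < \<epsilon> / 3"
      by (rule order_tendstoD(2)) (use \<epsilon> in simp)
    then obtain d where d: "d > 0" "\<And>t. 0 < t \<Longrightarrow> t < d \<Longrightarrow> sup_norm U (S t v - v) < \<epsilon> / 3"
      by (auto simp: eventually_at_right_field)
    have d': "sup_norm U (S t v - v) < \<epsilon> / 3" if "0 \<le> t" "t < d" for t
      using d(2) [of t] that S0 [OF v] \<epsilon> by (cases "t = 0") (auto simp: sup_norm_def)
    have "(\<lambda>k. 1 / real (Suc k)) \<longlonglongrightarrow> 0" by (rule LIMSEQ_Suc [OF lim_1_over_n])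
    then have "\<forall>\<^sub>F k in sequentially. 1 / real (Suc k) < d" using d(1) by (rule order_tendstoD)
    then have "\<forall>\<^sub>F k in sequentially. 1 / real (Suc (\<rho> k)) < d"
      using filterlim_subseq [OF \<rho>] by (rule eventually_compose_filterlim)
    moreover have "\<forall>\<^sub>F k in sequentially. sup_norm U (S \<eta> (w (\<rho> k)) - v) < \<epsilon> / 3"
      using lim by (rule order_tendstoD(2)) (use \<epsilon> in simp)
    ultimately have "\<forall>\<^sub>F k in sequentially. False"
    proof eventually_elim
      case (elim k)
      let ?y = "S \<eta> (w (\<rho> k))" and ?h = "h (\<rho> k)"
      have h: "0 \<le> ?h" "?h < d" using hz(1) [of "\<rho> k"] elim(1) by auto
      have y: "?y \<in> bc_space U bc" using \<eta> w_in by (intro S_in) auto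
      \<comment> \<open>Detour through \<open>v\<close>: the first and last terms are controlled by
        the distance of \<open>S \<eta> (w (\<rho> k))\<close> from \<open>v\<close>, the middle one
        by strong continuity at \<open>v\<close>; each is below \<epsilon> / 3.\<close>
      have Sh: "S ?h ?y - ?y = (S ?h (?y - v) + (S ?h v - v)) + (v - ?y)"
        using bounded_op_diff [OF op [OF h(1)] y v] by simp
      have "sup_norm U (S ?h ?y - ?y) \<le> sup_norm U (S ?h (?y - v)) + sup_norm U (S ?h v - v) + sup_norm U (v - ?y)"
      proof -
        have a: "S ?h (?y - v) \<in> bc_space U bc" "S ?h v - v \<in> bc_space U bc" "v - ?y \<in> bc_space U bc"
          by (intro bc_space_diff S_in h y v)+
        show ?thesis
          unfolding Sh using sup_norm_triangle [OF bc_space_add [OF a(1,2)] a(3)] sup_norm_triangle [OF a(1,2)]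
          by linarith
      qed
      moreover have "sup_norm U (S ?h (?y - v)) \<le> sup_norm U (?y - v)" by (intro contr h bc_space_diff y v)
      moreover have "sup_norm U (v - ?y) = sup_norm U (?y - v)" by (simp add: sup_norm_def abs_minus_commute)
      moreover have "sup_norm U (?y - v) + sup_norm U (S ?h v - v) + sup_norm U (?y - v) < \<epsilon>"
        using elim(2) d' [OF h] by simp
      ultimately have "sup_norm U (S ?h ?y - ?y) < \<epsilon>" by linarith
      then show False
        using w_big [of "\<rho> k"] S_add [OF h(1), of \<eta> "w (\<rho> k)"] \<eta> w_in by (simp add: add.commute)
    qed
    then show False by simp
  qed
  then obtain \<delta> where \<delta>: "\<delta> > 0"
    "\<And>h z. h \<in> {0..\<delta>} \<Longrightarrow> z \<in> bc_space U bc \<Longrightarrow> sup_norm U (S (\<eta> + h) z - S \<eta> z) \<le> \<epsilon> * sup_norm U z" by blast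
  show ?thesis
  proof (intro exI [of _ \<delta>] conjI \<delta>(1) ballI allI impI)
    fix h t :: real and z :: "real ^ 'm \<Rightarrow> real"
    assume h: "h \<in> {0..\<delta>}" and t: "\<eta> \<le> t" and z: "z \<in> bc_space U bc"
    have in1: "S (\<eta> + h) z \<in> bc_space U bc" "S \<eta> z \<in> bc_space U bc"
      using h \<eta> z by (auto intro: S_in)
    have "S (t + h) z = S (t - \<eta>) (S (\<eta> + h) z)" "S t z = S (t - \<eta>) (S \<eta> z)"
      using S_add [of "t - \<eta>" "\<eta> + h" z] S_add [of "t - \<eta>" "\<eta>" z] t h z \<eta> by (auto simp: algebra_simps)
    then have "S (t + h) z - S t z = S (t - \<eta>) (S (\<eta> + h) z - S \<eta> z)"
      using bounded_op_diff [OF op in1, of "t - \<eta>"] t by simp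
    then have "sup_norm U (S (t + h) z - S t z) \<le> sup_norm U (S (\<eta> + h) z - S \<eta> z)"
      using contr [OF _ bc_space_diff [OF in1], of "t - \<eta>"] t by simp
    then show "sup_norm U (S (t + h) z - S t z) \<le> \<epsilon> * sup_norm U z"
      using \<delta>(2) [OF h z] by linarith
  qed
qed

end

text \<open>An interface to e^(tA) that separates the evolution argument from the Laplacian. The
  last property is uniform over all times from \<eta> on, so that one step size serves all grid
  cells that stay away from the end point.\<close>

locale heat_flow = bounded_domain U
  for U :: "(real ^ 'm) set" and bc :: bdry_cond
    and P :: "real \<Rightarrow> (real ^ 'm \<Rightarrow> real ^ 'n::finite) \<Rightarrow> real ^ 'm \<Rightarrow> real ^ 'n" +
  assumes P_linear: "0 \<le> t \<Longrightarrow> bdd_linear bc (real CARD('n)) (P t)"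
    and P_0: "z \<in> bc_space U bc \<Longrightarrow> P 0 z = z"
    and P_add: "0 \<le> s \<Longrightarrow> 0 \<le> t \<Longrightarrow> z \<in> bc_space U bc \<Longrightarrow> P (s + t) z = P s (P t z)"
    and P_strongly_continuous: "z \<in> bc_space U bc \<Longrightarrow> ((\<lambda>t. Xnorm U (P t z - z)) \<longlongrightarrow> 0) (at_right 0)"
    and P_norm_continuous: "0 < \<eta> \<Longrightarrow> 0 < \<epsilon> \<Longrightarrow>
      \<exists>\<delta>>0. \<forall>h\<in>{0..\<delta>}. \<forall>t\<ge>\<eta>. \<forall>z\<in>bc_space U bc. Xnorm U (P (t + h) z - P t z) \<le> \<epsilon> * Xnorm U z"

text \<open>Each property is inherited componentwise. The factor CARD('n) arises because
  \<open>Xnorm\<close> is at most the sum of the sup norms of the components, while each of these is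
  at most \<open>Xnorm\<close>.\<close>

lemma (in bounded_domain) heat_flow_product_semigroup:
  fixes S :: "'n::finite \<Rightarrow> real \<Rightarrow> (real ^ 'm \<Rightarrow> real) \<Rightarrow> real ^ 'm \<Rightarrow> real"
  assumes S: "\<And>i. heat_semigroup U bc (\<alpha> i) (S i)"
  shows "heat_flow U bc (product_semigroup S)"
proof
  let ?P = "product_semigroup S" and ?X = "bc_space U bc :: (real ^ 'm \<Rightarrow> real ^ 'n) set"
  have op: "bounded_op_on_Y U bc (S i t)" if "0 \<le> t" for i t
    using S that by (simp add: heat_semigroup_def C0_semigroup_def)
  have P_comp: "(\<lambda>x. ?P t z x $ i) = S i t (\<lambda>x. z x $ i)" for t z i
    by (simp add: product_semigroup_def)
  have P_in: "?P t z \<in> bc_space U bc" if "0 \<le> t" "z \<in> bc_space U bc" for t z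
    unfolding product_semigroup_def
    using op [OF that(1)] bc_space_component [OF that(2)]
    by (intro bc_space_vec) (simp add: bounded_op_on_Y_def)
  have comp_diff: "(\<lambda>x. (z - w) x $ i) = (\<lambda>x. z x $ i) - (\<lambda>x. w x $ i)" for z w :: "real ^ 'm \<Rightarrow> real ^ 'n" and i
    by auto
  have X_le: "Xnorm U (z - w) \<le> (\<Sum>i\<in>UNIV. sup_norm U ((\<lambda>x. z x $ i) - (\<lambda>x. w x $ i)))"
    if "z \<in> ?X" "w \<in> ?X" for z w
    using Xnorm_le_sum_sup_norm [OF bc_space_diff [OF that]] unfolding comp_diff .
  {
    fix t :: real assume t: "0 \<le> t"
    show "bdd_linear bc (real CARD('n)) (?P t)"
      unfolding bdd_linear_def
    proof (intro conjI ballI allI)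
      fix z :: "real ^ 'm \<Rightarrow> real ^ 'n" assume z: "z \<in> bc_space U bc"
      show "?P t z \<in> bc_space U bc" by (rule P_in [OF t z])
      have "Xnorm U (?P t z) \<le> (\<Sum>i\<in>(UNIV :: 'n set). sup_norm U (S i t (\<lambda>x. z x $ i)))"
        using Xnorm_le_sum_sup_norm [OF P_in [OF t z]] unfolding P_comp .
      also have "\<dots> \<le> (\<Sum>i\<in>(UNIV :: 'n set). Xnorm U z)"
      proof (rule sum_mono)
        fix i
        have "sup_norm U (S i t (\<lambda>x. z x $ i)) \<le> sup_norm U (\<lambda>x. z x $ i)"
          using S [of i] t bc_space_component [OF z] by (simp add: heat_semigroup_def)
        also have "\<dots> \<le> Xnorm U z" by (rule sup_norm_component_le_Xnorm [OF z])
        finally show "sup_norm U (S i t (\<lambda>x. z x $ i)) \<le> Xnorm U z" .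
      qed
      finally show "Xnorm U (?P t z) \<le> real CARD('n) * Xnorm U z" by simp
      fix c :: real
      have "S i t (\<lambda>x. c * z x $ i) = (\<lambda>x. c * S i t (\<lambda>x. z x $ i) x)" for i
        by (rule bounded_op_mult [OF op [OF t] bc_space_component [OF z]])
      then show "?P t (\<lambda>x. c *\<^sub>R z x) = (\<lambda>x. c *\<^sub>R ?P t z x)"
        by (simp add: product_semigroup_def vec_eq_iff fun_eq_iff)
    next
      fix z w :: "real ^ 'm \<Rightarrow> real ^ 'n" assume zw: "z \<in> bc_space U bc" "w \<in> bc_space U bc"
      have "S i t ((\<lambda>x. z x $ i) + (\<lambda>x. w x $ i)) = S i t (\<lambda>x. z x $ i) + S i t (\<lambda>x. w x $ i)" for i
        using op [OF t] bc_space_component [OF zw(1)] bc_space_component [OF zw(2)] unfolding bounded_op_on_Y_def by blast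
      then show "?P t (z + w) = ?P t z + ?P t w"
        by (simp add: product_semigroup_def vec_eq_iff fun_eq_iff plus_fun_def)
    qed
  }
  {
    fix z assume z: "z \<in> ?X"
    show "?P 0 z = z"
      using S bc_space_component [OF z]
      by (simp add: product_semigroup_def heat_semigroup_def C0_semigroup_def)
    fix s t :: real assume "0 \<le> s" "0 \<le> t"
    then show "?P (s + t) z = ?P s (?P t z)"
      using S bc_space_component [OF z]
      by (simp add: product_semigroup_def heat_semigroup_def C0_semigroup_def)
  }
  {
    fix z assume z: "z \<in> ?X"
    have lim: "((\<lambda>t. \<Sum>i\<in>UNIV. sup_norm U (S i t (\<lambda>x. z x $ i) - (\<lambda>x. z x $ i))) \<longlongrightarrow> 0) (at_right 0)"
      using S bc_space_component [OF z]
      by (intro tendsto_null_sum) (simp add: heat_semigroup_def C0_semigroup_def)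
    show "((\<lambda>t. Xnorm U (?P t z - z)) \<longlongrightarrow> 0) (at_right 0)"
    proof (rule tendsto_sandwich [OF _ _ tendsto_const lim])
      have ev: "\<forall>\<^sub>F t in at_right (0::real). 0 \<le> t" by (auto simp: eventually_at_right_field intro: exI [of _ 1])
      show "\<forall>\<^sub>F t in at_right 0. 0 \<le> Xnorm U (?P t z - z)"
        using ev by eventually_elim (auto intro!: Xnorm_nonneg bc_space_diff P_in z)
      show "\<forall>\<^sub>F t in at_right 0. Xnorm U (?P t z - z) \<le> (\<Sum>i\<in>UNIV. sup_norm U (S i t (\<lambda>x. z x $ i) - (\<lambda>x. z x $ i)))"
        using ev
      proof eventually_elim
        case (elim t)
        show ?case using X_le [OF P_in [OF elim z] z] unfolding P_comp .
      qed
    qed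
  }
  {
    fix \<eta> \<epsilon> :: real assume \<eta>: "0 < \<eta>" and \<epsilon>: "0 < \<epsilon>"
    have "\<exists>\<delta>>0. \<forall>h\<in>{0..\<delta>}. \<forall>t\<ge>\<eta>. \<forall>z\<in>bc_space U bc.
        sup_norm U (S i (t + h) z - S i t z) \<le> \<epsilon> / real CARD('n) * sup_norm U z" for i
      using \<epsilon> by (intro heat_semigroup_norm_continuous [OF S \<eta>]) simp
    then obtain \<delta> where \<delta>: "\<And>i. \<delta> i > 0" "\<And>i h t z. h \<in> {0..\<delta> i} \<Longrightarrow> t \<ge> \<eta> \<Longrightarrow> z \<in> bc_space U bc \<Longrightarrow>
        sup_norm U (S i (t + h) z - S i t z) \<le> \<epsilon> / real CARD('n) * sup_norm U z" by metis
    show "\<exists>\<delta>>0. \<forall>h\<in>{0..\<delta>}. \<forall>t\<ge>\<eta>. \<forall>z\<in>?X. Xnorm U (?P (t + h) z - ?P t z) \<le> \<epsilon> * Xnorm U z"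
    proof (intro exI [of _ "Min (range \<delta>)"] conjI ballI allI impI)
      show "0 < Min (range \<delta>)" using \<delta>(1) by simp
      fix h t z assume h: "h \<in> {0..Min (range \<delta>)}" and t: "\<eta> \<le> t" and z: "z \<in> ?X"
      have h': "h \<in> {0..\<delta> i}" for i using h by auto
      have th: "0 \<le> t + h" "0 \<le> t" using t \<eta> h by auto
      have "Xnorm U (?P (t + h) z - ?P t z)
          \<le> (\<Sum>i\<in>UNIV. sup_norm U (S i (t + h) (\<lambda>x. z x $ i) - S i t (\<lambda>x. z x $ i)))"
        using X_le [OF P_in [OF th(1) z] P_in [OF th(2) z]] unfolding P_comp .
      also have "\<dots> \<le> (\<Sum>i\<in>(UNIV::'n set). \<epsilon> / real CARD('n) * Xnorm U z)"
        using \<epsilon> by (intro sum_mono order_trans [OF \<delta>(2) [OF h' t bc_space_component [OF z]]]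
            mult_left_mono sup_norm_component_le_Xnorm [OF z]) simp
      also have "\<dots> = \<epsilon> * Xnorm U z" by simp
      finally show "Xnorm U (?P (t + h) z - ?P t z) \<le> \<epsilon> * Xnorm U z" .
    qed
  }
qed

section \<open>Curves that are continuous in the sup norm\<close>

lemma (in bounded_domain) norm_continuous_on_ptw:
  fixes v :: "real \<Rightarrow> real ^ 'm \<Rightarrow> real ^ 'n"
  assumes "\<And>t. t \<in> D \<Longrightarrow> v t \<in> bc_space U bc" "norm_continuous_on U D v"
  shows "continuous_on D (\<lambda>t. v t x)"
  unfolding continuous_on
proof
  fix t assume t: "t \<in> D"
  show "((\<lambda>s. v s x) \<longlongrightarrow> v t x) (at t within D)"
  proof (rule Lim_null_comparison [THEN Lim_null [THEN iffD2]])
    have "\<forall>\<^sub>F s in at t within D. s \<in> D" by (simp add: eventually_at_filter)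
    then show "\<forall>\<^sub>F s in at t within D. norm (v s x - v t x) \<le> Xnorm U (v s - v t)"
    proof eventually_elim
      case (elim s)
      show ?case
        using l1_norm_le_Xnorm [OF bc_space_diff [OF assms(1) [OF elim] assms(1) [OF t]], of x]
          norm_le_l1_norm [of "v s x - v t x"] by simp
    qed
    show "((\<lambda>s. Xnorm U (v s - v t)) \<longlongrightarrow> 0) (at t within D)"
      using assms(2) t by (simp add: norm_continuous_on_def)
  qed
qed

lemma (in bounded_domain) norm_continuous_on_Xnorm:
  fixes v w :: "real \<Rightarrow> real ^ 'm \<Rightarrow> real ^ 'n"
  assumes v: "\<And>t. t \<in> D \<Longrightarrow> v t \<in> bc_space U bc" "norm_continuous_on U D v"
    and w: "\<And>t. t \<in> D \<Longrightarrow> w t \<in> bc_space U bc" "norm_continuous_on U D w"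
  shows "continuous_on D (\<lambda>t. Xnorm U (v t - w t))"
  unfolding continuous_on
proof
  fix t assume t: "t \<in> D"
  show "((\<lambda>s. Xnorm U (v s - w s)) \<longlongrightarrow> Xnorm U (v t - w t)) (at t within D)"
  proof (rule Lim_null_comparison [THEN Lim_null [THEN iffD2]])
    have "\<forall>\<^sub>F s in at t within D. s \<in> D" by (simp add: eventually_at_filter)
    then show "\<forall>\<^sub>F s in at t within D. norm (Xnorm U (v s - w s) - Xnorm U (v t - w t))
        \<le> Xnorm U (v s - v t) + Xnorm U (w s - w t)"
    proof eventually_elim
      case (elim s)
      note in' = v(1) [OF elim] v(1) [OF t] w(1) [OF elim] w(1) [OF t]
      have "Xnorm U (v s - w s) \<le> Xnorm U (v s - v t) + (Xnorm U (v t - w t) + Xnorm U (w t - w s))"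
        using Xnorm_diff_triangle [OF in'(1,2,3)] Xnorm_diff_triangle [OF in'(2,4,3)] by linarith
      moreover have "Xnorm U (v t - w t) \<le> Xnorm U (v t - v s) + (Xnorm U (v s - w s) + Xnorm U (w s - w t))"
        using Xnorm_diff_triangle [OF in'(2,1,4)] Xnorm_diff_triangle [OF in'(1,3,4)] by linarith
      ultimately show ?case
        using Xnorm_minus_commute [of "v s" "v t"] Xnorm_minus_commute [of "w s" "w t"] by (simp add: abs_le_iff)
    qed
    show "((\<lambda>s. Xnorm U (v s - v t) + Xnorm U (w s - w t)) \<longlongrightarrow> 0) (at t within D)"
      using v(2) w(2) t unfolding norm_continuous_on_def by (intro tendsto_add_zero) auto
  qed
qed

lemma norm_continuous_on_subset:
  "norm_continuous_on U D v \<Longrightarrow> D' \<subseteq> D \<Longrightarrow> norm_continuous_on U D' v"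
  unfolding norm_continuous_on_def by (meson subsetD tendsto_within_subset)

lemma continuous_on_imp_lebesgue_on_measurable:
  fixes f :: "real \<Rightarrow> 'a::euclidean_space"
  shows "continuous_on {a..b} f \<Longrightarrow> f \<in> borel_measurable (lebesgue_on {a..b})"
  by (rule continuous_imp_measurable_on_sets_lebesgue) auto

context heat_flow
begin

abbreviation X :: "(real ^ 'm \<Rightarrow> real ^ 'n) set" where "X \<equiv> bc_space U bc"

lemma P_in: "0 \<le> t \<Longrightarrow> z \<in> X \<Longrightarrow> P t z \<in> X"
  using P_linear by (simp add: bdd_linear_def)

lemma Xnorm_P_le: "0 \<le> t \<Longrightarrow> z \<in> X \<Longrightarrow> Xnorm U (P t z) \<le> real CARD('n) * Xnorm U z"
  using P_linear by (simp add: bdd_linear_def)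

lemma P_diff: "0 \<le> t \<Longrightarrow> z \<in> X \<Longrightarrow> w \<in> X \<Longrightarrow> P t (z - w) = P t z - P t w"
  by (rule bdd_linear_diff [OF P_linear])

lemma P_plus: "0 \<le> t \<Longrightarrow> z \<in> X \<Longrightarrow> w \<in> X \<Longrightarrow> P t (z + w) = P t z + P t w"
  using P_linear by (simp add: bdd_linear_def)

lemma P_increment_eq:
  assumes "0 \<le> t" "0 \<le> h" "z \<in> X"
  shows "P (t + h) z - P t z = P t (P h z - z)"
  using assms P_add [of t h z] by (simp add: P_diff P_in)

text \<open>An increment starting at time \<open>t\<close> is the image under \<open>P t\<close> of
  one starting at time 0, and the operators \<open>P t\<close> are uniformly bounded; hence one step
  size for all \<open>t\<close>.\<close>

lemma P_uniformly_strongly_continuous: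
  assumes z: "z \<in> X" and "0 < \<epsilon>"
  shows "\<exists>\<delta>>0. \<forall>h\<in>{0..\<delta>}. \<forall>t\<ge>0. Xnorm U (P (t + h) z - P t z) \<le> \<epsilon>"
proof -
  have "\<forall>\<^sub>F t in at_right 0. Xnorm U (P t z - z) < \<epsilon> / real CARD('n)"
    using P_strongly_continuous [OF z] by (rule order_tendstoD(2)) (use \<open>0 < \<epsilon>\<close> in simp)
  then obtain d where d: "d > 0" "\<And>t. 0 < t \<Longrightarrow> t < d \<Longrightarrow> Xnorm U (P t z - z) < \<epsilon> / real CARD('n)"
    by (auto simp: eventually_at_right_field)
  have le: "Xnorm U (P (t + h) z - P t z) \<le> \<epsilon>" if "h \<in> {0..d / 2}" "0 \<le> t" for h t
  proof (cases "h = 0")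
    case True
    then show ?thesis using \<open>0 < \<epsilon>\<close> by simp
  next
    case False
    then have h: "0 < h" "h < d" using that d(1) by auto
    have "Xnorm U (P (t + h) z - P t z) \<le> real CARD('n) * Xnorm U (P h z - z)"
      using P_increment_eq [OF that(2) _ z, of h] h z that(2)
      by (simp add: Xnorm_P_le bc_space_diff P_in)
    also have "\<dots> \<le> real CARD('n) * (\<epsilon> / real CARD('n))" using d(2) [OF h] by (intro mult_left_mono) auto
    finally show ?thesis by simp
  qed
  show ?thesis
    using le d(1) by (intro exI [of _ "d / 2"]) auto
qed

lemma norm_continuous_P:
  assumes z: "z \<in> X" shows "norm_continuous_on U {0..} (\<lambda>t. P t z)"
  unfolding norm_continuous_on_def
proof
  fix t :: real assume t: "t \<in> {0..}"
  show "((\<lambda>s. Xnorm U (P s z - P t z)) \<longlongrightarrow> 0) (at t within {0..})"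
  proof (rule tendstoI)
    fix \<epsilon> :: real assume "\<epsilon> > 0"
    then obtain \<delta> where \<delta>: "\<delta> > 0" "\<And>h t. h \<in> {0..\<delta>} \<Longrightarrow> t \<ge> 0 \<Longrightarrow> Xnorm U (P (t + h) z - P t z) \<le> \<epsilon> / 2"
      using P_uniformly_strongly_continuous [OF z, of "\<epsilon> / 2"] by auto
    \<comment> \<open>Right continuity that is uniform in the base point also gives left continuity:
      for s < t the increment is read from \<open>s\<close>.\<close>
    have "Xnorm U (P s z - P t z) \<le> \<epsilon> / 2" if "s \<in> {0..}" "dist s t < \<delta>" for s
    proof (cases "t \<le> s")
      case True
      then show ?thesis using \<delta>(2) [of "s - t" t] that t by (simp add: dist_real_def)
    next
      case False
      then show ?thesis using \<delta>(2) [of "t - s" s] that t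
        by (simp add: dist_real_def Xnorm_minus_commute)
    qed
    then have "dist (Xnorm U (P s z - P t z)) 0 < \<epsilon>" if "s \<in> {0..}" "dist s t < \<delta>" for s
      using that \<open>\<epsilon> > 0\<close> t Xnorm_nonneg [OF bc_space_diff [OF P_in P_in], OF _ z _ z, of s t] by fastforce
    then show "\<forall>\<^sub>F s in at t within {0..}. dist (Xnorm U (P s z - P t z)) 0 < \<epsilon>"
      unfolding eventually_at using \<delta>(1) by blast
  qed
qed

text \<open>For fixed \<open>z\<close>, strong continuity makes \<open>P (t - s) z x\<close>
  continuous in \<open>s\<close>, which supplies the measurability demanded of a family of
  operators.\<close>

lemma bint_convolution:
  assumes F: "bint bc a b F m" and "b \<le> t"
  shows "bint bc a b (\<lambda>s. P (t - s) (F s)) (\<lambda>s. real CARD('n) * m s)"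
proof (rule bint_bdd_linear_family [OF F])
  show "bdd_linear bc (real CARD('n)) (P (t - s))" if "s \<in> {a..b}" for s
    using that \<open>b \<le> t\<close> by (intro P_linear) auto
  fix z x assume z: "z \<in> X"
  have "continuous_on {0..} (\<lambda>s. P s z x)"
    by (rule norm_continuous_on_ptw [where bc = bc, OF _ norm_continuous_P [OF z]]) (simp add: P_in z)
  then have "continuous_on {a..b} (\<lambda>s. P (t - s) z x)"
    using \<open>b \<le> t\<close> by (intro continuous_on_compose2 [where g = "\<lambda>s. P s z x" and f = "\<lambda>s. t - s"] continuous_intros) auto
  then show "(\<lambda>s. P (t - s) z x) \<in> borel_measurable (lebesgue_on {a..b})"
    by (rule continuous_on_imp_lebesgue_on_measurable)
qed simp

end

section \<open>Caratheodory maps and their superposition operators\<close>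

lemma nemytskii_diff: "nemytskii U (g - h) s z = nemytskii U g s z - nemytskii U h s z"
  by (auto simp: nemytskii_def fun_eq_iff)

context bounded_domain
begin

lemma SC_compose_measurable:
  fixes g :: "real \<Rightarrow> real ^ 'm \<Rightarrow> real ^ 'n \<Rightarrow> real ^ 'n"
  assumes g: "g \<in> SC U" and x: "x \<in> closure U" and w: "w \<in> borel_measurable (lebesgue_on {a..b})"
  shows "(\<lambda>s. g s x (w s)) \<in> borel_measurable (lebesgue_on {a..b})"
proof -
  have id: "(\<lambda>s::real. s) \<in> borel_measurable (lebesgue_on {a..b})"
    using id_borel_measurable_lebesgue_on [of "{a..b}"] by (simp add: id_def)
  have 1: "(\<lambda>s. (s, x, w s)) \<in> lebesgue_on {a..b} \<rightarrow>\<^sub>M restrict_space borel (UNIV \<times> closure U \<times> UNIV)"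
    using x by (intro measurable_restrict_space2 borel_measurable_Pair id w) auto
  have 2: "(\<lambda>(t, x, y). g t x y) \<in> borel_measurable (restrict_space borel (UNIV \<times> closure U \<times> UNIV))"
    using g by (simp add: SC_def)
  show ?thesis using measurable_compose [OF 1 2] by simp
qed

lemma SC_AE_continuous:
  fixes g :: "real \<Rightarrow> real ^ 'm \<Rightarrow> real ^ 'n \<Rightarrow> real ^ 'n"
  assumes "g \<in> SC U"
  shows "AE s in lebesgue_on {a..b}. continuous_on (closure U \<times> UNIV) (\<lambda>(x, y). g s x y)"
proof -
  have "AE s in lebesgue. continuous_on (closure U \<times> UNIV) (\<lambda>(x, y). g s x y)"
    using assms by (simp add: SC_def)
  then show ?thesis unfolding AE_lebesgue_on_iff by eventually_elim simp
qed

lemma SC_AE_continuous_l1_norm: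
  fixes g :: "real \<Rightarrow> real ^ 'm \<Rightarrow> real ^ 'n \<Rightarrow> real ^ 'n"
  assumes "g \<in> SC U"
  shows "AE s in lebesgue_on {a..b}. continuous_on (closure U \<times> l1_ball r) (\<lambda>(x, y). l1_norm (g s x y))
    \<and> bdd_above ((\<lambda>(x, y). l1_norm (g s x y)) ` (closure U \<times> l1_ball r))"
  using SC_AE_continuous [OF assms]
proof eventually_elim
  case (elim s)
  have "continuous_on (closure U \<times> l1_ball r) (\<lambda>p. l1_norm (case p of (x, y) \<Rightarrow> g s x y))"
    by (intro continuous_intros continuous_on_subset [OF elim]) auto
  then have c: "continuous_on (closure U \<times> l1_ball r) (\<lambda>(x, y). l1_norm (g s x y))"
    by (simp add: case_prod_unfold)
  moreover have "compact (closure U \<times> (l1_ball r :: (real ^ 'n) set))"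
    by (intro compact_Times compact_l1_ball compact_closure_U)
  ultimately show ?case
    by (meson bounded_imp_bdd_above compact_continuous_image compact_imp_bounded)
qed

lemma l1_norm_le_opt_m_bound:
  fixes g :: "real \<Rightarrow> real ^ 'm \<Rightarrow> real ^ 'n \<Rightarrow> real ^ 'n"
  assumes "bdd_above ((\<lambda>(x, y). l1_norm (g s x y)) ` (closure U \<times> l1_ball (real j)))"
    and "x \<in> closure U" "y \<in> l1_ball (real j)"
  shows "l1_norm (g s x y) \<le> opt_m_bound U g j s"
  unfolding opt_m_bound_def using cSUP_upper [OF _ assms(1), of "(x, y)"] assms(2,3) by auto

lemma zero_in_l1_ball: "0 \<le> r \<Longrightarrow> 0 \<in> l1_ball r"
  by (simp add: l1_ball_def)

text \<open>A real supremum over an unbounded set carries no information. Boundedness is known only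
  for almost every time, hence the almost everywhere form.\<close>

lemma opt_m_bound_AE_nonneg:
  fixes g :: "real \<Rightarrow> real ^ 'm \<Rightarrow> real ^ 'n \<Rightarrow> real ^ 'n"
  assumes "g \<in> SC U"
  shows "AE s in lebesgue_on {a..b}. 0 \<le> opt_m_bound U g j s"
  using SC_AE_continuous_l1_norm [OF assms, where r = "real j"]
proof eventually_elim
  case (elim s)
  obtain x0 where "x0 \<in> closure U" by (rule obtain_point)
  then have "l1_norm (g s x0 0) \<le> opt_m_bound U g j s"
    using elim by (intro l1_norm_le_opt_m_bound zero_in_l1_ball) auto
  then show ?case using l1_norm_nonneg order_trans by blast
qed

lemma opt_m_bound_le_m_bound:
  fixes g :: "real \<Rightarrow> real ^ 'm \<Rightarrow> real ^ 'n \<Rightarrow> real ^ 'n"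
  assumes "m_bound U g (l1_ball (real j)) m"
  shows "AE s in lebesgue_on {a..b}. opt_m_bound U g j s \<le> m s"
proof -
  have "AE s in lebesgue. \<forall>x\<in>closure U. \<forall>y\<in>l1_ball (real j). l1_norm (g s x y) \<le> m s"
    using assms by (simp add: m_bound_def)
  then show ?thesis unfolding AE_lebesgue_on_iff
  proof eventually_elim
    case (elim s)
    have "closure U \<times> (l1_ball (real j) :: (real ^ 'n) set) \<noteq> {}"
      using zero_in_l1_ball [of "real j"] by auto
    then have "opt_m_bound U g j s \<le> m s"
      unfolding opt_m_bound_def using elim by (intro cSUP_least) auto
    then show ?case by simp
  qed
qed

text \<open>Measurability comes from a countable dense subset of the parameter set, integrability
  from domination by any m-bound.\<close>

lemma opt_m_bound_integrable:
  fixes g :: "real \<Rightarrow> real ^ 'm \<Rightarrow> real ^ 'n \<Rightarrow> real ^ 'n"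
  assumes g: "g \<in> SC U"
  shows "integrable (lebesgue_on {a..b}) (opt_m_bound U g j)"
proof -
  obtain m where m: "m_bound U g (l1_ball (real j)) m"
    using g compact_l1_ball unfolding SC_def by blast
  have int: "integrable (lebesgue_on {a..b}) m"
    using m by (simp add: m_bound_def L1loc_def set_integrable_lebesgue_on)
  obtain D where D: "countable D" "D \<subseteq> closure U \<times> (l1_ball (real j) :: (real ^ 'n) set)"
    "closure U \<times> l1_ball (real j) \<subseteq> closure D"
    using separable by blast
  show ?thesis
  proof (rule Bochner_Integration.integrable_bound [OF int])
    show "opt_m_bound U g j \<in> borel_measurable (lebesgue_on {a..b})"
      unfolding opt_m_bound_def
    proof (rule measurable_SUP_continuous [OF D(2,3,1)])
      show "closure U \<times> (l1_ball (real j) :: (real ^ 'n) set) \<noteq> {}"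
        using zero_in_l1_ball [of "real j"] by auto
      show "AE s in lebesgue_on {a..b}.
          continuous_on (closure U \<times> l1_ball (real j)) (\<lambda>(x, y). l1_norm (g s x y)) \<and>
          bdd_above ((\<lambda>(x, y). l1_norm (g s x y)) ` (closure U \<times> l1_ball (real j)))"
        by (rule SC_AE_continuous_l1_norm [OF g])
      fix p assume "p \<in> closure U \<times> (l1_ball (real j) :: (real ^ 'n) set)"
      then have "(\<lambda>s. g s (fst p) (snd p)) \<in> borel_measurable (lebesgue_on {a..b})"
        by (intro SC_compose_measurable [OF g]) auto
      then show "(\<lambda>s. case p of (x, y) \<Rightarrow> l1_norm (g s x y)) \<in> borel_measurable (lebesgue_on {a..b})"
        unfolding case_prod_unfold by measurable
    qed
    show "AE s in lebesgue_on {a..b}. norm (opt_m_bound U g j s) \<le> norm (m s)"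
      using opt_m_bound_AE_nonneg [OF g, where j = j] opt_m_bound_le_m_bound [OF m] by eventually_elim simp
  qed
qed

text \<open>At almost every time the composition is continuous in \<open>x\<close>. In the Dirichlet
  case \<open>v s\<close> vanishes on the boundary, and \<open>vanish\<close> passes this on to the
  composition, which thus stays in the space.\<close>

lemma bint_nemytskii:
  fixes g :: "real \<Rightarrow> real ^ 'm \<Rightarrow> real ^ 'n \<Rightarrow> real ^ 'n"
  assumes g: "g \<in> SC U"
    and v: "\<And>s. s \<in> {a..b} \<Longrightarrow> v s \<in> Cball U (real j)" "\<And>s. s \<in> {a..b} \<Longrightarrow> v s \<in> bc_space U bc"
    and v_meas: "\<And>x. (\<lambda>s. v s x) \<in> borel_measurable (lebesgue_on {a..b})"
    and vanish: "bc = Dirichlet \<Longrightarrow> \<forall>t. \<forall>x\<in>frontier U. g t x 0 = 0"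
  shows "bint bc a b (\<lambda>s. nemytskii U g s (v s)) (opt_m_bound U g j)"
  unfolding bint_def
proof (intro conjI allI opt_m_bound_integrable [OF g])
  fix x
  show "(\<lambda>s. nemytskii U g s (v s) x) \<in> borel_measurable (lebesgue_on {a..b})"
    using SC_compose_measurable [OF g _ v_meas] by (cases "x \<in> closure U") (auto simp: nemytskii_def)
next
  have "AE s in lebesgue_on {a..b}. s \<in> {a..b}" by (rule AE_I2) simp
  with SC_AE_continuous [OF g] SC_AE_continuous_l1_norm [OF g, where r = "real j"]
  show "AE s in lebesgue_on {a..b}. nemytskii U g s (v s) \<in> bc_space U bc \<and>
      Xnorm U (nemytskii U g s (v s)) \<le> opt_m_bound U g j s"
  proof eventually_elim
    case (elim s)
    have vC: "continuous_on (closure U) (v s)" using v(2) elim(3) by (simp add: bc_space_def Cbar_def)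
    have "continuous_on (closure U) (\<lambda>x. (\<lambda>(x, y). g s x y) (x, v s x))"
      by (rule continuous_on_compose2 [OF elim(1)]) (auto intro!: continuous_intros vC)
    then have "continuous_on (closure U) (nemytskii U g s (v s))"
      by (rule continuous_on_eq) (simp add: nemytskii_def)
    moreover have "nemytskii U g s (v s) x = 0" if "bc = Dirichlet" "x \<in> frontier U" for x
      using v(2) [OF elim(3)] that vanish by (auto simp: nemytskii_def bc_space_def frontier_def)
    ultimately have "nemytskii U g s (v s) \<in> bc_space U bc"
      by (auto simp: bc_space_def Cbar_def nemytskii_def)
    moreover have "Xnorm U (nemytskii U g s (v s)) \<le> opt_m_bound U g j s"
    proof (rule Xnorm_le)
      fix x assume x: "x \<in> closure U"
      then show "l1_norm (nemytskii U g s (v s) x) \<le> opt_m_bound U g j s"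
        using elim(2) v(1) [OF elim(3)]
        by (auto simp: nemytskii_def Cball_def intro!: l1_norm_le_opt_m_bound)
    qed
    ultimately show ?case by simp
  qed
qed

text \<open>The seminorms are evaluated at \<open>fs n - f\<close>, which must therefore be a
  Caratheodory map in its own right.\<close>

lemma SC_diff:
  fixes g h :: "real \<Rightarrow> real ^ 'm \<Rightarrow> real ^ 'n \<Rightarrow> real ^ 'n"
  assumes g: "g \<in> SC U" and h: "h \<in> SC U"
  shows "g - h \<in> SC U"
proof -
  let ?M = "restrict_space borel (UNIV \<times> closure U \<times> UNIV) :: (real \<times> (real ^ 'm) \<times> (real ^ 'n)) measure"
  have "(\<lambda>(t, x, y). g t x y) \<in> borel_measurable ?M" "(\<lambda>(t, x, y). h t x y) \<in> borel_measurable ?M"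
    using g h by (simp_all add: SC_def)
  then have "(\<lambda>p. (case p of (t, x, y) \<Rightarrow> g t x y) - (case p of (t, x, y) \<Rightarrow> h t x y)) \<in> borel_measurable ?M"
    by (rule borel_measurable_diff)
  then have 1: "(\<lambda>(t, x, y). (g - h) t x y) \<in> borel_measurable ?M"
    by (simp add: case_prod_unfold)
  have 2: "\<exists>m. m_bound U (g - h) K m" if "compact K" for K
  proof -
    have "\<exists>m. m_bound U g K m" "\<exists>m. m_bound U h K m" using g h that by (simp_all add: SC_def)
    then obtain m m' where m: "m_bound U g K m" "m_bound U h K m'" by blast
    have "AE t in lebesgue. \<forall>x\<in>closure U. \<forall>y\<in>K. l1_norm (g t x y) \<le> m t"
      "AE t in lebesgue. \<forall>x\<in>closure U. \<forall>y\<in>K. l1_norm (h t x y) \<le> m' t"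
      using m by (simp_all add: m_bound_def)
    then have "AE t in lebesgue. \<forall>x\<in>closure U. \<forall>y\<in>K. l1_norm ((g - h) t x y) \<le> m t + m' t"
    proof eventually_elim
      case (elim t)
      show ?case
      proof (intro ballI)
        fix x y assume "x \<in> closure U" "y \<in> K"
        then show "l1_norm ((g - h) t x y) \<le> m t + m' t"
          using elim l1_norm_triangle [of "g t x y" "- h t x y"] by fastforce
      qed
    qed
    then have "m_bound U (g - h) K (\<lambda>t. m t + m' t)"
      using m by (auto simp: m_bound_def L1loc_def)
    then show ?thesis by blast
  qed
  have "AE t in lebesgue. continuous_on (closure U \<times> UNIV) (\<lambda>(x, y). g t x y)"
    "AE t in lebesgue. continuous_on (closure U \<times> UNIV) (\<lambda>(x, y). h t x y)"
    using g h by (simp_all add: SC_def)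
  then have 3: "AE t in lebesgue. continuous_on (closure U \<times> UNIV) (\<lambda>(x, y). (g - h) t x y)"
  proof eventually_elim
    case (elim t)
    from continuous_on_diff [OF elim] show ?case by (simp add: case_prod_unfold)
  qed
  show ?thesis unfolding SC_def mem_Collect_eq by (intro conjI allI impI 1 2 3)
qed

text \<open>One exceptional null set serves all pairs \<open>z\<close>, \<open>w\<close> at once, so
  the estimate can be used along curves that are chosen later.\<close>

lemma LC_lipschitz:
  fixes g :: "real \<Rightarrow> real ^ 'm \<Rightarrow> real ^ 'n \<Rightarrow> real ^ 'n"
  assumes "g \<in> LC U"
  shows "\<exists>l. (\<forall>a b. integrable (lebesgue_on {a..b}) l) \<and> (\<forall>t. 0 \<le> l t) \<and>
    (\<forall>a b. AE s in lebesgue_on {a..b}. \<forall>z\<in>Cball U r. \<forall>w\<in>Cball U r.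
       Xnorm U (nemytskii U g s z - nemytskii U g s w) \<le> l s * Xnorm U (z - w))"
proof -
  have "\<exists>l\<in>L1loc. (\<forall>t. 0 \<le> l t) \<and>
      (AE t in lebesgue. \<forall>x\<in>closure U. \<forall>y1\<in>l1_ball r. \<forall>y2\<in>l1_ball r.
         l1_norm (g t x y1 - g t x y2) \<le> l t * l1_norm (y1 - y2))"
    using assms unfolding LC_def by (elim CollectE conjE allE [of _ "l1_ball r"] mp) (rule compact_l1_ball)
  then obtain l where l: "l \<in> L1loc" "\<forall>t. 0 \<le> l t"
    "AE t in lebesgue. \<forall>x\<in>closure U. \<forall>y1\<in>l1_ball r. \<forall>y2\<in>l1_ball r.
       l1_norm (g t x y1 - g t x y2) \<le> l t * l1_norm (y1 - y2)"
    by blast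
  have "AE s in lebesgue_on {a..b}. \<forall>z\<in>Cball U r. \<forall>w\<in>Cball U r.
       Xnorm U (nemytskii U g s z - nemytskii U g s w) \<le> l s * Xnorm U (z - w)" for a b
    unfolding AE_lebesgue_on_iff using l(3)
  proof eventually_elim
    case (elim s)
    have "Xnorm U (nemytskii U g s z - nemytskii U g s w) \<le> l s * Xnorm U (z - w)"
      if z: "z \<in> Cball U r" and w: "w \<in> Cball U r" for z w
    proof (rule Xnorm_le)
      fix x assume x: "x \<in> closure U"
      have "z - w \<in> bc_space U Neumann"
        using z w by (intro bc_space_diff) (auto simp: Cball_def bc_space_Neumann)
      from l1_norm_le_Xnorm [OF this, of x] have "l1_norm (z x - w x) \<le> Xnorm U (z - w)" by simp
      from mult_left_mono [OF this, of "l s"] l(2)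
      have "l s * l1_norm (z x - w x) \<le> l s * Xnorm U (z - w)" by simp
      moreover have "l1_norm (g s x (z x) - g s x (w x)) \<le> l s * l1_norm (z x - w x)"
        using elim x z w by (auto simp: Cball_def)
      ultimately show "l1_norm ((nemytskii U g s z - nemytskii U g s w) x) \<le> l s * Xnorm U (z - w)"
        using x by (simp add: nemytskii_def)
    qed
    then show ?case by blast
  qed
  then show ?thesis
    using l(1,2) by (intro exI [of _ l]) (auto simp: L1loc_def set_integrable_lebesgue_on)
qed

text \<open>The optimal m-bound of a map lies almost everywhere below the one chosen for it in
  \<open>\<S>\<close>, and so inherits the common modulus.\<close>

lemma equicontinuous_opt_m_bound:
  fixes E :: "(real \<Rightarrow> real ^ 'm \<Rightarrow> real ^ 'n \<Rightarrow> real ^ 'n) set"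
  assumes E: "E \<subseteq> SC U" "L1loc_equicontinuous_m_bounds U E" and j: "1 \<le> j" and "0 < r" "0 < \<epsilon>"
  shows "\<exists>\<delta>>0. \<forall>g\<in>E. \<forall>t1 t2. - r \<le> t1 \<and> t1 \<le> t2 \<and> t2 \<le> r \<and> t2 - t1 < \<delta> \<longrightarrow>
    integral\<^sup>L (lebesgue_on {t1..t2}) (opt_m_bound U g j) < \<epsilon>"
proof -
  obtain \<S> where \<S>: "\<forall>g\<in>E. \<exists>m\<in>\<S>. m_bound U g (l1_ball (real j)) m"
    "\<forall>r>0. \<forall>\<epsilon>>0. \<exists>\<delta>>0. \<forall>t1 t2. - r \<le> t1 \<and> t1 \<le> t2 \<and> t2 \<le> r \<and> t2 - t1 < \<delta> \<longrightarrow>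
      (SUP m\<in>\<S>. ereal (LINT s:{t1..t2}|lebesgue. m s)) < ereal \<epsilon>"
    using E(2) j unfolding L1loc_equicontinuous_m_bounds_def by metis
  then obtain \<delta> where \<delta>: "\<delta> > 0" "\<And>t1 t2. - r \<le> t1 \<Longrightarrow> t1 \<le> t2 \<Longrightarrow> t2 \<le> r \<Longrightarrow> t2 - t1 < \<delta> \<Longrightarrow>
      (SUP m\<in>\<S>. ereal (LINT s:{t1..t2}|lebesgue. m s)) < ereal \<epsilon>"
    using \<open>0 < r\<close> \<open>0 < \<epsilon>\<close> by metis
  show ?thesis
  proof (intro exI [of _ \<delta>] conjI \<delta>(1) ballI allI impI; elim conjE)
    fix g t1 t2 assume g: "g \<in> E" and t: "- r \<le> t1" "t1 \<le> t2" "t2 \<le> r" "t2 - t1 < \<delta>"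
    obtain m where m: "m \<in> \<S>" "m_bound U g (l1_ball (real j)) m" using \<S>(1) g by blast
    have int: "integrable (lebesgue_on {t1..t2}) m"
      using m(2) by (simp add: m_bound_def L1loc_def set_integrable_lebesgue_on)
    have "integral\<^sup>L (lebesgue_on {t1..t2}) (opt_m_bound U g j) \<le> integral\<^sup>L (lebesgue_on {t1..t2}) m"
      using E(1) g by (intro integral_mono_AE opt_m_bound_integrable int opt_m_bound_le_m_bound m(2)) auto
    moreover have "ereal (LINT s:{t1..t2}|lebesgue. m s) < ereal \<epsilon>"
      using \<delta>(2) [OF t] SUP_upper [OF m(1), of "\<lambda>m. ereal (LINT s:{t1..t2}|lebesgue. m s)"]
      by (rule le_less_trans [rotated])
    ultimately show "integral\<^sup>L (lebesgue_on {t1..t2}) (opt_m_bound U g j) < \<epsilon>"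
      by (simp add: LINT_lebesgue_on)
  qed
qed

text \<open>A piece shorter than the equicontinuity threshold for the value 1 contributes less than
  1, and the number of pieces needed is the same for all maps of \<open>E\<close>.\<close>

lemma uniformly_bounded_opt_m_bound:
  fixes E :: "(real \<Rightarrow> real ^ 'm \<Rightarrow> real ^ 'n \<Rightarrow> real ^ 'n) set"
  assumes E: "E \<subseteq> SC U" "L1loc_equicontinuous_m_bounds U E" and j: "1 \<le> j"
  shows "\<exists>B. \<forall>g\<in>E. integral\<^sup>L (lebesgue_on {a..b}) (opt_m_bound U g j) \<le> B"
proof (cases "a \<le> b")
  case ab: True
  \<comment> \<open>A window containing [a, b]; the added 1 makes its radius positive.\<close>
  define r where "r = \<bar>a\<bar> + \<bar>b\<bar> + 1"
  have "0 < r" by (simp add: r_def)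
  from equicontinuous_opt_m_bound [OF E j this zero_less_one]
  obtain \<delta> where \<delta>: "\<delta> > 0" "\<And>g t1 t2. g \<in> E \<Longrightarrow> - r \<le> t1 \<Longrightarrow> t1 \<le> t2 \<Longrightarrow> t2 \<le> r \<Longrightarrow> t2 - t1 < \<delta> \<Longrightarrow>
      integral\<^sup>L (lebesgue_on {t1..t2}) (opt_m_bound U g j) < 1"
    by blast
  \<comment> \<open>Half of the threshold, because the threshold itself must not be
    attained.\<close>
  define d where "d = \<delta> / 2"
  have d: "0 < d" "d < \<delta>" using \<delta>(1) by (auto simp: d_def)
  have step: "integral\<^sup>L (lebesgue_on {a..min b (a + real k * d)}) (opt_m_bound U g j) \<le> real k"
    if g: "g \<in> E" for g k
  proof (induction k)
    case 0
    have "integral\<^sup>L (lebesgue_on {a..a}) (opt_m_bound U g j) = 0"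
      by (rule integral_eq_zero_null_sets) simp
    then show ?case using ab by simp
  next
    case (Suc k)
    let ?c = "min b (a + real k * d)" and ?e = "min b (a + real (Suc k) * d)"
    have le: "a \<le> ?c" "?c \<le> ?e" "?e - ?c < \<delta>" "?e \<le> b"
      using ab d by (auto simp: min_def algebra_simps)
    have "integral\<^sup>L (lebesgue_on {a..?e}) (opt_m_bound U g j)
        = integral\<^sup>L (lebesgue_on {a..?c}) (opt_m_bound U g j) + integral\<^sup>L (lebesgue_on {?c..?e}) (opt_m_bound U g j)"
      using g E(1) le by (intro integral_lebesgue_on_combine opt_m_bound_integrable) auto
    moreover have "integral\<^sup>L (lebesgue_on {?c..?e}) (opt_m_bound U g j) < 1"
      using le by (intro \<delta>(2) g) (auto simp: r_def)
    ultimately show ?case using Suc by simp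
  qed
  obtain k :: nat where "(b - a) / d < real k" using reals_Archimedean2 by blast
  then have "min b (a + real k * d) = b" using d by (simp add: field_simps)
  with step [of _ k] show ?thesis by auto
qed (auto intro!: exI [of _ 0])

end

section \<open>A weighted estimate and Gronwall's inequality\<close>

lemma integrable_mult_continuous:
  fixes l g :: "real \<Rightarrow> real"
  assumes l: "integrable (lebesgue_on {a..b}) l" and g: "continuous_on {a..b} g"
  shows "integrable (lebesgue_on {a..b}) (\<lambda>s. l s * g s)"
proof -
  have "bounded (g ` {a..b})" by (intro compact_imp_bounded compact_continuous_image g) simp
  then obtain B where B: "\<And>s. s \<in> {a..b} \<Longrightarrow> \<bar>g s\<bar> \<le> B"
    unfolding bounded_iff by (metis imageI real_norm_def)
  have [measurable]: "l \<in> borel_measurable (lebesgue_on {a..b})" "g \<in> borel_measurable (lebesgue_on {a..b})"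
    using l continuous_on_imp_lebesgue_on_measurable [OF g] by auto
  show ?thesis
  proof (rule Bochner_Integration.integrable_bound)
    show "integrable (lebesgue_on {a..b}) (\<lambda>s. B * \<bar>l s\<bar>)" using l by simp
    show "AE s in lebesgue_on {a..b}. norm (l s * g s) \<le> norm (B * \<bar>l s\<bar>)"
    proof (rule AE_I2)
      fix s assume "s \<in> space (lebesgue_on {a..b})"
      then have "\<bar>g s\<bar> \<le> B" using B by simp
      then show "norm (l s * g s) \<le> norm (B * \<bar>l s\<bar>)"
        by (simp add: abs_mult mult.commute mult_right_mono)
    qed
  qed measurable
qed

text \<open>Up to a part of small integral, \<open>l\<close> is bounded, and bounded kernels are made contractive
  by an exponential weight. This replaces the usual weight \<open>exp (\<integral> l)\<close> and the absolutely
  continuous calculus that goes with it.\<close>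

lemma exponential_weight:
  fixes l :: "real \<Rightarrow> real"
  assumes l: "integrable (lebesgue_on {0..T}) l" and l0: "\<And>s. 0 \<le> l s" and c: "0 \<le> c"
  shows "\<exists>\<kappa>\<ge>0. \<forall>t\<in>{0..T}. c * (\<integral>s. l s * exp (\<kappa> * s) \<partial>lebesgue_on {0..t}) \<le> exp (\<kappa> * t) / 2"
proof -
  let ?e = "\<lambda>(k::nat) s. max 0 (l s - real k)"
  have [measurable]: "l \<in> borel_measurable (lebesgue_on {0..T})" using l by auto
  have int_e: "integrable (lebesgue_on {0..T}) (?e k)" for k
    by (rule Bochner_Integration.integrable_bound [OF l]) (use l0 in \<open>auto intro!: AE_I2\<close>)
  have "(\<lambda>k. \<integral>s. ?e k s \<partial>lebesgue_on {0..T}) \<longlonglongrightarrow> (\<integral>s. 0 \<partial>lebesgue_on {0..T})"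
  proof (rule integral_dominated_convergence [OF _ _ l])
    show "AE s in lebesgue_on {0..T}. (\<lambda>k. ?e k s) \<longlonglongrightarrow> 0"
    proof (rule AE_I2)
      fix s
      have "\<forall>\<^sub>F k in sequentially. ?e k s = 0"
        using eventually_ge_at_top [of "nat \<lceil>l s\<rceil>"] by eventually_elim linarith
      then show "(\<lambda>k. ?e k s) \<longlonglongrightarrow> 0" by (rule tendsto_eventually)
    qed
  qed (use l0 in \<open>auto intro!: AE_I2\<close>)
  then have "(\<lambda>k. c * (\<integral>s. ?e k s \<partial>lebesgue_on {0..T})) \<longlonglongrightarrow> c * 0" by (intro tendsto_mult_left) simp
  then have "\<forall>\<^sub>F k in sequentially. c * (\<integral>s. ?e k s \<partial>lebesgue_on {0..T}) < 1 / 4"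
    by (rule order_tendstoD) simp
  then obtain k where k: "c * (\<integral>s. ?e k s \<partial>lebesgue_on {0..T}) < 1 / 4"
    by (auto simp: eventually_sequentially)
  define \<kappa> where "\<kappa> = 4 * c * real k + 1"
  have \<kappa>: "0 < \<kappa>" using c by (simp add: \<kappa>_def add_nonneg_pos)
  have "c * (\<integral>s. l s * exp (\<kappa> * s) \<partial>lebesgue_on {0..t}) \<le> exp (\<kappa> * t) / 2" if t: "t \<in> {0..T}" for t
  proof -
    have sub: "{0..t} \<subseteq> {0..T}" using t by auto
    have cont: "continuous_on {0..t} (\<lambda>s. exp (\<kappa> * s))" by (intro continuous_intros)
    have int_exp: "integrable (lebesgue_on {0..t}) (\<lambda>s. exp (\<kappa> * s))"
      using cont by (intro absolutely_integrable_imp_integrable absolutely_integrable_continuous_real) auto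
    have int_et: "integrable (lebesgue_on {0..t}) (?e k)" by (rule integrable_lebesgue_on_subset [OF int_e sub])
    have "((\<lambda>s. exp (\<kappa> * s)) has_integral exp (\<kappa> * t) / \<kappa> - exp (\<kappa> * 0) / \<kappa>) {0..t}"
      using t \<kappa> by (intro fundamental_theorem_of_calculus)
        (auto intro!: derivative_eq_intros simp flip: has_real_derivative_iff_has_vector_derivative)
    then have exp_int: "(\<integral>s. exp (\<kappa> * s) \<partial>lebesgue_on {0..t}) \<le> exp (\<kappa> * t) / \<kappa>"
      using lebesgue_integral_eq_integral [OF int_exp] \<kappa> by (simp add: integral_unique)
    have "(\<integral>s. l s * exp (\<kappa> * s) \<partial>lebesgue_on {0..t})
        \<le> (\<integral>s. real k * exp (\<kappa> * s) + exp (\<kappa> * t) * ?e k s \<partial>lebesgue_on {0..t})"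
    proof (rule integral_mono)
      show "integrable (lebesgue_on {0..t}) (\<lambda>s. l s * exp (\<kappa> * s))"
        by (rule integrable_mult_continuous [OF integrable_lebesgue_on_subset [OF l sub] cont])
      show "integrable (lebesgue_on {0..t}) (\<lambda>s. real k * exp (\<kappa> * s) + exp (\<kappa> * t) * ?e k s)"
        using int_exp int_et by simp
      fix s assume "s \<in> space (lebesgue_on {0..t})"
      then have "exp (\<kappa> * s) \<le> exp (\<kappa> * t)" using \<kappa> by simp
      then have "?e k s * exp (\<kappa> * s) \<le> ?e k s * exp (\<kappa> * t)" by (intro mult_left_mono) auto
      moreover have "l s * exp (\<kappa> * s) \<le> (real k + ?e k s) * exp (\<kappa> * s)" by (intro mult_right_mono) auto
      ultimately show "l s * exp (\<kappa> * s) \<le> real k * exp (\<kappa> * s) + exp (\<kappa> * t) * ?e k s"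
        by (simp add: algebra_simps)
    qed
    also have "\<dots> = real k * (\<integral>s. exp (\<kappa> * s) \<partial>lebesgue_on {0..t}) + exp (\<kappa> * t) * (\<integral>s. ?e k s \<partial>lebesgue_on {0..t})"
      using int_exp int_et by simp
    also have "\<dots> \<le> real k * (exp (\<kappa> * t) / \<kappa>) + exp (\<kappa> * t) * (\<integral>s. ?e k s \<partial>lebesgue_on {0..T})"
      using exp_int integral_lebesgue_on_mono_set [OF int_e sub]
      by (intro add_mono mult_left_mono) auto
    finally have "c * (\<integral>s. l s * exp (\<kappa> * s) \<partial>lebesgue_on {0..t})
        \<le> c * (real k * (exp (\<kappa> * t) / \<kappa>) + exp (\<kappa> * t) * (\<integral>s. ?e k s \<partial>lebesgue_on {0..T}))"
      using c by (rule mult_left_mono)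
    also have "\<dots> = exp (\<kappa> * t) * (c * real k / \<kappa> + c * (\<integral>s. ?e k s \<partial>lebesgue_on {0..T}))"
      by (simp add: algebra_simps)
    also have "\<dots> \<le> exp (\<kappa> * t) * (1 / 4 + 1 / 4)"
    proof (intro mult_left_mono add_mono)
      show "c * real k / \<kappa> \<le> 1 / 4" using \<kappa> by (simp add: \<kappa>_def divide_simps)
    qed (use k in auto)
    finally show ?thesis by simp
  qed
  then show ?thesis using \<kappa> by (intro exI [of _ \<kappa>]) auto
qed

text \<open>Let \<mu> be the maximum of exp (- \<kappa> t) \<phi>(t), attained at \<open>r\<close>.
  If it is positive, the weight inequality bounds the integral term at \<open>r\<close> by \<mu> exp
  (\<kappa> r) / 2, and absorbing this into the left side produces the factor 2.\<close>

lemma gronwall_weighted: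
  fixes l \<phi> :: "real \<Rightarrow> real"
  assumes l: "integrable (lebesgue_on {0..T}) l" and l0: "\<And>s. 0 \<le> l s" and c: "0 \<le> c" and \<kappa>: "0 \<le> \<kappa>"
    and weight: "\<And>t. t \<in> {0..T} \<Longrightarrow> c * (\<integral>s. l s * exp (\<kappa> * s) \<partial>lebesgue_on {0..t}) \<le> exp (\<kappa> * t) / 2"
    and \<phi>: "continuous_on {0..T} \<phi>" and \<epsilon>: "0 \<le> \<epsilon>"
    and ineq: "\<And>t. t \<in> {0..T} \<Longrightarrow> \<phi> t \<le> \<epsilon> + c * (\<integral>s. l s * \<phi> s \<partial>lebesgue_on {0..t})"
    and t: "t \<in> {0..T}"
  shows "\<phi> t \<le> 2 * \<epsilon> * exp (\<kappa> * t)"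
proof -
  have "continuous_on {0..T} (\<lambda>t. exp (- (\<kappa> * t)) * \<phi> t)" by (intro continuous_intros \<phi>)
  then obtain r where r: "r \<in> {0..T}" "\<And>s. s \<in> {0..T} \<Longrightarrow> exp (- (\<kappa> * s)) * \<phi> s \<le> exp (- (\<kappa> * r)) * \<phi> r"
    using continuous_attains_sup [of "{0..T}" "\<lambda>t. exp (- (\<kappa> * t)) * \<phi> t"] t by auto
  define \<mu> where "\<mu> = exp (- (\<kappa> * r)) * \<phi> r"
  have le: "\<phi> s \<le> \<mu> * exp (\<kappa> * s)" if "s \<in> {0..T}" for s
    using r(2) [OF that] by (simp add: \<mu>_def exp_minus field_simps)
  have \<phi>r: "\<phi> r = \<mu> * exp (\<kappa> * r)" by (simp add: \<mu>_def exp_minus)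
  have "\<mu> \<le> 2 * \<epsilon>"
  proof (cases "\<mu> \<le> 0")
    case False
    have sub: "{0..r} \<subseteq> {0..T}" using r(1) by auto
    have "(\<integral>s. l s * \<phi> s \<partial>lebesgue_on {0..r}) \<le> (\<integral>s. \<mu> * (l s * exp (\<kappa> * s)) \<partial>lebesgue_on {0..r})"
    proof (rule integral_mono)
      show "integrable (lebesgue_on {0..r}) (\<lambda>s. l s * \<phi> s)"
        by (rule integrable_mult_continuous [OF integrable_lebesgue_on_subset [OF l sub] continuous_on_subset [OF \<phi> sub]])
      show "integrable (lebesgue_on {0..r}) (\<lambda>s. \<mu> * (l s * exp (\<kappa> * s)))"
        by (intro integrable_mult_right integrable_mult_continuous [OF integrable_lebesgue_on_subset [OF l sub]] continuous_intros)
      fix s assume "s \<in> space (lebesgue_on {0..r})"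
      then have "s \<in> {0..T}" using sub by auto
      from mult_left_mono [OF le [OF this] l0 [of s]] show "l s * \<phi> s \<le> \<mu> * (l s * exp (\<kappa> * s))"
        by (simp add: algebra_simps)
    qed
    then have "c * (\<integral>s. l s * \<phi> s \<partial>lebesgue_on {0..r}) \<le> c * (\<mu> * (\<integral>s. l s * exp (\<kappa> * s) \<partial>lebesgue_on {0..r}))"
      using c by (intro mult_left_mono) auto
    also have "\<dots> = \<mu> * (c * (\<integral>s. l s * exp (\<kappa> * s) \<partial>lebesgue_on {0..r}))" by simp
    also have "\<dots> \<le> \<mu> * (exp (\<kappa> * r) / 2)" using False by (intro mult_left_mono weight r(1)) auto
    finally have "\<mu> * exp (\<kappa> * r) \<le> 2 * \<epsilon>" using ineq [OF r(1)] \<phi>r by simp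
    moreover have "\<mu> * 1 \<le> \<mu> * exp (\<kappa> * r)" using False \<kappa> r(1) by (intro mult_left_mono) auto
    ultimately show ?thesis by simp
  qed (use \<epsilon> in simp)
  then have "\<mu> * exp (\<kappa> * t) \<le> 2 * \<epsilon> * exp (\<kappa> * t)" by (intro mult_right_mono) auto
  then show ?thesis using le [OF t] by linarith
qed

section \<open>Mild solutions and the truncated equation\<close>

text \<open>Truncation is done componentwise because the radial retraction onto an \<open>l1\<close> ball is not
  1-Lipschitz for the \<open>l1\<close> norm.\<close>

definition clip :: "real \<Rightarrow> (real ^ 'm \<Rightarrow> real ^ 'n) \<Rightarrow> real ^ 'm \<Rightarrow> real ^ 'n" where
  "clip c z = (\<lambda>x. \<chi> i. max (- c) (min c (z x $ i)))"

lemma l1_norm_clip_diff_le: "l1_norm (clip c z x - clip c w x) \<le> l1_norm (z x - w x)"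
  unfolding l1_norm_def clip_def by (intro sum_mono) (auto simp: max_def min_def)

lemma clip_eq:
  assumes "\<And>x. l1_norm (z x) \<le> c" shows "clip c z = z"
proof -
  have "\<bar>z x $ i\<bar> \<le> c" for x i
    using component_le_l1_norm [of "z x" i] assms [of x] by linarith
  then have "z x $ i \<le> c" "- c \<le> z x $ i" for x i
    by (simp_all add: abs_le_iff minus_le_iff)
  then have "max (- c) (min c (z x $ i)) = z x $ i" for x i
    by (simp add: min_absorb2 max_absorb2)
  then show ?thesis by (simp add: clip_def vec_eq_iff fun_eq_iff)
qed

lemma clip_in_bc_space: "0 \<le> c \<Longrightarrow> z \<in> bc_space U bc \<Longrightarrow> clip c z \<in> bc_space U bc"
  unfolding bc_space_def Cbar_def clip_def
  by (auto simp: vec_eq_iff intro!: continuous_intros)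

lemma l1_norm_clip_le:
  fixes z :: "real ^ 'm \<Rightarrow> real ^ 'n"
  assumes "0 \<le> c" shows "l1_norm (clip c z x) \<le> real CARD('n) * c"
proof -
  have "l1_norm (clip c z x) \<le> (\<Sum>i\<in>(UNIV :: 'n set). c)"
    unfolding l1_norm_def clip_def using assms by (intro sum_mono) (auto simp: max_def min_def)
  then show ?thesis by simp
qed

text \<open>Clipping bounds each of the CARD('n) components by \<open>j\<close>. The larger radius
  CARD('n) * j decides which m-bound and which Lipschitz function belong to the truncated
  map.\<close>

lemma clip_in_Cball:
  fixes z :: "real ^ 'm \<Rightarrow> real ^ 'n"
  assumes "z \<in> bc_space U bc"
  shows "clip (real j) z \<in> Cball U (real (CARD('n) * j))"
  using clip_in_bc_space [OF _ assms, of "real j"] l1_norm_clip_le [of "real j" z]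
  by (auto simp: Cball_def bc_space_def l1_ball_def)

lemma (in bounded_domain) pint_cong_AE:
  fixes \<phi> \<psi> :: "real \<Rightarrow> real ^ 'm \<Rightarrow> real ^ 'n"
  assumes \<phi>: "bint bc a b \<phi> m" and \<psi>: "bint bc a b \<psi> m'" and "AE s in lebesgue_on {a..b}. \<phi> s = \<psi> s"
  shows "pint a b \<phi> = pint a b \<psi>"
  unfolding pint_def
proof
  fix x
  show "(\<integral>s. \<phi> s x \<partial>lebesgue_on {a..b}) = (\<integral>s. \<psi> s x \<partial>lebesgue_on {a..b})"
  proof (rule integral_cong_AE [OF bint_measurable [OF \<phi>] bint_measurable [OF \<psi>]])
    show "AE s in lebesgue_on {a..b}. \<phi> s x = \<psi> s x" using assms(3) by eventually_elim simp
  qed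
qed

section \<open>The Duhamel integral\<close>

context heat_flow
begin

definition duhamel :: "real \<Rightarrow> (real \<Rightarrow> real ^ 'm \<Rightarrow> real ^ 'n) \<Rightarrow> real ^ 'm \<Rightarrow> real ^ 'n" where
  "duhamel t F = pint 0 t (\<lambda>s. P (t - s) (F s))"

lemma duhamel_in: "bint bc 0 t F m \<Longrightarrow> duhamel t F \<in> X"
  unfolding duhamel_def by (rule pint_in_bc_space [OF bint_convolution]) auto

lemma bint_P:
  assumes F: "bint bc a b F m" and "0 \<le> h"
  shows "bint bc a b (\<lambda>s. P h (F s)) (\<lambda>s. real CARD('n) * m s)"
  by (rule bint_bdd_linear_family [OF F P_linear [OF \<open>0 \<le> h\<close>]]) auto

text \<open>The operator passes under the integral and the semigroup law adds the times. The
  integrands agree only almost everywhere, since \<open>F s\<close> is known to lie in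
  \<open>X\<close> only for almost every \<open>s\<close>.\<close>

lemma P_duhamel:
  assumes F: "bint bc 0 t F m" and r: "0 \<le> r" "r \<le> t"
  shows "P (t - r) (duhamel r F) = pint 0 r (\<lambda>s. P (t - s) (F s))"
proof -
  have Fr: "bint bc 0 r F m" by (rule bint_subset [OF F]) (use r in auto)
  have c: "bint bc 0 r (\<lambda>s. P (r - s) (F s)) (\<lambda>s. real CARD('n) * m s)" by (rule bint_convolution [OF Fr]) simp
  have "P (t - r) (duhamel r F) = pint 0 r (\<lambda>s. P (t - r) (P (r - s) (F s)))"
    unfolding duhamel_def by (rule pint_bdd_linear [OF c P_linear]) (use r in auto)
  also have "\<dots> = pint 0 r (\<lambda>s. P (t - s) (F s))"
  proof (rule pint_cong_AE [OF bint_P [OF c] bint_convolution [OF Fr]])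
    have "AE s in lebesgue_on {0..r}. s \<in> {0..r}" by (rule AE_I2) simp
    with bint_AE [OF Fr] show "AE s in lebesgue_on {0..r}. P (t - r) (P (r - s) (F s)) = P (t - s) (F s)"
    proof eventually_elim
      case (elim s)
      then show ?case using P_add [of "t - r" "r - s" "F s"] r by simp
    qed
  qed (use r in auto)
  finally show ?thesis .
qed

lemma duhamel_flow:
  assumes F: "bint bc 0 t F m" and r: "0 \<le> r" "r \<le> t"
  shows "duhamel t F = P (t - r) (duhamel r F) + pint r t (\<lambda>s. P (t - s) (F s))"
  unfolding P_duhamel [OF assms]
  unfolding duhamel_def by (rule pint_combine [OF bint_convolution [OF F]]) (use r in auto)

text \<open>An increment from t to t' consists of the change of the semigroup on [0, t] and of the
  new integral over [t, t']. The first is at most N times \<omega>, which tends to 0 by strong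
  continuity and dominated convergence; the second is at most N times an increment of the indefinite
  integral of \<open>m\<close>.\<close>

lemma norm_continuous_duhamel:
  assumes F: "bint bc 0 T F m"
  shows "norm_continuous_on U {0..T} (\<lambda>t. duhamel t F)"
proof -
  let ?N = "real CARD('n)"
  define \<omega> where "\<omega> h = (\<integral>s. Xnorm U (P h (F s) - F s) \<partial>lebesgue_on {0..T})" for h
  define G where "G t = (\<integral>s. m s \<partial>lebesgue_on {0..t})" for t
  have m: "integrable (lebesgue_on {0..T}) m" by (rule bint_bound_integrable [OF F])
  have inc: "bint bc 0 T (\<lambda>s. P h (F s) - F s) (\<lambda>s. ?N * m s + m s)" if "0 \<le> h" for h
    by (rule bint_diff [OF bint_P [OF F that] F])
  have \<omega>_lim: "(\<omega> \<longlongrightarrow> 0) (at 0 within {0..})"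
    unfolding tendsto_at_iff_sequentially
  proof (intro allI impI)
    fix h :: "nat \<Rightarrow> real" assume h: "\<forall>i. h i \<in> {0..} - {0}" "h \<longlonglongrightarrow> 0"
    then have h0: "0 \<le> h i" for i by auto
    have "(\<lambda>i. \<omega> (h i)) \<longlonglongrightarrow> (\<integral>s. 0 \<partial>lebesgue_on {0..T})"
      unfolding \<omega>_def
    proof (rule integral_dominated_convergence [where w = "\<lambda>s. ?N * m s + m s"])
      show "AE s in lebesgue_on {0..T}. norm (Xnorm U (P (h i) (F s) - F s)) \<le> ?N * m s + m s" for i
        using bint_AE [OF inc [OF h0 [of i]]] by eventually_elim (auto dest: Xnorm_nonneg)
      show "AE s in lebesgue_on {0..T}. (\<lambda>i. Xnorm U (P (h i) (F s) - F s)) \<longlonglongrightarrow> 0"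
        using bint_AE [OF F]
      proof eventually_elim
        case (elim s)
        have "filterlim h (at_right 0) sequentially"
          using h by (auto simp: filterlim_at less_le intro!: always_eventually)
        from filterlim_compose [OF P_strongly_continuous this] elim show ?case by simp
      qed
      show "(\<lambda>s. Xnorm U (P (h i) (F s) - F s)) \<in> borel_measurable (lebesgue_on {0..T})" for i
        by (rule borel_measurable_integrable [OF bint_Xnorm_integrable [OF inc [OF h0]]])
      show "integrable (lebesgue_on {0..T}) (\<lambda>s. ?N * m s + m s)" using m by simp
    qed simp
    then show "(\<omega> \<circ> h) \<longlonglongrightarrow> 0" by (simp add: comp_def)
  qed
  have G: "continuous_on {0..T} G"
  proof -
    have "continuous_on {0..T} (\<lambda>t. integral {0..t} m)"
      by (rule indefinite_integral_continuous_1) (rule integrable_on_lebesgue_on [OF m], simp)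
    then show ?thesis
    proof (rule continuous_on_eq)
      fix t assume "t \<in> {0..T}"
      then have "integrable (lebesgue_on {0..t}) m" by (intro integrable_lebesgue_on_subset [OF m]) auto
      then show "integral {0..t} m = G t" by (simp add: G_def lebesgue_integral_eq_integral)
    qed
  qed
  have step: "Xnorm U (duhamel t' F - duhamel t F) \<le> ?N * \<omega> (t' - t) + ?N * \<bar>G t' - G t\<bar>"
    if t: "0 \<le> t" "t \<le> t'" "t' \<le> T" for t t'
  proof -
    have Ft': "bint bc 0 t' F m" and Ft: "bint bc 0 t F m" and Ftt': "bint bc t t' F m"
      by (rule bint_subset [OF F]; use t in auto)+
    have c1: "bint bc 0 t (\<lambda>s. P (t' - s) (F s)) (\<lambda>s. ?N * m s)" by (rule bint_convolution [OF Ft t(2)])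
    have c2: "bint bc 0 t (\<lambda>s. P (t - s) (F s)) (\<lambda>s. ?N * m s)" by (rule bint_convolution [OF Ft]) simp
    have c3: "bint bc t t' (\<lambda>s. P (t' - s) (F s)) (\<lambda>s. ?N * m s)" by (rule bint_convolution [OF Ftt']) simp
    have inct: "bint bc 0 t (\<lambda>s. P (t' - t) (F s) - F s) (\<lambda>s. ?N * m s + m s)"
      by (rule bint_subset [OF inc]) (use t in auto)
    have d: "bint bc 0 t (\<lambda>s. P (t' - s) (F s) - P (t - s) (F s)) (\<lambda>s. ?N * Xnorm U (P (t' - t) (F s) - F s))"
    proof (rule bint_mono [OF bint_diff [OF c1 c2]])
      show "integrable (lebesgue_on {0..t}) (\<lambda>s. ?N * Xnorm U (P (t' - t) (F s) - F s))"
        using bint_Xnorm_integrable [OF inct] by simp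
      have "AE s in lebesgue_on {0..t}. s \<in> {0..t}" by (rule AE_I2) simp
      with bint_AE [OF Ft]
      show "AE s in lebesgue_on {0..t}. Xnorm U (P (t' - s) (F s) - P (t - s) (F s)) \<le> ?N * Xnorm U (P (t' - t) (F s) - F s)"
      proof eventually_elim
        case (elim s)
        then have "P (t' - s) (F s) - P (t - s) (F s) = P (t - s) (P (t' - t) (F s) - F s)"
          using P_increment_eq [of "t - s" "t' - t" "F s"] t by simp
        then show ?case using elim t by (simp add: Xnorm_P_le bc_space_diff P_in)
      qed
    qed
    have "duhamel t' F - duhamel t F
        = pint 0 t (\<lambda>s. P (t' - s) (F s) - P (t - s) (F s)) + pint t t' (\<lambda>s. P (t' - s) (F s))"
      unfolding pint_diff [OF c1 c2]
      using pint_combine [OF bint_convolution [OF Ft'], of t' t] t unfolding duhamel_def by simp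
    then have "Xnorm U (duhamel t' F - duhamel t F)
        \<le> Xnorm U (pint 0 t (\<lambda>s. P (t' - s) (F s) - P (t - s) (F s))) + Xnorm U (pint t t' (\<lambda>s. P (t' - s) (F s)))"
      using Xnorm_triangle [OF pint_in_bc_space [OF d] pint_in_bc_space [OF c3]] by simp
    moreover have "Xnorm U (pint 0 t (\<lambda>s. P (t' - s) (F s) - P (t - s) (F s))) \<le> ?N * \<omega> (t' - t)"
    proof -
      have "(\<integral>s. Xnorm U (P (t' - t) (F s) - F s) \<partial>lebesgue_on {0..t}) \<le> \<omega> (t' - t)"
        unfolding \<omega>_def
      proof (rule integral_lebesgue_on_mono_set)
        show "integrable (lebesgue_on {0..T}) (\<lambda>s. Xnorm U (P (t' - t) (F s) - F s))"
          by (rule bint_Xnorm_integrable [OF inc]) (use t in simp)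
        have "0 \<le> t' - t" using t by simp
        from bint_AE [OF inc [OF this]]
        show "AE s in lebesgue_on {0..T}. 0 \<le> Xnorm U (P (t' - t) (F s) - F s)"
          by eventually_elim (auto dest: Xnorm_nonneg)
      qed (use t in auto)
      then have "?N * (\<integral>s. Xnorm U (P (t' - t) (F s) - F s) \<partial>lebesgue_on {0..t}) \<le> ?N * \<omega> (t' - t)"
        by (intro mult_left_mono) auto
      moreover have "Xnorm U (pint 0 t (\<lambda>s. P (t' - s) (F s) - P (t - s) (F s)))
          \<le> ?N * (\<integral>s. Xnorm U (P (t' - t) (F s) - F s) \<partial>lebesgue_on {0..t})"
        using Xnorm_pint_le [OF d] by simp
      ultimately show ?thesis by linarith
    qed
    moreover have "Xnorm U (pint t t' (\<lambda>s. P (t' - s) (F s))) \<le> ?N * \<bar>G t' - G t\<bar>"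
    proof -
      have "G t' - G t = (\<integral>s. m s \<partial>lebesgue_on {t..t'})"
        unfolding G_def using t
        by (subst integral_lebesgue_on_combine [OF bint_bound_integrable [OF Ft'], of t]) auto
      then have "?N * (\<integral>s. m s \<partial>lebesgue_on {t..t'}) \<le> ?N * \<bar>G t' - G t\<bar>"
        by (intro mult_left_mono) auto
      moreover have "Xnorm U (pint t t' (\<lambda>s. P (t' - s) (F s))) \<le> ?N * (\<integral>s. m s \<partial>lebesgue_on {t..t'})"
        using Xnorm_pint_le [OF c3] by simp
      ultimately show ?thesis by linarith
    qed
    ultimately show ?thesis by linarith
  qed
  have step': "Xnorm U (duhamel s F - duhamel t F) \<le> ?N * \<omega> \<bar>s - t\<bar> + ?N * \<bar>G s - G t\<bar>"
    if "s \<in> {0..T}" "t \<in> {0..T}" for s t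
    using step [of t s] step [of s t] that
    by (cases "t \<le> s") (auto simp: Xnorm_minus_commute [of "duhamel t F"] abs_minus_commute [of "G t"])
  show ?thesis
    unfolding norm_continuous_on_def
  proof
    fix t assume t: "t \<in> {0..T}"
    have ev: "\<forall>\<^sub>F s in at t within {0..T}. s \<in> {0..T}" by (simp add: eventually_at_filter)
    have "((\<lambda>s. s - t) \<longlongrightarrow> t - t) (at t within {0..T})" by (intro tendsto_intros)
    then have "((\<lambda>s. \<bar>s - t\<bar>) \<longlongrightarrow> 0) (at t within {0..T})" by (intro tendsto_rabs_zero) simp
    then have "filterlim (\<lambda>s. \<bar>s - t\<bar>) (at 0 within {0..}) (at t within {0..T})"
      by (simp add: filterlim_at eventually_at_filter)
    from filterlim_compose [OF \<omega>_lim this] have "((\<lambda>s. \<omega> \<bar>s - t\<bar>) \<longlongrightarrow> 0) (at t within {0..T})" .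
    moreover have "((\<lambda>s. \<bar>G s - G t\<bar>) \<longlongrightarrow> 0) (at t within {0..T})"
      using G t unfolding continuous_on by (intro tendsto_rabs_zero) (auto simp flip: Lim_null)
    ultimately have lim: "((\<lambda>s. ?N * \<omega> \<bar>s - t\<bar> + ?N * \<bar>G s - G t\<bar>) \<longlongrightarrow> ?N * 0 + ?N * 0) (at t within {0..T})"
      by (intro tendsto_intros)
    show "((\<lambda>s. Xnorm U (duhamel s F - duhamel t F)) \<longlongrightarrow> 0) (at t within {0..T})"
    proof (rule tendsto_sandwich [OF _ _ tendsto_const])
      have dX: "duhamel s F \<in> X" if "s \<in> {0..T}" for s
        by (rule duhamel_in [OF bint_subset [OF F]]) (use that in auto)
      show "\<forall>\<^sub>F s in at t within {0..T}. 0 \<le> Xnorm U (duhamel s F - duhamel t F)"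
        using ev by eventually_elim (intro Xnorm_nonneg [of _ bc] bc_space_diff dX t)
      show "\<forall>\<^sub>F s in at t within {0..T}. Xnorm U (duhamel s F - duhamel t F) \<le> ?N * \<omega> \<bar>s - t\<bar> + ?N * \<bar>G s - G t\<bar>"
        using ev by eventually_elim (rule step' [OF _ t])
    qed (use lim in simp)
  qed
qed

lemma Xnorm_duhamel_diff_le:
  assumes F: "bint bc 0 t F m" and G: "bint bc 0 t G m'"
    and k: "integrable (lebesgue_on {0..t}) k" "AE s in lebesgue_on {0..t}. Xnorm U (F s - G s) \<le> k s"
  shows "Xnorm U (duhamel t F - duhamel t G) \<le> real CARD('n) * (\<integral>s. k s \<partial>lebesgue_on {0..t})"
proof -
  have c1: "bint bc 0 t (\<lambda>s. P (t - s) (F s)) (\<lambda>s. real CARD('n) * m s)" by (rule bint_convolution [OF F]) simp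
  have c2: "bint bc 0 t (\<lambda>s. P (t - s) (G s)) (\<lambda>s. real CARD('n) * m' s)" by (rule bint_convolution [OF G]) simp
  have "bint bc 0 t (\<lambda>s. P (t - s) (F s) - P (t - s) (G s)) (\<lambda>s. real CARD('n) * k s)"
  proof (rule bint_mono [OF bint_diff [OF c1 c2]])
    show "integrable (lebesgue_on {0..t}) (\<lambda>s. real CARD('n) * k s)" using k(1) by simp
    have "AE s in lebesgue_on {0..t}. s \<in> {0..t}" by (rule AE_I2) simp
    with bint_AE [OF F] bint_AE [OF G] k(2)
    show "AE s in lebesgue_on {0..t}. Xnorm U (P (t - s) (F s) - P (t - s) (G s)) \<le> real CARD('n) * k s"
    proof eventually_elim
      case (elim s)
      have "Xnorm U (P (t - s) (F s) - P (t - s) (G s)) \<le> real CARD('n) * Xnorm U (F s - G s)"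
        using elim by (simp add: P_diff [symmetric] Xnorm_P_le bc_space_diff)
      also have "\<dots> \<le> real CARD('n) * k s" using elim by (intro mult_left_mono) auto
      finally show ?case .
    qed
  qed
  from Xnorm_pint_le [OF this] show ?thesis
    unfolding duhamel_def pint_diff [OF c1 c2] by simp
qed

text \<open>The integral equation written with pointwise integrals;
  \<open>mild_solution_iff_mild\<close> relates it to \<open>mild_solution\<close>.\<close>

definition mild :: "(real \<Rightarrow> real ^ 'm \<Rightarrow> real ^ 'n \<Rightarrow> real ^ 'n) \<Rightarrow> (real ^ 'm \<Rightarrow> real ^ 'n) \<Rightarrow> real \<Rightarrow>
    (real \<Rightarrow> real ^ 'm \<Rightarrow> real ^ 'n) \<Rightarrow> bool" where
  "mild g z T u \<longleftrightarrow>
    (\<forall>t\<in>{0..T}. u t \<in> X) \<and> norm_continuous_on U {0..T} u \<and>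
    (\<forall>t\<in>{0..T}. u t = P t z + duhamel t (\<lambda>s. nemytskii U g s (u s)))"

lemma norm_continuous_const: "norm_continuous_on U D (\<lambda>t. z)"
  by (simp add: norm_continuous_on_def)

lemma norm_continuous_bounded:
  assumes u: "\<And>t. t \<in> {a..b} \<Longrightarrow> u t \<in> X" "norm_continuous_on U {a..b} u"
  shows "\<exists>j::nat. 1 \<le> j \<and> (\<forall>t\<in>{a..b}. Xnorm U (u t) \<le> real j)"
proof -
  have "continuous_on {a..b} (\<lambda>t. Xnorm U (u t - 0))"
    by (rule norm_continuous_on_Xnorm [OF u bc_space_zero norm_continuous_const])
  then have "bounded ((\<lambda>t. Xnorm U (u t - 0)) ` {a..b})"
    by (intro compact_imp_bounded compact_continuous_image) simp_all
  then obtain B where "\<forall>y\<in>(\<lambda>t. Xnorm U (u t - 0)) ` {a..b}. norm y \<le> B"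
    unfolding bounded_iff by blast
  then have B: "\<bar>Xnorm U (u t)\<bar> \<le> B" if "t \<in> {a..b}" for t
    using that by simp
  have "B \<le> real (nat \<lceil>B\<rceil> + 1)" by linarith
  then show ?thesis using B by (intro exI [of _ "nat \<lceil>B\<rceil> + 1"]) force
qed

lemma in_Cball: "z \<in> X \<Longrightarrow> Xnorm U z \<le> r \<Longrightarrow> z \<in> Cball U r"
  using bc_space_subset_Cbar by (auto simp: Cball_Xnorm_iff)

lemma bint_nemytskii_trajectory:
  assumes g: "g \<in> SC U" and vanish: "bc = Dirichlet \<Longrightarrow> \<forall>t. \<forall>x\<in>frontier U. g t x 0 = 0"
    and u: "\<And>t. t \<in> {a..b} \<Longrightarrow> u t \<in> X" "norm_continuous_on U {a..b} u"
    and j: "\<And>t. t \<in> {a..b} \<Longrightarrow> Xnorm U (u t) \<le> real j"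
  shows "bint bc a b (\<lambda>s. nemytskii U g s (u s)) (opt_m_bound U g j)"
proof (rule bint_nemytskii [OF g _ u(1) _ vanish])
  show "(\<lambda>s. u s x) \<in> borel_measurable (lebesgue_on {a..b})" for x
    by (rule continuous_on_imp_lebesgue_on_measurable [OF norm_continuous_on_ptw [OF u]])
qed (rule in_Cball [OF u(1) j] u(1); assumption)+

lemma bint_nemytskii_clip:
  assumes g: "g \<in> SC U" and vanish: "bc = Dirichlet \<Longrightarrow> \<forall>t. \<forall>x\<in>frontier U. g t x 0 = 0"
    and u: "\<And>t. t \<in> {a..b} \<Longrightarrow> u t \<in> X" "norm_continuous_on U {a..b} u"
  shows "bint bc a b (\<lambda>s. nemytskii U g s (clip (real j) (u s))) (opt_m_bound U g (CARD('n) * j))"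
proof (rule bint_nemytskii [OF g _ _ _ vanish])
  show "(\<lambda>s. clip (real j) (u s) x) \<in> borel_measurable (lebesgue_on {a..b})" for x
    unfolding clip_def
    by (intro continuous_on_imp_lebesgue_on_measurable continuous_on_vec_lambda continuous_intros
        norm_continuous_on_ptw [OF u])
qed (rule clip_in_Cball [OF u(1)] clip_in_bc_space [OF of_nat_0_le_iff u(1)]; assumption)+

text \<open>The contraction behind the Picard iteration: measured with the weight exp (- \<kappa>
  t), a distance \<open>D\<close> of the curves becomes at most \<open>D / 2\<close>.\<close>

lemma nemytskii_lipschitz_step:
  assumes F: "bint bc 0 t F m" and G: "bint bc 0 t G m'"
    and l: "integrable (lebesgue_on {0..t}) l" "\<And>s. 0 \<le> l s"
    and FG: "AE s in lebesgue_on {0..t}. Xnorm U (F s - G s) \<le> l s * \<phi> s"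
    and \<phi>: "\<And>s. s \<in> {0..t} \<Longrightarrow> \<phi> s \<le> D * exp (\<kappa> * s)" and D: "0 \<le> D"
    and weight: "real CARD('n) * (\<integral>s. l s * exp (\<kappa> * s) \<partial>lebesgue_on {0..t}) \<le> exp (\<kappa> * t) / 2"
  shows "Xnorm U (duhamel t F - duhamel t G) \<le> D / 2 * exp (\<kappa> * t)"
proof -
  have int: "integrable (lebesgue_on {0..t}) (\<lambda>s. l s * (D * exp (\<kappa> * s)))"
    by (intro integrable_mult_continuous [OF l(1)] continuous_intros)
  have "AE s in lebesgue_on {0..t}. s \<in> {0..t}" by (rule AE_I2) simp
  with FG have "AE s in lebesgue_on {0..t}. Xnorm U (F s - G s) \<le> l s * (D * exp (\<kappa> * s))"
  proof eventually_elim
    case (elim s)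
    from mult_left_mono [OF \<phi> [OF elim(2)] l(2) [of s]] elim(1) show ?case by linarith
  qed
  from Xnorm_duhamel_diff_le [OF F G int this]
  have "Xnorm U (duhamel t F - duhamel t G) \<le> real CARD('n) * (\<integral>s. D * (l s * exp (\<kappa> * s)) \<partial>lebesgue_on {0..t})"
    by (simp add: mult_ac)
  also have "\<dots> = D * (real CARD('n) * (\<integral>s. l s * exp (\<kappa> * s) \<partial>lebesgue_on {0..t}))" by simp
  also have "\<dots> \<le> D * (exp (\<kappa> * t) / 2)" by (rule mult_left_mono [OF weight D])
  finally show ?thesis by simp
qed

text \<open>After clipping, the superposition operator is Lipschitz on all of \<open>X\<close> with
  an integrable factor. The fixed point map thus halves weighted distances on the whole of [0, T],
  and the Picard iterates converge there without any restriction on the length.\<close>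

theorem truncated_mild_solution_exists:
  assumes g: "g \<in> LC U" and vanish: "bc = Dirichlet \<Longrightarrow> \<forall>t. \<forall>x\<in>frontier U. g t x 0 = 0"
    and z: "z \<in> X"
  shows "\<exists>u. (\<forall>t\<in>{0..T}. u t \<in> X) \<and> norm_continuous_on U {0..T} u \<and>
    (\<forall>t\<in>{0..T}. u t = P t z + duhamel t (\<lambda>s. nemytskii U g s (clip (real j) (u s))))"
proof -
  have gS: "g \<in> SC U" using g by (simp add: LC_def)
  define F where "F v s = nemytskii U g s (clip (real j) (v s))" for v s
  define \<Phi> where "\<Phi> v t = P t z + duhamel t (F v)" for v t
  define good where "good v \<longleftrightarrow> (\<forall>t\<in>{0..T}. v t \<in> X) \<and> norm_continuous_on U {0..T} v" for v
  obtain l where l [rule_format]: "\<forall>a b. integrable (lebesgue_on {a..b}) l" "\<forall>t. 0 \<le> l t"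
    and lip [THEN spec, THEN spec]: "\<forall>a b. AE s in lebesgue_on {a..b}. \<forall>z\<in>Cball U (real (CARD('n) * j)). \<forall>w\<in>Cball U (real (CARD('n) * j)).
       Xnorm U (nemytskii U g s z - nemytskii U g s w) \<le> l s * Xnorm U (z - w)"
    using LC_lipschitz [OF g, where r = "real (CARD('n) * j)"] by (elim exE conjE) (rule that; assumption)
  obtain \<kappa> where \<kappa>: "0 \<le> \<kappa>" "\<And>t. t \<in> {0..T} \<Longrightarrow>
      real CARD('n) * (\<integral>s. l s * exp (\<kappa> * s) \<partial>lebesgue_on {0..t}) \<le> exp (\<kappa> * t) / 2"
    using exponential_weight [OF l(1) l(2), of "real CARD('n)" T] by auto
  have F_bint: "bint bc 0 T (F v) (opt_m_bound U g (CARD('n) * j))" if "good v" for v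
    unfolding F_def using that unfolding good_def by (intro bint_nemytskii_clip [OF gS vanish]) auto
  have F_bint': "bint bc 0 t (F v) (opt_m_bound U g (CARD('n) * j))" if "good v" "t \<in> {0..T}" for v t
    by (rule bint_subset [OF F_bint [OF that(1)]]) (use that(2) in auto)
  have \<Phi>_good: "good (\<Phi> v)" if v: "good v" for v
    unfolding good_def
  proof (intro conjI ballI)
    show "\<Phi> v t \<in> X" if "t \<in> {0..T}" for t
      unfolding \<Phi>_def using that z by (intro bc_space_add P_in duhamel_in [OF F_bint' [OF v that]]) auto
    show "norm_continuous_on U {0..T} (\<Phi> v)"
      unfolding norm_continuous_on_def
    proof
      fix t assume t: "t \<in> {0..T}"
      have ev: "\<forall>\<^sub>F s in at t within {0..T}. s \<in> {0..T}" by (simp add: eventually_at_filter)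
      have PX: "P s z \<in> X" "duhamel s (F v) \<in> X" if "s \<in> {0..T}" for s
        using that z by (auto intro: P_in duhamel_in [OF F_bint' [OF v that]])
      have "norm_continuous_on U {0..T} (\<lambda>t. P t z)"
        by (rule norm_continuous_on_subset [OF norm_continuous_P [OF z]]) auto
      then have lim: "((\<lambda>s. Xnorm U (P s z - P t z) + Xnorm U (duhamel s (F v) - duhamel t (F v))) \<longlongrightarrow> 0) (at t within {0..T})"
        using norm_continuous_duhamel [OF F_bint [OF v]] t unfolding norm_continuous_on_def
        by (intro tendsto_add_zero) auto
      show "((\<lambda>s. Xnorm U (\<Phi> v s - \<Phi> v t)) \<longlongrightarrow> 0) (at t within {0..T})"
      proof (rule tendsto_sandwich [OF _ _ tendsto_const lim])
        show "\<forall>\<^sub>F s in at t within {0..T}. 0 \<le> Xnorm U (\<Phi> v s - \<Phi> v t)"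
          using ev unfolding \<Phi>_def
          by eventually_elim (intro Xnorm_nonneg [of _ bc] bc_space_diff bc_space_add PX t)
        show "\<forall>\<^sub>F s in at t within {0..T}. Xnorm U (\<Phi> v s - \<Phi> v t)
            \<le> Xnorm U (P s z - P t z) + Xnorm U (duhamel s (F v) - duhamel t (F v))"
          using ev
        proof eventually_elim
          case (elim s)
          have "\<Phi> v s - \<Phi> v t = (P s z - P t z) + (duhamel s (F v) - duhamel t (F v))"
            by (simp add: \<Phi>_def)
          then show ?case
            using Xnorm_triangle [OF bc_space_diff [OF PX(1) [OF elim] PX(1) [OF t]] bc_space_diff [OF PX(2) [OF elim] PX(2) [OF t]]]
            by simp
        qed
      qed
    qed
  qed
  have contr: "Xnorm U (\<Phi> v t - \<Phi> w t) \<le> D / 2 * exp (\<kappa> * t)"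
    if v: "good v" and w: "good w" and D: "0 \<le> D"
      and vw: "\<And>t. t \<in> {0..T} \<Longrightarrow> Xnorm U (v t - w t) \<le> D * exp (\<kappa> * t)" and t: "t \<in> {0..T}" for v w D t
  proof -
    have "Xnorm U (duhamel t (F v) - duhamel t (F w)) \<le> D / 2 * exp (\<kappa> * t)"
    proof (rule nemytskii_lipschitz_step [OF F_bint' [OF v t] F_bint' [OF w t] l(1,2) _ _ D \<kappa>(2) [OF t]])
      show "AE s in lebesgue_on {0..t}. Xnorm U (F v s - F w s) \<le> l s * Xnorm U (v s - w s)"
      proof -
        have "AE s in lebesgue_on {0..t}. s \<in> {0..t}" by (rule AE_I2) simp
        with lip show ?thesis
        proof eventually_elim
          case (elim s)
          then have vs: "v s \<in> X" "w s \<in> X" using v w t by (auto simp: good_def)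
          have "Xnorm U (F v s - F w s) \<le> l s * Xnorm U (clip (real j) (v s) - clip (real j) (w s))"
            unfolding F_def using elim(1) clip_in_Cball [OF vs(1)] clip_in_Cball [OF vs(2)] by blast
          also have "\<dots> \<le> l s * Xnorm U (v s - w s)"
          proof (intro mult_left_mono l(2) Xnorm_le)
            fix x
            have "l1_norm (v s x - w s x) \<le> Xnorm U (v s - w s)"
              using l1_norm_le_Xnorm [OF bc_space_diff [OF vs], of x] by simp
            then show "l1_norm ((clip (real j) (v s) - clip (real j) (w s)) x) \<le> Xnorm U (v s - w s)"
              using l1_norm_clip_diff_le [of "real j" "v s" x "w s"] by simp
          qed
          finally show ?case .
        qed
      qed
      show "Xnorm U (v s - w s) \<le> D * exp (\<kappa> * s)" if "s \<in> {0..t}" for s using vw that t by simp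
    qed
    then show ?thesis by (simp add: \<Phi>_def)
  qed
  define v where "v k = (\<Phi> ^^ k) (\<lambda>t. 0)" for k
  have v_Suc: "v (Suc k) = \<Phi> (v k)" for k by (simp add: v_def)
  have v_good: "good (v k)" for k
  proof (induction k)
    case 0
    show ?case by (simp add: v_def good_def norm_continuous_const bc_space_zero [unfolded zero_fun_def])
  next
    case (Suc k)
    then show ?case unfolding v_Suc by (rule \<Phi>_good)
  qed
  have v_in: "v k t \<in> X" if "t \<in> {0..T}" for k t using v_good that by (simp add: good_def)
  obtain D0 :: nat where D0: "\<And>t. t \<in> {0..T} \<Longrightarrow> Xnorm U (v 1 t) \<le> real D0"
    using norm_continuous_bounded [of 0 T "v 1"] v_good [of 1] unfolding good_def by blast
  have diff: "Xnorm U (v (Suc k) t - v k t) \<le> real D0 / 2 ^ k * exp (\<kappa> * t)" if "t \<in> {0..T}" for k t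
    using that
  proof (induction k arbitrary: t)
    case 0
    have "real D0 * 1 \<le> real D0 * exp (\<kappa> * t)" using \<kappa>(1) 0 by (intro mult_left_mono) auto
    moreover have "v 0 t = 0" by (simp add: v_def)
    ultimately show ?case using D0 [OF 0] by simp
  next
    case (Suc k)
    have "Xnorm U (\<Phi> (v (Suc k)) t - \<Phi> (v k) t) \<le> (real D0 / 2 ^ k) / 2 * exp (\<kappa> * t)"
      by (rule contr [OF v_good v_good _ Suc.IH Suc.prems]) auto
    moreover have "real D0 / 2 ^ Suc k = (real D0 / 2 ^ k) / 2" by simp
    ultimately show ?case unfolding v_Suc by (simp only:)
  qed
  \<comment> \<open>The weight is traded for its maximum exp (\<kappa> T), which gives bounds
    uniform in time.\<close>
  define D where "D = real D0 * exp (\<kappa> * T)"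
  have D_nonneg: "0 \<le> D" by (simp add: D_def)
  have diffD: "Xnorm U (v (Suc k) t - v k t) \<le> D / 2 ^ k" if t: "t \<in> {0..T}" for k t
  proof -
    have "real D0 / 2 ^ k * exp (\<kappa> * t) \<le> real D0 / 2 ^ k * exp (\<kappa> * T)"
      using \<kappa>(1) t by (intro mult_left_mono) (auto intro: mult_left_mono)
    with diff [OF t, of k] show ?thesis by (simp add: D_def)
  qed
  \<comment> \<open>The subtracted term makes the geometric sum telescope in the induction on
    \<open>i\<close>.\<close>
  have tail: "Xnorm U (v (k + i) t - v k t) \<le> 2 * D / 2 ^ k - 2 * D / 2 ^ (k + i)" if t: "t \<in> {0..T}" for k i t
  proof (induction i)
    case (Suc i)
    have "Xnorm U (v (k + Suc i) t - v k t) \<le> Xnorm U (v (Suc (k + i)) t - v (k + i) t) + Xnorm U (v (k + i) t - v k t)"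
      using Xnorm_diff_triangle [OF v_in v_in v_in] t by simp
    also have "\<dots> \<le> D / 2 ^ (k + i) + (2 * D / 2 ^ k - 2 * D / 2 ^ (k + i))"
      by (intro add_mono Suc diffD t)
    also have "\<dots> = 2 * D / 2 ^ k - 2 * D / 2 ^ (k + Suc i)" by (simp add: field_simps)
    finally show ?case .
  qed simp
  have tail': "l1_norm (v (k + i) t x - v k t x) \<le> 2 * D / 2 ^ k" if t: "t \<in> {0..T}" for k i t x
  proof -
    have "l1_norm (v (k + i) t x - v k t x) \<le> Xnorm U (v (k + i) t - v k t)"
      using l1_norm_le_Xnorm [OF bc_space_diff [OF v_in [OF t] v_in [OF t]], of "k + i" k x] by simp
    moreover have "0 \<le> 2 * D / 2 ^ (k + i)" using D_nonneg by simp
    ultimately show ?thesis using tail [OF t, of k i] by linarith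
  qed
  have small: "(\<lambda>k. c / 2 ^ k) \<longlonglongrightarrow> 0" for c :: real
  proof -
    have "(\<lambda>k. c * (1 / 2) ^ k) \<longlonglongrightarrow> c * 0" by (intro tendsto_mult_left LIMSEQ_realpow_zero) auto
    then show ?thesis by (simp add: power_divide)
  qed
  have conv: "convergent (\<lambda>k. v k t x)" if t: "t \<in> {0..T}" for t x
  proof (rule Cauchy_convergent, rule metric_CauchyI)
    fix \<epsilon> :: real assume "0 < \<epsilon>"
    then have "\<forall>\<^sub>F k in sequentially. 4 * D / 2 ^ k < \<epsilon>" by (rule order_tendstoD(2) [OF small])
    then obtain k where k: "4 * D / 2 ^ k < \<epsilon>" by (auto simp: eventually_sequentially)
    have close: "dist (v a t x) (v k t x) \<le> 2 * D / 2 ^ k" if "k \<le> a" for a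
      using tail' [OF t, of k "a - k" x] that norm_le_l1_norm [of "v a t x - v k t x"] by (simp add: dist_norm)
    then have "dist (v a t x) (v b t x) < \<epsilon>" if "k \<le> a" "k \<le> b" for a b
      using k close [OF that(1)] close [OF that(2)] dist_triangle2 [of "v a t x" "v b t x" "v k t x"] by simp
    then show "\<exists>M. \<forall>a\<ge>M. \<forall>b\<ge>M. dist (v a t x) (v b t x) < \<epsilon>" by blast
  qed
  define u where "u t x = lim (\<lambda>k. v k t x)" for t x
  have u_lim: "(\<lambda>k. v k t x) \<longlonglongrightarrow> u t x" if "t \<in> {0..T}" for t x
    unfolding u_def using conv [OF that] by (simp add: convergent_LIMSEQ_iff)
  have u_close: "l1_norm (u t x - v k t x) \<le> 2 * D / 2 ^ k" if t: "t \<in> {0..T}" for t x k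
  proof (rule LIMSEQ_le_const2)
    show "(\<lambda>i. l1_norm (v (i + k) t x - v k t x)) \<longlonglongrightarrow> l1_norm (u t x - v k t x)"
      by (intro tendsto_intros LIMSEQ_ignore_initial_segment u_lim t)
    show "\<exists>N. \<forall>i\<ge>N. l1_norm (v (i + k) t x - v k t x) \<le> 2 * D / 2 ^ k"
      using tail' [OF t, of k] by (simp add: add.commute)
  qed
  have u_in: "u t \<in> X" if t: "t \<in> {0..T}" for t
  proof (rule bc_space_uniform_limit [of "\<lambda>k. v k t"])
    show "uniform_limit UNIV (\<lambda>k. v k t) (u t) sequentially"
    proof (rule uniform_limitI)
      fix \<epsilon> :: real assume "0 < \<epsilon>"
      then have "\<forall>\<^sub>F k in sequentially. 2 * D / 2 ^ k < \<epsilon>" by (rule order_tendstoD(2) [OF small])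
      then show "\<forall>\<^sub>F k in sequentially. \<forall>x\<in>UNIV. dist (v k t x) (u t x) < \<epsilon>"
      proof eventually_elim
        case (elim k)
        show ?case
          using u_close [OF t, of _ k] norm_le_l1_norm elim
          by (auto simp: dist_norm norm_minus_commute intro: order_le_less_trans order_trans)
      qed
    qed
  qed (rule v_in [OF t])
  have u_close': "Xnorm U (u t - v k t) \<le> 2 * D / 2 ^ k" if t: "t \<in> {0..T}" for t k
    using u_close [OF t] by (intro Xnorm_le) simp
  have u_good: "good u"
    unfolding good_def norm_continuous_on_def
  proof (intro conjI ballI u_in)
    fix t assume t: "t \<in> {0..T}"
    show "((\<lambda>s. Xnorm U (u s - u t)) \<longlongrightarrow> 0) (at t within {0..T})"
    proof (rule tendstoI)
      fix \<epsilon> :: real assume \<epsilon>: "0 < \<epsilon>"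
      then have "\<forall>\<^sub>F k in sequentially. 2 * D / 2 ^ k < \<epsilon> / 3" by (intro order_tendstoD(2) [OF small]) simp
      then obtain k where k: "2 * D / 2 ^ k < \<epsilon> / 3" by (auto simp: eventually_sequentially)
      have "((\<lambda>s. Xnorm U (v k s - v k t)) \<longlongrightarrow> 0) (at t within {0..T})"
        using v_good [of k] t by (simp add: good_def norm_continuous_on_def)
      then have "\<forall>\<^sub>F s in at t within {0..T}. Xnorm U (v k s - v k t) < \<epsilon> / 3"
        by (rule order_tendstoD) (use \<epsilon> in simp)
      moreover have "\<forall>\<^sub>F s in at t within {0..T}. s \<in> {0..T}" by (simp add: eventually_at_filter)
      ultimately show "\<forall>\<^sub>F s in at t within {0..T}. dist (Xnorm U (u s - u t)) 0 < \<epsilon>"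
      proof eventually_elim
        case (elim s)
        have "Xnorm U (u s - u t) \<le> Xnorm U (u s - v k s) + (Xnorm U (v k s - v k t) + Xnorm U (v k t - u t))"
          using Xnorm_diff_triangle [OF u_in [OF elim(2)] v_in [OF elim(2), of k] u_in [OF t]]
            Xnorm_diff_triangle [OF v_in [OF elim(2), of k] v_in [OF t, of k] u_in [OF t]] by linarith
        then show ?case
          using u_close' [OF elim(2), of k] u_close' [OF t, of k] elim(1) k
            Xnorm_nonneg [OF bc_space_diff [OF u_in [OF elim(2)] u_in [OF t]]]
          by (simp add: Xnorm_minus_commute [of "v k t"])
      qed
    qed
  qed
  have "u t = \<Phi> u t" if t: "t \<in> {0..T}" for t
  proof -
    have \<Phi>u: "\<Phi> u t \<in> X" using \<Phi>_good [OF u_good] t by (simp add: good_def)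
    \<comment> \<open>The iterate \<open>v (Suc k)\<close> lies close to \<open>u\<close> and is the
      image of \<open>v k\<close>, which by contraction lies close to the image of \<open>u\<close>;
      both errors decay like 1 / 2 ^ k.\<close>
    have le: "Xnorm U (u t - \<Phi> u t) \<le> (D + D * exp (\<kappa> * t)) / 2 ^ k" for k
    proof -
      have 1: "Xnorm U (v k t - u t) \<le> 2 * D / 2 ^ k * exp (\<kappa> * t)" if "t \<in> {0..T}" for t
      proof -
        have "2 * D / 2 ^ k * 1 \<le> 2 * D / 2 ^ k * exp (\<kappa> * t)"
          using \<kappa>(1) that D_nonneg by (intro mult_left_mono) auto
        then show ?thesis using u_close' [OF that, of k] by (simp add: Xnorm_minus_commute)
      qed
      have "Xnorm U (\<Phi> (v k) t - \<Phi> u t) \<le> (2 * D / 2 ^ k) / 2 * exp (\<kappa> * t)"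
        by (rule contr [OF v_good u_good _ 1 t]) (use D_nonneg in auto)
      moreover have "Xnorm U (u t - \<Phi> u t) \<le> Xnorm U (u t - v (Suc k) t) + Xnorm U (\<Phi> (v k) t - \<Phi> u t)"
        using Xnorm_diff_triangle [OF u_in [OF t] v_in [OF t, of "Suc k"] \<Phi>u] by (simp add: v_Suc)
      moreover have "Xnorm U (u t - v (Suc k) t) \<le> D / 2 ^ k" using u_close' [OF t, of "Suc k"] by simp
      ultimately show ?thesis by (simp add: add_divide_distrib)
    qed
    have "Xnorm U (u t - \<Phi> u t) \<le> 0"
      by (rule LIMSEQ_le_const [OF small]) (use le in auto)
    then show ?thesis using Xnorm_eq_0D [OF bc_space_diff [OF u_in [OF t] \<Phi>u]] by simp
  qed
  then show ?thesis
    using u_good unfolding good_def \<Phi>_def F_def by blast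
qed

end

section \<open>Mild solutions, the sets K and the topology\<close>

context bounded_domain
begin

text \<open>A real supremum bounds its members only if the family is bounded: all intervals
  [t, t + s] lie in [q1, q2 + s], where the integrals are uniformly bounded over
  \<open>E\<close>.\<close>

lemma le_theta1:
  fixes E :: "(real \<Rightarrow> real ^ 'm \<Rightarrow> real ^ 'n \<Rightarrow> real ^ 'n) set"
  assumes E: "E \<subseteq> SC U" "L1loc_equicontinuous_m_bounds U E" and j: "1 \<le> j" and g: "g \<in> E"
    and t: "t \<in> {q1..q2}" and s: "0 \<le> s"
  shows "2 * real CARD('n) * integral\<^sup>L (lebesgue_on {t..t + s}) (opt_m_bound U g j) \<le> theta1 U E j q1 q2 s"
proof -
  obtain B where B: "\<And>g. g \<in> E \<Longrightarrow> integral\<^sup>L (lebesgue_on {q1..q2 + s}) (opt_m_bound U g j) \<le> B"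
    using uniformly_bounded_opt_m_bound [OF E j, of q1 "q2 + s"] by blast
  have "bdd_above ((\<lambda>(t, g). LINT r:{t..t + s}|lebesgue. opt_m_bound U g j r) ` ({q1..q2} \<times> E))"
  proof (rule bdd_aboveI2)
    fix p assume "p \<in> {q1..q2} \<times> E"
    then obtain t g where p: "p = (t, g)" "t \<in> {q1..q2}" "g \<in> E" by auto
    have "integral\<^sup>L (lebesgue_on {t..t + s}) (opt_m_bound U g j) \<le> integral\<^sup>L (lebesgue_on {q1..q2 + s}) (opt_m_bound U g j)"
      using p(2,3) E(1) by (intro integral_lebesgue_on_mono_set opt_m_bound_integrable opt_m_bound_AE_nonneg) auto
    then show "(case p of (t, g) \<Rightarrow> LINT r:{t..t + s}|lebesgue. opt_m_bound U g j r) \<le> B"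
      using B [OF p(3)] by (simp add: p(1) LINT_lebesgue_on)
  qed
  from cSUP_upper [OF _ this, of "(t, g)"] t g
  have "integral\<^sup>L (lebesgue_on {t..t + s}) (opt_m_bound U g j)
      \<le> (SUP (t, g)\<in>{q1..q2} \<times> E. LINT r:{t..t + s}|lebesgue. opt_m_bound U g j r)"
    by (simp add: LINT_lebesgue_on)
  then show ?thesis unfolding theta1_def by (intro mult_left_mono) auto
qed

lemma le_SUP_opt_m_bound:
  fixes E :: "(real \<Rightarrow> real ^ 'm \<Rightarrow> real ^ 'n \<Rightarrow> real ^ 'n) set"
  assumes E: "E \<subseteq> SC U" "L1loc_equicontinuous_m_bounds U E" and j: "1 \<le> j" and g: "g \<in> E"
    and sub: "{a..b} \<subseteq> {q1..q2}"
  shows "integral\<^sup>L (lebesgue_on {a..b}) (opt_m_bound U g j)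
    \<le> (SUP g\<in>E. LINT r:{q1..q2}|lebesgue. opt_m_bound U g j r)"
proof -
  obtain B where B: "\<And>g. g \<in> E \<Longrightarrow> integral\<^sup>L (lebesgue_on {q1..q2}) (opt_m_bound U g j) \<le> B"
    using uniformly_bounded_opt_m_bound [OF E j, of q1 q2] by blast
  have "integral\<^sup>L (lebesgue_on {a..b}) (opt_m_bound U g j) \<le> integral\<^sup>L (lebesgue_on {q1..q2}) (opt_m_bound U g j)"
    using g E(1) sub by (intro integral_lebesgue_on_mono_set opt_m_bound_integrable opt_m_bound_AE_nonneg) auto
  also have "\<dots> \<le> (SUP g\<in>E. LINT r:{q1..q2}|lebesgue. opt_m_bound U g j r)"
    unfolding LINT_lebesgue_on by (rule cSUP_upper [OF g]) (use B in \<open>auto intro!: bdd_aboveI2\<close>)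
  finally show ?thesis .
qed

lemma opt_m_bound_integral_nonneg:
  fixes g :: "real \<Rightarrow> real ^ 'm \<Rightarrow> real ^ 'n \<Rightarrow> real ^ 'n"
  shows "g \<in> SC U \<Longrightarrow> 0 \<le> integral\<^sup>L (lebesgue_on {a..b}) (opt_m_bound U g j)"
  by (intro Bochner_Integration.integral_nonneg_AE opt_m_bound_AE_nonneg)

text \<open>The bound \<open>C\<close> shows that the supremum defining the operator norm is taken
  over a bounded set.\<close>

lemma
  fixes T :: "(real ^ 'm \<Rightarrow> real ^ 'n) \<Rightarrow> real ^ 'm \<Rightarrow> real ^ 'n"
  assumes T: "bdd_linear bc C T" and C: "0 \<le> C"
  shows X_opnorm_le: "X_opnorm U bc T \<le> C"
    and Xnorm_le_X_opnorm: "z \<in> bc_space U bc \<Longrightarrow> Xnorm U (T z) \<le> X_opnorm U bc T * Xnorm U z"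
    and X_opnorm_nonneg: "0 \<le> X_opnorm U bc T"
proof -
  let ?B = "{z \<in> bc_space U bc. Xnorm U z \<le> 1} :: (real ^ 'm \<Rightarrow> real ^ 'n) set"
  have le: "Xnorm U (T z) \<le> C" if "z \<in> ?B" for z
  proof -
    have "Xnorm U (T z) \<le> C * Xnorm U z" using that by (intro Xnorm_bdd_linear_le [OF T]) auto
    also have "\<dots> \<le> C * 1" using that C by (intro mult_left_mono) auto
    finally show ?thesis by simp
  qed
  have zero: "0 \<in> ?B" by simp
  have upper: "Xnorm U (T z) \<le> X_opnorm U bc T" if "z \<in> ?B" for z
    unfolding X_opnorm_def by (rule cSUP_upper [OF that]) (use le in \<open>auto intro!: bdd_aboveI2\<close>)
  show "X_opnorm U bc T \<le> C"
    unfolding X_opnorm_def by (rule cSUP_least) (use zero le in blast)+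
  show "0 \<le> X_opnorm U bc T"
    using upper [OF zero] Xnorm_nonneg [OF bdd_linear_in [OF T bc_space_zero]] by linarith
  show "Xnorm U (T z) \<le> X_opnorm U bc T * Xnorm U z" if z: "z \<in> bc_space U bc"
  proof (cases "Xnorm U z = 0")
    case True
    then have "Xnorm U (T z) \<le> C * 0" using Xnorm_bdd_linear_le [OF T z] by simp
    then show ?thesis using True by simp
  next
    case False
    then have pos: "0 < Xnorm U z" using Xnorm_nonneg [OF z] by simp
    let ?w = "\<lambda>x. (1 / Xnorm U z) *\<^sub>R z x"
    have "Xnorm U (T ?w) \<le> X_opnorm U bc T"
      using pos by (intro upper) (auto simp: Xnorm_scaleR [OF z] intro!: bc_space_scaleR [OF z])
    moreover have "T ?w = (\<lambda>x. (1 / Xnorm U z) *\<^sub>R T z x)"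
      using T z unfolding bdd_linear_def by blast
    ultimately show ?thesis
      using pos by (simp add: Xnorm_scaleR [OF bdd_linear_in [OF T z], simplified] field_simps)
  qed
qed

text \<open>The m-bound on the ball of radius \<open>j\<close> makes the supremum in the seminorm
  finite. Members of \<open>K_set\<close> are merely continuous on the closure, hence the use of
  \<open>Neumann\<close>.\<close>

lemma pint_nemytskii_le_seminorm_K:
  fixes g :: "real \<Rightarrow> real ^ 'm \<Rightarrow> real ^ 'n \<Rightarrow> real ^ 'n"
  assumes g: "g \<in> SC U" and v: "v \<in> K_set U bc S \<Theta>1 \<Theta>2 R j q1 q2"
  shows "Xnorm U (pint q1 q2 (\<lambda>s. nemytskii U g s (v s)))
    \<le> seminorm_K U (K_set U bc S \<Theta>1 \<Theta>2 R j q1 q2) q1 q2 g"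
proof -
  let ?K = "K_set U bc S \<Theta>1 \<Theta>2 R j q1 q2"
  have bint: "bint Neumann q1 q2 (\<lambda>s. nemytskii U g s (w s)) (opt_m_bound U g j)" if "w \<in> ?K" for w
  proof (rule bint_nemytskii [OF g])
    have w: "\<And>s. s \<in> {q1..q2} \<Longrightarrow> w s \<in> Cball U (real j)" "norm_continuous_on U {q1..q2} w"
      using that by (auto simp: K_set_def)
    show "w s \<in> Cball U (real j)" "w s \<in> bc_space U Neumann" if "s \<in> {q1..q2}" for s
      using w(1) [OF that] by (auto simp: bc_space_Neumann Cball_Xnorm_iff)
    then show "(\<lambda>s. w s x) \<in> borel_measurable (lebesgue_on {q1..q2})" for x
      by (intro continuous_on_imp_lebesgue_on_measurable norm_continuous_on_ptw [OF _ w(2)])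
  qed simp
  have "Xnorm U (bochner_integral_Cbar U (lebesgue_on {q1..q2}) (\<lambda>s. nemytskii U g s (v s)))
      \<le> seminorm_K U ?K q1 q2 g"
    unfolding seminorm_K_def
  proof (rule cSUP_upper [OF v], rule bdd_aboveI2)
    fix w assume "w \<in> ?K"
    from Xnorm_pint_le [OF bint [OF this]] bochner_integral_eq_pint [OF bint [OF this]]
    show "Xnorm U (bochner_integral_Cbar U (lebesgue_on {q1..q2}) (\<lambda>s. nemytskii U g s (w s)))
        \<le> integral\<^sup>L (lebesgue_on {q1..q2}) (opt_m_bound U g j)" by simp
  qed
  then show ?thesis using bochner_integral_eq_pint [OF bint [OF v]] by simp
qed

text \<open>All integrands vanish; nonemptiness matters because the supremum of the empty set of
  reals is unspecified.\<close>

lemma seminorm_K_zero: "K \<noteq> {} \<Longrightarrow> seminorm_K U K q1 q2 (g - g) = 0"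
  for g :: "real \<Rightarrow> real ^ 'm \<Rightarrow> real ^ 'n \<Rightarrow> real ^ 'n"
proof -
  assume K: "K \<noteq> {}"
  have nem: "nemytskii U (g - g) s z = 0" for s z
    unfolding nemytskii_diff by simp
  have "bint Neumann q1 q2 (\<lambda>s. 0 :: real ^ 'm \<Rightarrow> real ^ 'n) (\<lambda>s. 0)"
    by (simp add: bint_def)
  from bochner_integral_eq_pint [OF this]
  have "bochner_integral_Cbar U (lebesgue_on {q1..q2}) (\<lambda>s. 0 :: real ^ 'm \<Rightarrow> real ^ 'n) = 0"
    by (simp add: pint_def zero_fun_def)
  then show ?thesis unfolding seminorm_K_def nem using K by simp
qed

text \<open>The basic set of radius \<epsilon> around \<open>f\<close> is open and contains
  \<open>f\<close>, so it eventually contains \<open>fs n\<close>. If there are no curves in the set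
  K, the value of the seminorm says nothing, but then the estimate is vacuous and only the
  membership of \<open>fs n\<close> remains.\<close>

lemma sigma_limitD:
  fixes fs :: "nat \<Rightarrow> real \<Rightarrow> real ^ 'm \<Rightarrow> real ^ 'n::finite \<Rightarrow> real ^ 'n"
  assumes lim: "limitin (subtopology (sigma_topology U bc S \<Theta>1 \<Theta>2 R) (LC U)) fs f sequentially"
  shows "f \<in> LC U"
    and "1 \<le> j \<Longrightarrow> q1 \<in> \<rat> \<Longrightarrow> q2 \<in> \<rat> \<Longrightarrow> q1 < q2 \<Longrightarrow> 0 < \<epsilon> \<Longrightarrow>
      \<forall>\<^sub>F n in sequentially. fs n \<in> SC U \<and> (\<forall>v\<in>K_set U bc S \<Theta>1 \<Theta>2 R j q1 q2.
        Xnorm U (pint q1 q2 (\<lambda>s. nemytskii U (fs n - f) s (v s))) < \<epsilon>)"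
proof -
  show fLC: "f \<in> LC U" using lim by (simp add: limitin_def)
  then have fSC: "f \<in> SC U" by (simp add: LC_def)
  assume j: "1 \<le> j" and q: "q1 \<in> \<rat>" "q2 \<in> \<rat>" "q1 < q2" and \<epsilon>: "0 < \<epsilon>"
  let ?K = "K_set U bc S \<Theta>1 \<Theta>2 R j q1 q2"
  have ev_LC: "\<forall>\<^sub>F n in sequentially. fs n \<in> LC U"
  proof -
    have "\<forall>\<^sub>F n in sequentially. fs n \<in> topspace (subtopology (sigma_topology U bc S \<Theta>1 \<Theta>2 R) (LC U))"
      using lim unfolding limitin_def by blast
    then show ?thesis by eventually_elim simp
  qed
  show "\<forall>\<^sub>F n in sequentially. fs n \<in> SC U \<and> (\<forall>v\<in>?K.
        Xnorm U (pint q1 q2 (\<lambda>s. nemytskii U (fs n - f) s (v s))) < \<epsilon>)"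
  proof (cases "?K = {}")
    case True
    from ev_LC show ?thesis by eventually_elim (simp add: True LC_def)
  next
    case False
    let ?O = "{g \<in> SC U. seminorm_K U ?K q1 q2 (g - f) < \<epsilon>}"
    have "openin (sigma_topology U bc S \<Theta>1 \<Theta>2 R) ?O"
      unfolding sigma_topology_def
      by (rule topology_generated_by_Basis) (use j q \<epsilon> fSC in blast)
    then have "openin (subtopology (sigma_topology U bc S \<Theta>1 \<Theta>2 R) (LC U)) (?O \<inter> LC U)"
      by (auto simp: openin_subtopology)
    moreover have "f \<in> ?O \<inter> LC U"
      using fLC fSC \<epsilon> seminorm_K_zero [OF False, of q1 q2 f] by simp
    ultimately have "\<forall>\<^sub>F n in sequentially. fs n \<in> ?O \<inter> LC U"
      using lim unfolding limitin_def by blast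
    then show ?thesis
    proof eventually_elim
      case (elim n)
      then have n: "fs n \<in> SC U" "seminorm_K U ?K q1 q2 (fs n - f) < \<epsilon>" by auto
      have "Xnorm U (pint q1 q2 (\<lambda>s. nemytskii U (fs n - f) s (v s))) < \<epsilon>" if "v \<in> ?K" for v
        using pint_nemytskii_le_seminorm_K [OF SC_diff [OF n(1) fSC] that] n(2) by (rule le_less_trans)
      then show ?case using n(1) by blast
    qed
  qed
qed

end

section \<open>Solutions for maps in \<open>E\<close> belong to the sets K\<close>

context heat_flow
begin

lemma bdd_linear_P_diff:
  assumes "0 \<le> t" "0 \<le> r"
  shows "bdd_linear bc (2 * real CARD('n)) (\<lambda>z. P t z - P (t + r) z)"
  unfolding bdd_linear_def
proof (intro conjI ballI allI)
  fix z assume z: "z \<in> X"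
  have in': "P t z \<in> X" "P (t + r) z \<in> X" using assms z by (auto intro: P_in)
  show "P t z - P (t + r) z \<in> X" by (rule bc_space_diff [OF in'])
  show "Xnorm U (P t z - P (t + r) z) \<le> 2 * real CARD('n) * Xnorm U z"
    using Xnorm_diff_le [OF in'] Xnorm_P_le [OF _ z, of t] Xnorm_P_le [OF _ z, of "t + r"] assms by simp
  fix c :: real
  have "P t (\<lambda>x. c *\<^sub>R z x) = (\<lambda>x. c *\<^sub>R P t z x)" "P (t + r) (\<lambda>x. c *\<^sub>R z x) = (\<lambda>x. c *\<^sub>R P (t + r) z x)"
    using P_linear [of t] P_linear [of "t + r"] assms z unfolding bdd_linear_def by auto
  then show "P t (\<lambda>x. c *\<^sub>R z x) - P (t + r) (\<lambda>x. c *\<^sub>R z x) = (\<lambda>x. c *\<^sub>R (P t z - P (t + r) z) x)"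
    by (auto simp: fun_eq_iff scaleR_diff_right)
next
  fix z w assume "z \<in> X" "w \<in> X"
  then show "P t (z + w) - P (t + r) (z + w) = P t z - P (t + r) z + (P t w - P (t + r) w)"
    using assms by (simp add: P_plus)
qed

text \<open>Two operators of norm at most N differ by at most 2 N in norm, which keeps the supremum
  over the rectangle of times bounded.\<close>

lemma
  assumes PS: "P = product_semigroup S" and \<nu>: "1 \<le> \<nu>" and q: "q1 + 1 / real \<nu> < q2" and s: "0 \<le> s"
  shows theta_sg_nonneg: "0 \<le> theta_sg U bc S q1 q2 \<nu> s"
    and le_theta_sg: "1 / real \<nu> \<le> t \<Longrightarrow> t \<le> q2 - q1 \<Longrightarrow> r \<in> {0..s} \<Longrightarrow> z \<in> X \<Longrightarrow>
      Xnorm U (P t z - P (t + r) z) \<le> theta_sg U bc S q1 q2 \<nu> s * Xnorm U z"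
proof -
  let ?op = "\<lambda>(t, r). X_opnorm U bc (\<lambda>z. P t z - P (t + r) z)"
  let ?A = "{1 / real \<nu>..q2 - q1} \<times> {0..s}"
  have sg: "theta_sg U bc S q1 q2 \<nu> s = (SUP p\<in>?A. ?op p)"
    by (simp add: theta_sg_def PS)
  have pos: "0 \<le> t" if "1 / real \<nu> \<le> t" for t using that \<nu> by (meson divide_nonneg_nonneg of_nat_0_le_iff order_trans zero_le_one)
  have "bdd_above (?op ` ?A)"
  proof (rule bdd_aboveI2)
    fix p assume "p \<in> ?A"
    then show "?op p \<le> 2 * real CARD('n)"
      using X_opnorm_le [OF bdd_linear_P_diff] pos by auto
  qed
  then have upper: "X_opnorm U bc (\<lambda>z. P t z - P (t + r) z) \<le> theta_sg U bc S q1 q2 \<nu> s"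
    if "1 / real \<nu> \<le> t" "t \<le> q2 - q1" "r \<in> {0..s}" for t r
    unfolding sg using cSUP_upper [of "(t, r)" ?A ?op] that by simp
  have lin: "bdd_linear bc (2 * real CARD('n)) (\<lambda>z. P t z - P (t + r) z)"
    if "1 / real \<nu> \<le> t" "r \<in> {0..s}" for t r
    using that pos by (intro bdd_linear_P_diff) auto
  show "0 \<le> theta_sg U bc S q1 q2 \<nu> s"
    using X_opnorm_nonneg [OF lin, of "1 / real \<nu>" 0] upper [of "1 / real \<nu>" 0] s q by simp
  show "Xnorm U (P t z - P (t + r) z) \<le> theta_sg U bc S q1 q2 \<nu> s * Xnorm U z"
    if "1 / real \<nu> \<le> t" "t \<le> q2 - q1" "r \<in> {0..s}" "z \<in> X"
    using Xnorm_le_X_opnorm [OF lin [OF that(1,3)] _ that(4)]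
      mult_right_mono [OF upper [OF that(1-3)] Xnorm_nonneg [OF that(4)]] by simp
qed

text \<open>The solution restarted at \<open>r\<close>. The moduli belonging to a subinterval see
  only what happens from its left end on, so the estimates have to start there and not at 0.\<close>

lemma mild_flow:
  assumes u: "mild g z T u" and F: "bint bc 0 T (\<lambda>s. nemytskii U g s (u s)) m" and z: "z \<in> X"
    and r: "0 \<le> r" "r \<le> t" "t \<le> T"
  shows "u t = P (t - r) (u r) + pint r t (\<lambda>s. P (t - s) (nemytskii U g s (u s)))"
proof -
  let ?F = "\<lambda>s. nemytskii U g s (u s)"
  have Ft: "bint bc 0 t ?F m" and Fr: "bint bc 0 r ?F m" by (rule bint_subset [OF F]; use r in auto)+
  have ut: "u t = P t z + duhamel t ?F" and ur: "u r = P r z + duhamel r ?F"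
    using u r by (auto simp: mild_def)
  have "P (t - r) (u r) = P (t - r) (P r z) + P (t - r) (duhamel r ?F)"
    unfolding ur using r z by (intro P_plus P_in duhamel_in [OF Fr]) auto
  moreover have "P (t - r) (P r z) = P t z" using P_add [of "t - r" r z] r z by simp
  ultimately show ?thesis
    unfolding ut duhamel_flow [OF Ft r(1,2)] by (simp only: add.assoc)
qed

text \<open>The solution restarted at \<open>r1\<close> is cut at \<open>t1 - 1 / \<nu>\<close>.
  Before the cut the semigroup acts for a time of at least 1 / \<nu>, and its norm continuity yields
  the terms with \<open>theta_sg\<close>. After it, two integrals over an interval of length 1 /
  \<nu> remain, each costing N times the integral of the m-bound: hence the factor 2 N in
  \<open>theta1\<close>. For the distance condition, \<open>u t\<close> is compared with
  \<open>P (1 / \<nu>)\<close> applied to \<open>u (t - 1 / \<nu>)\<close>.\<close>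

lemma mild_in_K_set:
  assumes PS: "P = product_semigroup S"
    and E: "E \<subseteq> SC U" "L1loc_equicontinuous_m_bounds U E" and g: "g \<in> E"
    and vanish: "bc = Dirichlet \<Longrightarrow> \<forall>t. \<forall>x\<in>frontier U. g t x 0 = 0"
    and u: "mild g z T u" and z: "z \<in> X" and j: "1 \<le> j" and uj: "\<And>t. t \<in> {0..T} \<Longrightarrow> Xnorm U (u t) \<le> real j"
    and q: "0 \<le> q1" "q2 \<le> T"
  shows "u \<in> K_set U bc S (theta1 U E) (theta2 U bc S E) (radius U E) j q1 q2"
proof -
  let ?F = "\<lambda>s. nemytskii U g s (u s)" and ?N = "real CARD('n)" and ?m = "opt_m_bound U g j"
  have gS: "g \<in> SC U" using E(1) g by blast
  have uX: "\<And>t. t \<in> {0..T} \<Longrightarrow> u t \<in> X" and uc: "norm_continuous_on U {0..T} u"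
    using u by (auto simp: mild_def)
  have F: "bint bc 0 T ?F ?m"
    by (rule bint_nemytskii_trajectory [OF gS vanish uX uc uj]) auto
  have sub: "{q1..q2} \<subseteq> {0..T}" using q by auto
  note flow = mild_flow [OF u F z]
  have m0: "0 \<le> integral\<^sup>L (lebesgue_on {a..b}) ?m" for a b by (rule opt_m_bound_integral_nonneg [OF gS])
  have conv: "bint bc a b (\<lambda>s. P (t - s) (?F s)) (\<lambda>s. ?N * ?m s)" if "0 \<le> a" "b \<le> t" "t \<le> T" for a b t
    by (rule bint_convolution [OF bint_subset [OF F]]) (use that in auto)
  have pint_le: "Xnorm U (pint a b (\<lambda>s. P (t - s) (?F s))) \<le> ?N * integral\<^sup>L (lebesgue_on {a..b}) ?m"
    if "0 \<le> a" "b \<le> t" "t \<le> T" for a b t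
    using Xnorm_pint_le [OF conv [OF that]] by simp
  have pint_X: "pint a b (\<lambda>s. P (t - s) (?F s)) \<in> X" if "0 \<le> a" "b \<le> t" "t \<le> T" for a b t
    by (rule pint_in_bc_space [OF conv [OF that]])
  {
    fix r1 r2 :: real and \<nu> :: nat
    assume r: "{r1..r2} \<subseteq> {q1..q2}" and \<nu>: "1 \<le> \<nu>" and lt: "r1 + 1 / real \<nu> < r2"
    define d where "d = 1 / real \<nu>"
    have d: "0 < d" using \<nu> by (simp add: d_def)
    have "r1 < r2" using lt d unfolding d_def by linarith
    moreover from this r have "q1 \<le> r1" "r2 \<le> q2" by auto
    ultimately have r12: "0 \<le> r1" "r1 < r2" "r2 \<le> T" using q by auto
    let ?\<theta>1 = "theta1 U E j r1 r2" and ?sg = "theta_sg U bc S r1 r2 \<nu>"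
    have osc: "Xnorm U (u t1 - u t2) \<le> theta2 U bc S E j r1 r2 \<nu> (t2 - t1) + ?\<theta>1 d"
      if t: "r1 + d \<le> t1" "t1 \<le> t2" "t2 \<le> r2" for t1 t2
    proof -
      define a where "a = t1 - d"
      define h where "h = t2 - t1"
      have ah: "r1 \<le> a" "a < t1" "0 \<le> h" "t1 = a + d" "t2 = t1 + h" using t d by (auto simp: a_def h_def)
      have bnds: "0 \<le> a" "t1 \<le> T" "t2 \<le> T" "0 \<le> r1" "r1 \<le> t1" "0 \<le> t1" using r12 t ah by auto
      have sg0: "0 \<le> ?sg h" by (rule theta_sg_nonneg [OF PS \<nu> lt ah(3)])
      have ur: "u r1 \<in> X" using uX r12 by auto
      have sgP: "Xnorm U (P \<tau> w - P (\<tau> + h) w) \<le> ?sg h * Xnorm U w" if "d \<le> \<tau>" "\<tau> \<le> r2 - r1" "w \<in> X" for \<tau> w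
        using le_theta_sg [OF PS \<nu> lt ah(3), of \<tau> h w] that ah(3) by (simp add: d_def)
      let ?I = "\<lambda>a b t. pint a b (\<lambda>s. P (t - s) (?F s))"
      have u1: "u t1 = P (t1 - r1) (u r1) + (?I r1 a t1 + ?I a t1 t1)"
        using flow [of r1 t1] pint_combine [OF conv [of r1 t1 t1], of a] bnds ah by auto
      have u2: "u t2 = P (t2 - r1) (u r1) + (?I r1 a t2 + (?I a t1 t2 + ?I t1 t2 t2))"
        using flow [of r1 t2] pint_combine [OF conv [of r1 t2 t2], of a] pint_combine [OF conv [of a t2 t2], of t1] bnds ah t
        by auto
      have in': "P (t1 - r1) (u r1) \<in> X" "P (t2 - r1) (u r1) \<in> X" "?I r1 a t1 \<in> X" "?I r1 a t2 \<in> X"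
        "?I a t1 t1 \<in> X" "?I a t1 t2 \<in> X" "?I t1 t2 t2 \<in> X"
        using bnds ah t ur by (auto intro!: pint_X P_in)
      \<comment> \<open>Four contributions: the value at \<open>r1\<close>, the integrals up to the
        cut, the two integrals from the cut to \<open>t1\<close>, and the piece from
        \<open>t1\<close> to \<open>t2\<close>. The third is absorbed by
        \<open>?\<theta>1 d\<close>, the others by the three summands of
        \<open>theta2\<close>.\<close>
      have "u t1 - u t2 = (P (t1 - r1) (u r1) - P (t2 - r1) (u r1)) + ((?I r1 a t1 - ?I r1 a t2)
          + ((?I a t1 t1 - ?I a t1 t2) - ?I t1 t2 t2))"
        unfolding u1 u2 by (simp add: algebra_simps)
      then have "Xnorm U (u t1 - u t2) \<le> Xnorm U (P (t1 - r1) (u r1) - P (t2 - r1) (u r1))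
          + (Xnorm U (?I r1 a t1 - ?I r1 a t2) + ((Xnorm U (?I a t1 t1) + Xnorm U (?I a t1 t2)) + Xnorm U (?I t1 t2 t2)))"
        using in' by (auto intro!: order_trans [OF Xnorm_triangle] order_trans [OF Xnorm_diff_le] add_mono Xnorm_triangle Xnorm_diff_le
            bc_space_diff bc_space_add intro: order_refl)
      moreover have "Xnorm U (P (t1 - r1) (u r1) - P (t2 - r1) (u r1)) \<le> ?sg h * real j"
      proof -
        have "Xnorm U (P (t1 - r1) (u r1) - P (t1 - r1 + h) (u r1)) \<le> ?sg h * Xnorm U (u r1)"
          using t ur ah by (intro sgP) auto
        also have "\<dots> \<le> ?sg h * real j" using r12 by (intro mult_left_mono sg0 uj) auto
        finally show ?thesis by (simp add: h_def)
      qed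
      moreover have "Xnorm U (?I r1 a t1 - ?I r1 a t2) \<le> ?sg h * (SUP g\<in>E. LINT r:{r1..r2}|lebesgue. opt_m_bound U g j r)"
      proof -
        have c: "bint bc r1 a (\<lambda>s. P (t1 - s) (?F s)) (\<lambda>s. ?N * ?m s)" "bint bc r1 a (\<lambda>s. P (t2 - s) (?F s)) (\<lambda>s. ?N * ?m s)"
          using bnds ah t by (auto intro!: conv)
        have "bint bc r1 a (\<lambda>s. P (t1 - s) (?F s) - P (t2 - s) (?F s)) (\<lambda>s. ?sg h * ?m s)"
        proof (rule bint_mono [OF bint_diff [OF c]])
          show "integrable (lebesgue_on {r1..a}) (\<lambda>s. ?sg h * ?m s)"
            using opt_m_bound_integrable [OF gS] by simp
          have Fra: "bint bc r1 a ?F ?m" by (rule bint_subset [OF F]) (use bnds ah in auto)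
          have "AE s in lebesgue_on {r1..a}. s \<in> {r1..a}" by (rule AE_I2) simp
          with bint_AE [OF Fra]
          show "AE s in lebesgue_on {r1..a}. Xnorm U (P (t1 - s) (?F s) - P (t2 - s) (?F s)) \<le> ?sg h * ?m s"
          proof eventually_elim
            case (elim s)
            have "Xnorm U (P (t1 - s) (?F s) - P (t1 - s + h) (?F s)) \<le> ?sg h * Xnorm U (?F s)"
              using elim t ah by (intro sgP) auto
            also have "\<dots> \<le> ?sg h * ?m s" using elim by (intro mult_left_mono sg0) auto
            finally show ?case by (simp add: h_def)
          qed
        qed
        from Xnorm_pint_le [OF this]
        have "Xnorm U (?I r1 a t1 - ?I r1 a t2) \<le> ?sg h * integral\<^sup>L (lebesgue_on {r1..a}) ?m"
          unfolding pint_diff [OF c] by simp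
        also have "\<dots> \<le> ?sg h * (SUP g\<in>E. LINT r:{r1..r2}|lebesgue. opt_m_bound U g j r)"
          using ah t by (intro mult_left_mono sg0 le_SUP_opt_m_bound [OF E j g]) auto
        finally show ?thesis .
      qed
      moreover have "Xnorm U (?I a t1 t1) + Xnorm U (?I a t1 t2) \<le> ?\<theta>1 d"
        using pint_le [of a t1 t1] pint_le [of a t1 t2] le_theta1 [OF E j g, of a r1 r2 d] bnds ah t d by auto
      moreover have "Xnorm U (?I t1 t2 t2) \<le> ?\<theta>1 h"
      proof -
        have "2 * ?N * integral\<^sup>L (lebesgue_on {t1..t2}) ?m \<le> ?\<theta>1 h"
          using le_theta1 [OF E j g, of t1 r1 r2 h] ah t r12 by auto
        moreover have "0 \<le> ?N * integral\<^sup>L (lebesgue_on {t1..t2}) ?m" using m0 by simp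
        ultimately show ?thesis using pint_le [of t1 t2 t2] bnds t by simp
      qed
      ultimately show ?thesis unfolding theta2_def h_def [symmetric] by (simp add: mult.commute)
    qed
    have dist: "Xdist U (u t) (product_semigroup S d ` (Cball U (radius U E j r1 r2) \<inter> X)) \<le> ?\<theta>1 d"
      if t: "r1 + d \<le> t" "t \<le> r2" for t
    proof -
      define a where "a = t - d"
      have a: "r1 \<le> a" "a \<le> r2" "a \<in> {0..T}" "t = a + d" "a \<le> t" "t \<le> T" using t r12 d by (auto simp: a_def)
      \<comment> \<open>As N is at least 1 and the second summand of \<open>radius\<close> is
        nonnegative, a value of norm at most \<open>j\<close> fits into the ball.\<close>
      have ua: "u a \<in> Cball U (radius U E j r1 r2) \<inter> X"
      proof -
        have "real j \<le> ?N * real j" by (simp add: mult_le_cancel_right1)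
        moreover have "0 \<le> ?N * (SUP g\<in>E. LINT r:{r1..r2}|lebesgue. opt_m_bound U g j r)"
          using m0 [of r1 r2] le_SUP_opt_m_bound [OF E j g, of r1 r2 r1 r2] by simp
        ultimately have "Xnorm U (u a) \<le> radius U E j r1 r2" using uj [OF a(3)] unfolding radius_def by linarith
        then show ?thesis using uX [OF a(3)] by (simp add: in_Cball)
      qed
      have bdd: "bdd_below ((\<lambda>w. Xnorm U (u t - w)) ` (P d ` (Cball U (radius U E j r1 r2) \<inter> X)))"
        using uX d a by (intro bdd_belowI [of _ 0]) (auto intro!: Xnorm_nonneg [of _ bc] bc_space_diff P_in)
      have "Xdist U (u t) (P d ` (Cball U (radius U E j r1 r2) \<inter> X)) \<le> Xnorm U (u t - P d (u a))"
        unfolding Xdist_def by (rule cINF_lower [OF bdd]) (use ua in blast)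
      also have "u t - P d (u a) = pint a t (\<lambda>s. P (t - s) (?F s))"
        using flow [of a t] a by simp
      also have "Xnorm U \<dots> \<le> ?N * integral\<^sup>L (lebesgue_on {a..t}) ?m"
        using a by (intro pint_le) auto
      also have "\<dots> \<le> ?\<theta>1 d"
      proof -
        have "0 \<le> ?N * integral\<^sup>L (lebesgue_on {a..t}) ?m" using m0 by simp
        moreover have "2 * ?N * integral\<^sup>L (lebesgue_on {a..t}) ?m \<le> ?\<theta>1 d"
          using le_theta1 [OF E j g, of a r1 r2 d] a d by simp
        ultimately show ?thesis by linarith
      qed
      finally show ?thesis by (simp add: PS)
    qed
    have "\<forall>t1\<in>{r1 + d..r2}. \<forall>t2\<in>{r1 + d..r2}.
        Xnorm U (u t1 - u t2) \<le> theta2 U bc S E j r1 r2 \<nu> \<bar>t1 - t2\<bar> + ?\<theta>1 d"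
    proof (intro ballI)
      fix t1 t2 assume "t1 \<in> {r1 + d..r2}" "t2 \<in> {r1 + d..r2}"
      then show "Xnorm U (u t1 - u t2) \<le> theta2 U bc S E j r1 r2 \<nu> \<bar>t1 - t2\<bar> + ?\<theta>1 d"
        using osc [of t1 t2] osc [of t2 t1] Xnorm_minus_commute [of "u t1" "u t2"]
        by (cases "t1 \<le> t2") auto
    qed
    with dist have "(\<forall>t1\<in>{r1 + 1 / real \<nu>..r2}. \<forall>t2\<in>{r1 + 1 / real \<nu>..r2}.
        Xnorm U (u t1 - u t2) \<le> theta2 U bc S E j r1 r2 \<nu> \<bar>t1 - t2\<bar> + theta1 U E j r1 r2 (1 / real \<nu>)) \<and>
      (\<forall>t\<in>{r1 + 1 / real \<nu>..r2}.
        Xdist U (u t) (product_semigroup S (1 / real \<nu>) ` (Cball U (radius U E j r1 r2) \<inter> X)) \<le> theta1 U E j r1 r2 (1 / real \<nu>))"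
      unfolding d_def by auto
  }
  then show ?thesis
    unfolding K_set_def using sub uj uX norm_continuous_on_subset [OF uc sub] by (auto intro!: in_Cball)
qed

section \<open>Convergence of mild solutions\<close>

lemma duhamel_diff:
  assumes F: "bint bc 0 t F m" and G: "bint bc 0 t G m'"
  shows "duhamel t (\<lambda>s. F s - G s) = duhamel t F - duhamel t G"
proof -
  have cF: "bint bc 0 t (\<lambda>s. P (t - s) (F s)) (\<lambda>s. real CARD('n) * m s)"
    and cG: "bint bc 0 t (\<lambda>s. P (t - s) (G s)) (\<lambda>s. real CARD('n) * m' s)"
    by (rule bint_convolution [OF F order_refl] bint_convolution [OF G order_refl])+
  have "AE s in lebesgue_on {0..t}. s \<in> {0..t}" by (rule AE_I2) simp
  with bint_AE [OF F] bint_AE [OF G]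
  have "AE s in lebesgue_on {0..t}. P (t - s) (F s - G s) = P (t - s) (F s) - P (t - s) (G s)"
    by eventually_elim (simp add: P_diff)
  then have "duhamel t (\<lambda>s. F s - G s) = pint 0 t (\<lambda>s. P (t - s) (F s) - P (t - s) (G s))"
    unfolding duhamel_def
    by (rule pint_cong_AE [OF bint_convolution [OF bint_diff [OF F G] order_refl] bint_diff [OF cF cG]])
  then show ?thesis unfolding pint_diff [OF cF cG] duhamel_def .
qed

text \<open>A continuous curve on [0, T] is bounded, so some optimal m-bound dominates the
  integrand. The Bochner integral then exists, is unique and equals the Duhamel term.\<close>

lemma mild_solution_iff_mild:
  assumes PS: "P = product_semigroup S" and g: "g \<in> SC U"
    and vanish: "bc = Dirichlet \<Longrightarrow> \<forall>t. \<forall>x\<in>frontier U. g t x 0 = 0"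
  shows "mild_solution U bc S g z T u \<longleftrightarrow> mild g z T u"
proof (cases "(\<forall>t\<in>{0..T}. u t \<in> X) \<and> norm_continuous_on U {0..T} u")
  case True
  then have u: "\<And>t. t \<in> {0..T} \<Longrightarrow> u t \<in> X" "norm_continuous_on U {0..T} u" by auto
  obtain j where j: "\<And>t. t \<in> {0..T} \<Longrightarrow> Xnorm U (u t) \<le> real j"
    using norm_continuous_bounded [OF u] by blast
  let ?F = "\<lambda>s. nemytskii U g s (u s)"
  have F: "bint bc 0 T ?F (opt_m_bound U g j)" by (rule bint_nemytskii_trajectory [OF g vanish u j])
  have "(\<exists>w. has_bochner_integral_Cbar U (lebesgue_on {0..t}) (\<lambda>s. product_semigroup S (t - s) (?F s)) w \<and>
      u t = product_semigroup S t z + w) \<longleftrightarrow> u t = P t z + duhamel t ?F" if t: "t \<in> {0..T}" for t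
  proof -
    have c: "bint bc 0 t (\<lambda>s. P (t - s) (?F s)) (\<lambda>s. real CARD('n) * opt_m_bound U g j s)"
      by (rule bint_convolution [OF bint_subset [OF F]]) (use t in auto)
    show ?thesis
      using has_bochner_integral_pint [OF c] has_bochner_integral_eq_pint [OF c]
      unfolding duhamel_def PS [symmetric] by blast
  qed
  then show ?thesis using True unfolding mild_solution_def mild_def by blast
next
  case False
  then show ?thesis unfolding mild_solution_def mild_def by blast
qed

text \<open>The perturbation \<open>g - f\<close> is evaluated along \<open>w\<close> and assumed
  small after integration; what remains is the increment of \<open>f\<close> from \<open>u\<close>
  to \<open>w\<close>, which feeds Gronwall's inequality. The resulting constant depends on
  \<open>f\<close> and \<open>j\<close>, so it is the same for all maps \<open>g\<close> compared
  with \<open>f\<close>.\<close>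

lemma mild_difference_le:
  assumes f: "f \<in> SC U" and g: "g \<in> SC U"
    and vanish: "bc = Dirichlet \<Longrightarrow> \<forall>t. \<forall>x\<in>frontier U. f t x 0 = 0"
      "bc = Dirichlet \<Longrightarrow> \<forall>t. \<forall>x\<in>frontier U. g t x 0 = 0"
    and w: "mild g y T w" and u: "mild f z T u" and y: "y \<in> X" and z: "z \<in> X"
    and wj: "\<And>t. t \<in> {0..T} \<Longrightarrow> Xnorm U (w t) \<le> real j"
    and uj: "\<And>t. t \<in> {0..T} \<Longrightarrow> Xnorm U (u t) \<le> real j"
    and l: "integrable (lebesgue_on {0..T}) l" "\<And>s. 0 \<le> l s"
    and lip: "AE s in lebesgue_on {0..T}. \<forall>z\<in>Cball U (real j). \<forall>w\<in>Cball U (real j).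
       Xnorm U (nemytskii U f s z - nemytskii U f s w) \<le> l s * Xnorm U (z - w)"
    and \<kappa>: "0 \<le> \<kappa>" "\<And>t. t \<in> {0..T} \<Longrightarrow>
      real CARD('n) * (\<integral>s. l s * exp (\<kappa> * s) \<partial>lebesgue_on {0..t}) \<le> exp (\<kappa> * t) / 2"
    and \<epsilon>: "0 \<le> \<epsilon>" "\<And>t. t \<in> {0..T} \<Longrightarrow> real CARD('n) * Xnorm U (y - z)
      + Xnorm U (duhamel t (\<lambda>s. nemytskii U (g - f) s (w s))) \<le> \<epsilon>"
    and t: "t \<in> {0..T}"
  shows "Xnorm U (w t - u t) \<le> 2 * \<epsilon> * exp (\<kappa> * t)"
proof -
  let ?Fw = "\<lambda>s. nemytskii U f s (w s)" and ?Fu = "\<lambda>s. nemytskii U f s (u s)" and ?G = "\<lambda>s. nemytskii U g s (w s)"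
  have wX: "\<And>t. t \<in> {0..T} \<Longrightarrow> w t \<in> X" and wc: "norm_continuous_on U {0..T} w"
    and uX: "\<And>t. t \<in> {0..T} \<Longrightarrow> u t \<in> X" and uc: "norm_continuous_on U {0..T} u"
    using w u by (auto simp: mild_def)
  have cont: "continuous_on {0..T} (\<lambda>t. Xnorm U (w t - u t))"
    by (rule norm_continuous_on_Xnorm [OF wX wc uX uc])
  have b: "bint bc 0 T ?Fw (opt_m_bound U f j)" "bint bc 0 T ?Fu (opt_m_bound U f j)" "bint bc 0 T ?G (opt_m_bound U g j)"
    by (rule bint_nemytskii_trajectory; use f g vanish wX wc wj uX uc uj in blast)+
  show ?thesis
  proof (rule gronwall_weighted [OF l _ \<kappa> cont \<epsilon>(1) _ t])
    fix t assume t: "t \<in> {0..T}"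
    have sub: "{0..t} \<subseteq> {0..T}" using t by auto
    note bt = b [THEN bint_subset, OF sub]
    have in': "P t y \<in> X" "P t z \<in> X" "duhamel t ?Fw \<in> X" "duhamel t ?Fu \<in> X" "duhamel t ?G \<in> X"
      using t y z by (auto intro: P_in duhamel_in [OF bt(1)] duhamel_in [OF bt(2)] duhamel_in [OF bt(3)])
    have d: "duhamel t (\<lambda>s. nemytskii U (g - f) s (w s)) = duhamel t ?G - duhamel t ?Fw"
      unfolding nemytskii_diff by (rule duhamel_diff [OF bt(3,1)])
    have "w t = P t y + duhamel t ?G" "u t = P t z + duhamel t ?Fu" using w u t by (auto simp: mild_def)
    then have "w t - u t = (P t y - P t z) + ((duhamel t ?G - duhamel t ?Fw) + (duhamel t ?Fw - duhamel t ?Fu))"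
      by (simp add: algebra_simps)
    then have "Xnorm U (w t - u t) \<le> Xnorm U (P t y - P t z) + (Xnorm U (duhamel t ?G - duhamel t ?Fw) + Xnorm U (duhamel t ?Fw - duhamel t ?Fu))"
      using Xnorm_triangle [OF bc_space_diff [OF in'(1,2)] bc_space_add [OF bc_space_diff [OF in'(5,3)] bc_space_diff [OF in'(3,4)]]]
        Xnorm_triangle [OF bc_space_diff [OF in'(5,3)] bc_space_diff [OF in'(3,4)]] by simp
    moreover have "Xnorm U (P t y - P t z) \<le> real CARD('n) * Xnorm U (y - z)"
      using P_diff [OF _ y z, of t] Xnorm_P_le [OF _ bc_space_diff [OF y z], of t] t by simp
    moreover have "Xnorm U (duhamel t ?Fw - duhamel t ?Fu) \<le> real CARD('n) * (\<integral>s. l s * Xnorm U (w s - u s) \<partial>lebesgue_on {0..t})"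
    proof (rule Xnorm_duhamel_diff_le [OF bt(1,2)])
      show "integrable (lebesgue_on {0..t}) (\<lambda>s. l s * Xnorm U (w s - u s))"
        by (rule integrable_mult_continuous [OF integrable_lebesgue_on_subset [OF l(1) sub] continuous_on_subset [OF cont sub]])
      have "AE s in lebesgue_on {0..t}. s \<in> {0..t}" by (rule AE_I2) simp
      with AE_lebesgue_on_subset [OF lip sub]
      show "AE s in lebesgue_on {0..t}. Xnorm U (?Fw s - ?Fu s) \<le> l s * Xnorm U (w s - u s)"
      proof eventually_elim
        case (elim s)
        then have "w s \<in> Cball U (real j)" "u s \<in> Cball U (real j)"
          using sub by (auto intro!: in_Cball wX uX wj uj)
        then show ?case using elim(1) by blast
      qed
    qed
    ultimately show "Xnorm U (w t - u t) \<le> \<epsilon> + real CARD('n) * (\<integral>s. l s * Xnorm U (w s - u s) \<partial>lebesgue_on {0..t})"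
      using \<epsilon>(2) [OF t] unfolding d by linarith
  qed (use l(2) \<kappa>(2) in auto)
qed

text \<open>The comparison of \<open>g\<close> with itself: the perturbation vanishes and \<epsilon>
  = 0 is admissible. Both curves are bounded on the common interval, which provides one ball for the
  Lipschitz function.\<close>

lemma mild_unique:
  assumes g: "g \<in> LC U" and vanish: "bc = Dirichlet \<Longrightarrow> \<forall>t. \<forall>x\<in>frontier U. g t x 0 = 0" and z: "z \<in> X"
    and u: "mild g z T u" and w: "mild g z T' w" and t: "t \<in> {0..T}" "t \<in> {0..T'}"
  shows "u t = w t"
proof -
  have gS: "g \<in> SC U" using g by (simp add: LC_def)
  define R where "R = min T T'"
  have tR: "t \<in> {0..R}" using t by (simp add: R_def)
  have sub: "{0..R} \<subseteq> {0..T}" "{0..R} \<subseteq> {0..T'}" by (auto simp: R_def)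
  have uR: "mild g z R u" and wR: "mild g z R w"
    using u w sub norm_continuous_on_subset unfolding mild_def by blast+
  have uX: "\<And>t. t \<in> {0..R} \<Longrightarrow> u t \<in> X" and uc: "norm_continuous_on U {0..R} u"
    and wX: "\<And>t. t \<in> {0..R} \<Longrightarrow> w t \<in> X" and wc: "norm_continuous_on U {0..R} w"
    using uR wR by (auto simp: mild_def)
  obtain j1 where j1: "\<And>t. t \<in> {0..R} \<Longrightarrow> Xnorm U (u t) \<le> real j1"
    using norm_continuous_bounded [OF uX uc] by blast
  obtain j2 where j2: "\<And>t. t \<in> {0..R} \<Longrightarrow> Xnorm U (w t) \<le> real j2"
    using norm_continuous_bounded [OF wX wc] by blast
  define j where "j = max j1 j2"
  have j: "Xnorm U (u t) \<le> real j" "Xnorm U (w t) \<le> real j" if "t \<in> {0..R}" for t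
    using j1 [OF that] j2 [OF that] by (auto simp: j_def)
  obtain l where l [rule_format]: "\<forall>a b. integrable (lebesgue_on {a..b}) l" "\<forall>t. 0 \<le> l t"
    and lip [THEN spec, THEN spec]: "\<forall>a b. AE s in lebesgue_on {a..b}. \<forall>z\<in>Cball U (real j). \<forall>w\<in>Cball U (real j).
       Xnorm U (nemytskii U g s z - nemytskii U g s w) \<le> l s * Xnorm U (z - w)"
    using LC_lipschitz [OF g, where r = "real j"] by (elim exE conjE) (rule that; assumption)
  obtain \<kappa> where \<kappa>: "0 \<le> \<kappa>" "\<And>t. t \<in> {0..R} \<Longrightarrow>
      real CARD('n) * (\<integral>s. l s * exp (\<kappa> * s) \<partial>lebesgue_on {0..t}) \<le> exp (\<kappa> * t) / 2"
    using exponential_weight [OF l(1) l(2), of "real CARD('n)" R] by auto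
  have zero: "duhamel t (\<lambda>s. nemytskii U (g - g) s (u s)) = 0" for t
  proof -
    have "nemytskii U (g - g) s y = 0" for s y unfolding nemytskii_diff by simp
    moreover have "bint bc 0 t (\<lambda>s. 0 :: real ^ 'm \<Rightarrow> real ^ 'n) (\<lambda>s. 0)" by (simp add: bint_def)
    ultimately show ?thesis using duhamel_diff [of t "\<lambda>s. 0" "\<lambda>s. 0" "\<lambda>s. 0" "\<lambda>s. 0"] by simp
  qed
  have "Xnorm U (u t - w t) \<le> 2 * 0 * exp (\<kappa> * t)"
  proof (rule mild_difference_le [OF gS gS vanish vanish uR wR z z j l lip \<kappa> _ _ tR])
    show "real CARD('n) * Xnorm U (z - z) + Xnorm U (duhamel t (\<lambda>s. nemytskii U (g - g) s (u s))) \<le> 0" for t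
      unfolding zero by simp
  qed simp_all
  then have "u t - w t = 0"
    by (intro Xnorm_eq_0D [OF bc_space_diff [OF uX wX]] tR) simp
  then show ?thesis by simp
qed

text \<open>Away from the end point \<open>s = t\<close> the operator \<open>P (t - s)\<close> is nearly constant on the
  intervals of a fine grid, so only the integrals of \<open>G\<close> over the grid intervals matter.\<close>

lemma duhamel_small:
  assumes G: "bint bc 0 T G m" and t: "t \<in> {0..T}" and M: "1 \<le> M"
    and \<delta>: "1 / real M \<le> \<delta>" and \<epsilon>: "0 \<le> \<epsilon>" and \<eta>: "0 \<le> \<eta>"
    and osc: "\<And>h \<tau> y. h \<in> {0..1 / real M} \<Longrightarrow> \<delta> \<le> \<tau> \<Longrightarrow> y \<in> X \<Longrightarrow> Xnorm U (P (\<tau> + h) y - P \<tau> y) \<le> \<epsilon> * Xnorm U y"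
    and grid: "\<And>k. real (Suc k) / real M \<le> T \<Longrightarrow> Xnorm U (pint (real k / real M) (real (Suc k) / real M) G) \<le> \<eta>"
    and short: "\<And>a b. 0 \<le> a \<Longrightarrow> a \<le> b \<Longrightarrow> b \<le> T \<Longrightarrow> b - a \<le> 2 * \<delta> \<Longrightarrow> integral\<^sup>L (lebesgue_on {a..b}) m \<le> \<epsilon>"
    and B: "integral\<^sup>L (lebesgue_on {0..T}) m \<le> B"
  shows "Xnorm U (duhamel t G) \<le> real CARD('n) * (real M * T) * \<eta> + \<epsilon> * B + real CARD('n) * \<epsilon>"
proof -
  let ?N = "real CARD('n)"
  have M0: "0 < real M" using M by simp
  have m: "integrable (lebesgue_on {0..T}) m" by (rule bint_bound_integrable [OF G])
  have m0: "AE s in lebesgue_on {0..T}. 0 \<le> m s"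
    using bint_AE [OF G] by eventually_elim (use Xnorm_nonneg in fastforce)
  have conv: "bint bc a b (\<lambda>s. P (t - s) (G s)) (\<lambda>s. ?N * m s)" if "0 \<le> a" "b \<le> t" for a b
    by (rule bint_convolution [OF bint_subset [OF G]]) (use that t in auto)
  \<comment> \<open>Induction over the cells that end before \<open>t - \<delta>\<close>. On each,
    \<open>P (t - s)\<close> is frozen at the right end of the cell, at the cost of \<epsilon> times
    the mass of \<open>m\<close> there, and then taken out of the integral. The alternative k = 0
    covers small \<open>t\<close>, for which no cell qualifies.\<close>
  have main: "Xnorm U (pint 0 (real k / real M) (\<lambda>s. P (t - s) (G s)))
      \<le> real k * (?N * \<eta>) + \<epsilon> * integral\<^sup>L (lebesgue_on {0..real k / real M}) m"
    if "k = 0 \<or> real k / real M \<le> t - \<delta>" for k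
    using that
  proof (induction k)
    case 0
    have z: "{0::real} \<in> null_sets lebesgue" by simp
    have "pint 0 0 (\<lambda>s. P (t - s) (G s)) = 0"
      by (simp add: pint_def integral_eq_zero_null_sets [OF z] zero_fun_def)
    then show ?case by (simp add: integral_eq_zero_null_sets [OF z])
  next
    case (Suc k)
    let ?a = "real k / real M" and ?b = "real (Suc k) / real M"
    have ab: "0 \<le> ?a" "?a \<le> ?b" "?b \<le> t - \<delta>" "?b - ?a = 1 / real M"
      using Suc.prems M0 by (auto simp: divide_right_mono add_divide_distrib)
    have \<delta>0: "0 < \<delta>" using \<delta> M0 by (smt (verit) divide_pos_pos zero_less_one)
    have bt: "?b \<le> t" "?b \<le> T" using ab \<delta>0 t by auto
    have IH: "Xnorm U (pint 0 ?a (\<lambda>s. P (t - s) (G s))) \<le> real k * (?N * \<eta>) + \<epsilon> * integral\<^sup>L (lebesgue_on {0..?a}) m"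
      by (rule Suc.IH) (use ab in linarith)
    have Gab: "bint bc ?a ?b G m" by (rule bint_subset [OF G]) (use ab bt in auto)
    have c1: "bint bc ?a ?b (\<lambda>s. P (t - s) (G s)) (\<lambda>s. ?N * m s)" by (rule conv [OF ab(1) bt(1)])
    have c2: "bint bc ?a ?b (\<lambda>s. P (t - ?b) (G s)) (\<lambda>s. ?N * m s)" by (rule bint_P [OF Gab]) (use bt in simp)
    have d: "bint bc ?a ?b (\<lambda>s. P (t - s) (G s) - P (t - ?b) (G s)) (\<lambda>s. \<epsilon> * m s)"
    proof (rule bint_mono [OF bint_diff [OF c1 c2]])
      show "integrable (lebesgue_on {?a..?b}) (\<lambda>s. \<epsilon> * m s)" using bint_bound_integrable [OF Gab] by simp
      have "AE s in lebesgue_on {?a..?b}. s \<in> {?a..?b}" by (rule AE_I2) simp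
      with bint_AE [OF Gab] show "AE s in lebesgue_on {?a..?b}. Xnorm U (P (t - s) (G s) - P (t - ?b) (G s)) \<le> \<epsilon> * m s"
      proof eventually_elim
        case (elim s)
        have "Xnorm U (P ((t - ?b) + (?b - s)) (G s) - P (t - ?b) (G s)) \<le> \<epsilon> * Xnorm U (G s)"
          using elim ab by (intro osc) auto
        also have "\<dots> \<le> \<epsilon> * m s" using elim \<epsilon> by (intro mult_left_mono) auto
        finally show ?case by simp
      qed
    qed
    have pX: "pint 0 ?a (\<lambda>s. P (t - s) (G s)) \<in> X" "pint ?a ?b (\<lambda>s. P (t - s) (G s)) \<in> X"
      "pint ?a ?b (\<lambda>s. P (t - ?b) (G s)) \<in> X"
      using pint_in_bc_space [OF conv [of 0 ?a]] pint_in_bc_space [OF c1] pint_in_bc_space [OF c2] ab bt by auto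
    have "pint 0 ?b (\<lambda>s. P (t - s) (G s)) = pint 0 ?a (\<lambda>s. P (t - s) (G s)) + pint ?a ?b (\<lambda>s. P (t - s) (G s))"
      by (rule pint_combine [OF conv]) (use ab bt in auto)
    then have "Xnorm U (pint 0 ?b (\<lambda>s. P (t - s) (G s)))
        \<le> Xnorm U (pint 0 ?a (\<lambda>s. P (t - s) (G s))) + Xnorm U (pint ?a ?b (\<lambda>s. P (t - s) (G s)))"
      using Xnorm_triangle [OF pX(1,2)] by simp
    moreover have "Xnorm U (pint ?a ?b (\<lambda>s. P (t - s) (G s))) \<le>
        Xnorm U (pint ?a ?b (\<lambda>s. P (t - s) (G s)) - pint ?a ?b (\<lambda>s. P (t - ?b) (G s))) + Xnorm U (pint ?a ?b (\<lambda>s. P (t - ?b) (G s)))"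
      using Xnorm_triangle [OF bc_space_diff [OF pX(2,3)] pX(3)] by simp
    moreover have "Xnorm U (pint ?a ?b (\<lambda>s. P (t - s) (G s)) - pint ?a ?b (\<lambda>s. P (t - ?b) (G s)))
        \<le> \<epsilon> * integral\<^sup>L (lebesgue_on {?a..?b}) m"
      using Xnorm_pint_le [OF d] unfolding pint_diff [OF c1 c2] by simp
    moreover have "Xnorm U (pint ?a ?b (\<lambda>s. P (t - ?b) (G s))) \<le> ?N * \<eta>"
    proof -
      have "pint ?a ?b (\<lambda>s. P (t - ?b) (G s)) = P (t - ?b) (pint ?a ?b G)"
        by (rule pint_bdd_linear [OF Gab P_linear, symmetric]) (use bt in auto)
      then have "Xnorm U (pint ?a ?b (\<lambda>s. P (t - ?b) (G s))) \<le> ?N * Xnorm U (pint ?a ?b G)"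
        using Xnorm_P_le [OF _ pint_in_bc_space [OF Gab], of "t - ?b"] bt by simp
      also have "\<dots> \<le> ?N * \<eta>" by (intro mult_left_mono grid bt) auto
      finally show ?thesis .
    qed
    moreover have "integral\<^sup>L (lebesgue_on {0..?b}) m
        = integral\<^sup>L (lebesgue_on {0..?a}) m + integral\<^sup>L (lebesgue_on {?a..?b}) m"
      by (rule integral_lebesgue_on_combine [OF integrable_lebesgue_on_subset [OF m]]) (use ab bt in auto)
    then have "\<epsilon> * integral\<^sup>L (lebesgue_on {0..?b}) m
        = \<epsilon> * integral\<^sup>L (lebesgue_on {0..?a}) m + \<epsilon> * integral\<^sup>L (lebesgue_on {?a..?b}) m"
      by (simp add: distrib_left)
    moreover have "real (Suc k) * (?N * \<eta>) = real k * (?N * \<eta>) + ?N * \<eta>" by (simp add: distrib_right)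
    ultimately show ?case using IH by linarith
  qed
  \<comment> \<open>The number of whole cells up to \<open>t - \<delta>\<close>; \<open>nat\<close>
    makes it 0 when \<open>t\<close> is below \<delta>.\<close>
  define p where "p = nat \<lfloor>real M * (t - \<delta>)\<rfloor>"
  let ?c = "real p / real M"
  have \<delta>0: "0 < \<delta>" using \<delta> M0 by (smt (verit) divide_pos_pos zero_less_one)
  have p: "p = 0 \<or> ?c \<le> t - \<delta>"
  proof (cases "0 \<le> real M * (t - \<delta>)")
    case True
    then have "real p \<le> real M * (t - \<delta>)" unfolding p_def by simp
    then show ?thesis using M0 by (simp add: field_simps)
  qed (simp add: p_def)
  have c: "0 \<le> ?c" "?c \<le> t" using p \<delta>0 t by auto
  \<comment> \<open>What remains up to \<open>t\<close> is at most \<delta> plus the length 1 / M of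
    one cell.\<close>
  have tc: "t - ?c \<le> 2 * \<delta>"
  proof -
    have "real M * (t - \<delta>) \<le> real p + 1" unfolding p_def by linarith
    then have "t - \<delta> \<le> ?c + 1 / real M" using M0 by (simp add: field_simps)
    then show ?thesis using \<delta> by linarith
  qed
  have "duhamel t G = pint 0 ?c (\<lambda>s. P (t - s) (G s)) + pint ?c t (\<lambda>s. P (t - s) (G s))"
    unfolding duhamel_def by (rule pint_combine [OF conv]) (use c in auto)
  then have "Xnorm U (duhamel t G) \<le> Xnorm U (pint 0 ?c (\<lambda>s. P (t - s) (G s))) + Xnorm U (pint ?c t (\<lambda>s. P (t - s) (G s)))"
    using Xnorm_triangle [OF pint_in_bc_space [OF conv [of 0 ?c]] pint_in_bc_space [OF conv [of ?c t]]] c by simp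
  moreover have "Xnorm U (pint ?c t (\<lambda>s. P (t - s) (G s))) \<le> ?N * \<epsilon>"
  proof -
    have "Xnorm U (pint ?c t (\<lambda>s. P (t - s) (G s))) \<le> ?N * integral\<^sup>L (lebesgue_on {?c..t}) m"
      using Xnorm_pint_le [OF conv [of ?c t]] c by simp
    also have "\<dots> \<le> ?N * \<epsilon>" using c t tc by (intro mult_left_mono short) auto
    finally show ?thesis .
  qed
  moreover have "real p * (?N * \<eta>) \<le> ?N * (real M * T) * \<eta>"
  proof -
    have "real p \<le> real M * t" using c M0 by (simp add: field_simps)
    also have "\<dots> \<le> real M * T" using t by (intro mult_left_mono) auto
    finally have "real p * (?N * \<eta>) \<le> real M * T * (?N * \<eta>)" using \<eta> by (intro mult_right_mono) auto
    then show ?thesis by (simp add: mult_ac)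
  qed
  moreover have "\<epsilon> * integral\<^sup>L (lebesgue_on {0..?c}) m \<le> \<epsilon> * B"
    using integral_lebesgue_on_mono_set [OF m _ m0, of 0 ?c] c t B \<epsilon> by (intro mult_left_mono) auto
  ultimately show ?thesis using main [OF p] by linarith
qed

section \<open>Convergence inside a fixed ball\<close>

lemma mild_subinterval:
  assumes "mild g z T u" "T' \<le> T" shows "mild g z T' u"
proof -
  have "{0..T'} \<subseteq> {0..T}" using assms(2) by auto
  then show ?thesis
    using assms(1) norm_continuous_on_subset unfolding mild_def by blast
qed

lemma duhamel_cong: "(\<And>s. s \<in> {0..t} \<Longrightarrow> F s = G s) \<Longrightarrow> duhamel t F = duhamel t G"
  unfolding duhamel_def pint_def by (intro ext Bochner_Integration.integral_cong) auto

lemma duhamel_0: "duhamel 0 F = 0"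
proof -
  have z: "{0::real} \<in> null_sets lebesgue" by simp
  show ?thesis by (simp add: duhamel_def pint_def integral_eq_zero_null_sets [OF z] zero_fun_def)
qed

text \<open>The conclusion is conditional on \<open>w\<close> staying in the ball, and its threshold
  for \<open>n\<close> is independent of \<open>T0\<close> and \<open>w\<close>. The exit argument
  needs this uniformity, because the exit time may depend on \<open>n\<close>; all constants are
  therefore fixed before \<open>n\<close>.\<close>

theorem mild_convergence_while_bounded:
  assumes PS: "P = product_semigroup S"
    and E: "E \<subseteq> LC U" "L1loc_equicontinuous_m_bounds U E"
    and vanish: "bc = Dirichlet \<Longrightarrow> \<forall>g\<in>insert f E. \<forall>t. \<forall>x\<in>frontier U. g t x 0 = 0"
    and fs: "\<forall>n\<ge>1. fs n \<in> E"
    and fs_lim: "limitin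
        (subtopology (sigma_topology U bc S (theta1 U E) (theta2 U bc S E) (radius U E)) (LC U)) fs f sequentially"
    and zs: "\<forall>n\<ge>1. zs n \<in> X" and z: "z \<in> X" and zs_lim: "(\<lambda>n. Xnorm U (zs n - z)) \<longlonglongrightarrow> 0"
    and u: "mild f z T u" and T: "0 \<le> T" and j: "1 \<le> j"
    and uj: "\<And>t. t \<in> {0..T} \<Longrightarrow> Xnorm U (u t) \<le> real j" and \<epsilon>: "0 < \<epsilon>"
  shows "\<forall>\<^sub>F n in sequentially. \<forall>T0 w. T0 \<in> {0..T} \<longrightarrow> mild (fs n) (zs n) T0 w \<longrightarrow>
    (\<forall>t\<in>{0..T0}. Xnorm U (w t) \<le> real j) \<longrightarrow> (\<forall>t\<in>{0..T0}. Xnorm U (w t - u t) \<le> \<epsilon>)"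
proof -
  let ?N = "real CARD('n)"
  have fLC: "f \<in> LC U" by (rule sigma_limitD(1) [OF fs_lim])
  then have fSC: "f \<in> SC U" by (simp add: LC_def)
  have ESC: "E \<subseteq> SC U" using E(1) by (auto simp: LC_def)
  obtain l where l [rule_format]: "\<forall>a b. integrable (lebesgue_on {a..b}) l" "\<forall>t. 0 \<le> l t"
    and lip [THEN spec, THEN spec]: "\<forall>a b. AE s in lebesgue_on {a..b}. \<forall>z\<in>Cball U (real j). \<forall>w\<in>Cball U (real j).
       Xnorm U (nemytskii U f s z - nemytskii U f s w) \<le> l s * Xnorm U (z - w)"
    using LC_lipschitz [OF fLC, where r = "real j"] by (elim exE conjE) (rule that; assumption)
  obtain \<kappa> where \<kappa>: "0 \<le> \<kappa>" "\<And>t. t \<in> {0..T} \<Longrightarrow>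
      ?N * (\<integral>s. l s * exp (\<kappa> * s) \<partial>lebesgue_on {0..t}) \<le> exp (\<kappa> * t) / 2"
    using exponential_weight [OF l(1) l(2), of ?N T] by auto
  \<comment> \<open>Compensates the final factor \<open>2 * exp (\<kappa> * T)\<close> of the
    Gronwall estimate.\<close>
  define \<epsilon>' where "\<epsilon>' = \<epsilon> / (2 * exp (\<kappa> * T))"
  have \<epsilon>': "0 < \<epsilon>'" using \<epsilon> by (simp add: \<epsilon>'_def)
  obtain BE where BE: "\<And>g. g \<in> E \<Longrightarrow> integral\<^sup>L (lebesgue_on {0..T}) (opt_m_bound U g j) \<le> BE"
    using uniformly_bounded_opt_m_bound [OF ESC E(2) j, of 0 T] by blast
  \<comment> \<open>Bounds the mass of the m-bound of \<open>fs n - f\<close> on [0, T] uniformly in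
    \<open>n\<close>; the contribution of \<open>f\<close> is added separately. The absolute value
    keeps \<open>B\<close> nonnegative.\<close>
  define B where "B = \<bar>BE\<bar> + integral\<^sup>L (lebesgue_on {0..T}) (opt_m_bound U f j)"
  have B0: "0 \<le> B" unfolding B_def using opt_m_bound_integral_nonneg [OF fSC] by (simp add: add_nonneg_nonneg)
  \<comment> \<open>\<epsilon>' is distributed in quarters: one for freezing the semigroup together
    with the short remainder, one for the grid integrals, one for the initial values.\<close>
  define \<epsilon>1 where "\<epsilon>1 = \<epsilon>' / (4 * (B + ?N))"
  have BN: "0 < B + ?N" using B0 by (simp add: add_nonneg_pos)
  have "\<epsilon>' / (4 * c) * c = \<epsilon>' / 4" if "0 < c" for c using that by simp
  from this [OF BN] have "\<epsilon>1 * (B + ?N) = \<epsilon>' / 4" by (simp only: \<epsilon>1_def)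
  then have \<epsilon>1_sum: "\<epsilon>1 * B + ?N * \<epsilon>1 = \<epsilon>' / 4" by (simp only: distrib_left mult.commute [of ?N])
  have "0 < \<epsilon>1" unfolding \<epsilon>1_def using \<epsilon>' BN by (intro divide_pos_pos mult_pos_pos) auto
  note \<epsilon>1 = this \<epsilon>1_sum
  have "0 < T + 1" "0 < \<epsilon>1 / 2" using T \<epsilon>1(1) by auto
  from equicontinuous_opt_m_bound [OF ESC E(2) j this]
  obtain \<delta>E where \<delta>E: "0 < \<delta>E" "\<And>g a b. g \<in> E \<Longrightarrow> - (T + 1) \<le> a \<Longrightarrow> a \<le> b \<Longrightarrow> b \<le> T + 1 \<Longrightarrow> b - a < \<delta>E \<Longrightarrow>
      integral\<^sup>L (lebesgue_on {a..b}) (opt_m_bound U g j) < \<epsilon>1 / 2" by blast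
  \<comment> \<open>The equicontinuity of \<open>E\<close> says nothing about \<open>f\<close>;
    smallness of the integrals of its m-bound over short intervals comes from uniform continuity of
    the indefinite integral.\<close>
  define Gf where "Gf t = integral {0..t} (opt_m_bound U f j)" for t
  have "continuous_on {0..T} Gf"
    unfolding Gf_def
    by (intro indefinite_integral_continuous_1 integrable_on_lebesgue_on opt_m_bound_integrable fSC) simp
  then have "uniformly_continuous_on {0..T} Gf" by (intro compact_uniformly_continuous) auto
  then obtain \<delta>f where \<delta>f: "0 < \<delta>f"
    "\<And>a b. a \<in> {0..T} \<Longrightarrow> b \<in> {0..T} \<Longrightarrow> dist b a < \<delta>f \<Longrightarrow> dist (Gf b) (Gf a) < \<epsilon>1 / 2"
    using \<open>0 < \<epsilon>1 / 2\<close> unfolding uniformly_continuous_on_def by blast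
  have f_short: "integral\<^sup>L (lebesgue_on {a..b}) (opt_m_bound U f j) < \<epsilon>1 / 2"
    if "0 \<le> a" "a \<le> b" "b \<le> T" "b - a < \<delta>f" for a b
  proof -
    have "integral\<^sup>L (lebesgue_on {0..b}) (opt_m_bound U f j)
        = integral\<^sup>L (lebesgue_on {0..a}) (opt_m_bound U f j) + integral\<^sup>L (lebesgue_on {a..b}) (opt_m_bound U f j)"
      by (rule integral_lebesgue_on_combine [OF opt_m_bound_integrable [OF fSC] that(1,2)])
    then have "integral\<^sup>L (lebesgue_on {a..b}) (opt_m_bound U f j) = Gf b - Gf a"
      unfolding Gf_def by (simp add: lebesgue_integral_eq_integral opt_m_bound_integrable [OF fSC])
    moreover have "\<bar>Gf b - Gf a\<bar> < \<epsilon>1 / 2" using \<delta>f(2) [of a b] that by (simp add: dist_real_def)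
    ultimately show ?thesis by linarith
  qed
  \<comment> \<open>Divided by 3, so that intervals of length 2 \<delta> are strictly shorter than
    both thresholds.\<close>
  define \<delta> where "\<delta> = min \<delta>E \<delta>f / 3"
  have \<delta>: "0 < \<delta>" "2 * \<delta> < \<delta>E" "2 * \<delta> < \<delta>f" using \<delta>E(1) \<delta>f(1) by (auto simp: \<delta>_def)
  obtain \<delta>P where \<delta>P: "0 < \<delta>P" "\<And>h t y. h \<in> {0..\<delta>P} \<Longrightarrow> \<delta> \<le> t \<Longrightarrow> y \<in> X \<Longrightarrow>
      Xnorm U (P (t + h) y - P t y) \<le> \<epsilon>1 * Xnorm U y"
    using P_norm_continuous [OF \<delta>(1) \<epsilon>1(1)] by blast
  have "0 < min \<delta> \<delta>P" using \<delta> \<delta>P by simp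
  then obtain M0 where M0: "inverse (real (Suc M0)) < min \<delta> \<delta>P" by (rule reals_Archimedean [THEN exE])
  define M where "M = Suc M0"
  have M: "1 \<le> M" "1 / real M \<le> \<delta>" "1 / real M \<le> \<delta>P"
    using M0 by (auto simp: M_def inverse_eq_divide)
  \<comment> \<open>At most M T cells contribute N \<eta> each; the added 1 keeps the denominator
    positive also for T = 0.\<close>
  define \<eta> where "\<eta> = \<epsilon>' / (4 * (?N * (real M * T) + 1))"
  have NMT: "0 \<le> ?N * (real M * T)" using T by simp
  then have \<eta>: "0 < \<eta>" "?N * (real M * T) * \<eta> \<le> \<epsilon>' / 4"
    using \<epsilon>' by (simp_all add: \<eta>_def divide_simps add_nonneg_pos algebra_simps)
  \<comment> \<open>Only finitely many cells fit into [0, T], so their seminorm conditions hold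
    simultaneously from some \<open>n\<close> on. Multiples of 1 / M are rational, as the seminorms
    require.\<close>
  define K where "K = nat \<lceil>real M * T\<rceil>"
  let ?KS = "\<lambda>k. K_set U bc S (theta1 U E) (theta2 U bc S E) (radius U E) j (real k / real M) (real (Suc k) / real M)"
  have "\<forall>\<^sub>F n in sequentially. fs n \<in> SC U \<and> (\<forall>v\<in>?KS k.
      Xnorm U (pint (real k / real M) (real (Suc k) / real M) (\<lambda>s. nemytskii U (fs n - f) s (v s))) < \<eta>)" for k
    by (rule sigma_limitD(2) [OF fs_lim j _ _ _ \<eta>(1)]) (use M(1) in \<open>auto simp: divide_strict_right_mono\<close>)
  then have "\<forall>\<^sub>F n in sequentially. \<forall>k\<in>{..<K}. fs n \<in> SC U \<and> (\<forall>v\<in>?KS k.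
      Xnorm U (pint (real k / real M) (real (Suc k) / real M) (\<lambda>s. nemytskii U (fs n - f) s (v s))) < \<eta>)"
    by (intro eventually_ball_finite) auto
  moreover have "\<forall>\<^sub>F n in sequentially. Xnorm U (zs n - z) < \<epsilon>' / (4 * ?N)"
    using zs_lim by (rule order_tendstoD) (use \<epsilon>' in simp)
  moreover have "\<forall>\<^sub>F n in sequentially. 1 \<le> (n::nat)" by (rule eventually_ge_at_top)
  ultimately show ?thesis
  proof eventually_elim
    case (elim n)
    have fn: "fs n \<in> E" "fs n \<in> SC U" "zs n \<in> X" using fs zs elim(3) ESC by auto
    have van: "bc = Dirichlet \<Longrightarrow> \<forall>t. \<forall>x\<in>frontier U. fs n t x 0 = 0" "bc = Dirichlet \<Longrightarrow> \<forall>t. \<forall>x\<in>frontier U. f t x 0 = 0"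
      using vanish fn(1) by auto
    show ?case
    proof (intro allI impI ballI)
      fix T0 w t
      assume T0: "T0 \<in> {0..T}" and w: "mild (fs n) (zs n) T0 w" and wj: "\<forall>t\<in>{0..T0}. Xnorm U (w t) \<le> real j"
        and t: "t \<in> {0..T0}"
      have sub: "{0..T0} \<subseteq> {0..T}" using T0 by auto
      have wX: "\<And>t. t \<in> {0..T0} \<Longrightarrow> w t \<in> X" and wc: "norm_continuous_on U {0..T0} w"
        using w by (auto simp: mild_def)
      let ?G = "\<lambda>s. nemytskii U (fs n - f) s (w s)" and ?m = "\<lambda>s. opt_m_bound U (fs n) j s + opt_m_bound U f j s"
      have G: "bint bc 0 T0 ?G ?m"
        unfolding nemytskii_diff
        by (intro bint_diff bint_nemytskii_trajectory fn fSC van wX wc) (use wj in auto)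
      have int: "integral\<^sup>L (lebesgue_on {a..b}) ?m
          = integral\<^sup>L (lebesgue_on {a..b}) (opt_m_bound U (fs n) j) + integral\<^sup>L (lebesgue_on {a..b}) (opt_m_bound U f j)" for a b
        by (intro Bochner_Integration.integral_add opt_m_bound_integrable fn fSC)
      have small: "?N * Xnorm U (zs n - z) + Xnorm U (duhamel t ?G) \<le> \<epsilon>'" if t: "t \<in> {0..T0}" for t
      proof -
        have "Xnorm U (duhamel t ?G) \<le> ?N * (real M * T0) * \<eta> + \<epsilon>1 * B + ?N * \<epsilon>1"
        proof (rule duhamel_small [OF G t M(1,2)])
          show "Xnorm U (P (\<tau> + h) y - P \<tau> y) \<le> \<epsilon>1 * Xnorm U y"
            if "h \<in> {0..1 / real M}" "\<delta> \<le> \<tau>" "y \<in> X" for h \<tau> y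
            using \<delta>P(2) [of h \<tau> y] that M(3) by auto
          show "Xnorm U (pint (real k / real M) (real (Suc k) / real M) ?G) \<le> \<eta>"
            if k: "real (Suc k) / real M \<le> T0" for k
          proof -
            have "real (Suc k) \<le> real M * T0" using k M(1) by (simp add: field_simps)
            also have "\<dots> \<le> real M * T" using T0 by (intro mult_left_mono) auto
            finally have "k < K" unfolding K_def by linarith
            moreover have "w \<in> ?KS k"
              by (rule mild_in_K_set [OF PS ESC E(2) fn(1) van(1) w fn(3) j]) (use wj k in auto)
            ultimately show ?thesis using elim(1) by (intro less_imp_le) blast
          qed
          show "integral\<^sup>L (lebesgue_on {a..b}) ?m \<le> \<epsilon>1"
            if "0 \<le> a" "a \<le> b" "b \<le> T0" "b - a \<le> 2 * \<delta>" for a b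
            using \<delta>E(2) [OF fn(1), of a b] f_short [of a b] that T0 \<delta> unfolding int by auto
          have "integral\<^sup>L (lebesgue_on {0..T0}) ?m \<le> integral\<^sup>L (lebesgue_on {0..T}) ?m"
          proof (rule integral_lebesgue_on_mono_set [OF _ sub])
            show "integrable (lebesgue_on {0..T}) ?m"
              by (intro Bochner_Integration.integrable_add opt_m_bound_integrable fn fSC)
            show "AE s in lebesgue_on {0..T}. 0 \<le> ?m s"
              using opt_m_bound_AE_nonneg [OF fn(2), where j = j] opt_m_bound_AE_nonneg [OF fSC, where j = j] by eventually_elim simp
          qed
          also have "\<dots> \<le> B" unfolding int B_def using BE [OF fn(1)] by linarith
          finally show "integral\<^sup>L (lebesgue_on {0..T0}) ?m \<le> B" .
        qed (use \<epsilon>1 \<eta> in auto)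
        moreover have "?N * (real M * T0) * \<eta> \<le> ?N * (real M * T) * \<eta>"
          using T0 \<eta>(1) by (intro mult_right_mono mult_left_mono) auto
        moreover have "?N * Xnorm U (zs n - z) \<le> \<epsilon>' / 4"
        proof -
          have "?N * Xnorm U (zs n - z) \<le> ?N * (\<epsilon>' / (4 * ?N))" using elim(2) by (intro mult_left_mono) auto
          then show ?thesis by simp
        qed
        ultimately show ?thesis using \<eta>(2) \<epsilon>1(2) \<epsilon>' by linarith
      qed
      have "Xnorm U (w t - u t) \<le> 2 * \<epsilon>' * exp (\<kappa> * t)"
      proof (rule mild_difference_le [OF fSC fn(2) van(2,1) w mild_subinterval [OF u] fn(3) z _ _ l lip \<kappa>(1) _ _ small t])
        show "?N * (\<integral>s. l s * exp (\<kappa> * s) \<partial>lebesgue_on {0..t}) \<le> exp (\<kappa> * t) / 2" if "t \<in> {0..T0}" for t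
          using \<kappa>(2) that sub by blast
      qed (use wj uj T0 \<epsilon>' in auto)
      also have "\<dots> \<le> 2 * \<epsilon>' * exp (\<kappa> * T)"
        using t T0 \<kappa>(1) \<epsilon>' by (intro mult_left_mono) (auto intro: mult_left_mono)
      also have "\<dots> = \<epsilon>" by (simp add: \<epsilon>'_def)
      finally show "Xnorm U (w t - u t) \<le> \<epsilon>" .
    qed
  qed
qed

text \<open>Uniqueness makes the definite description proper, so any mild solution on a
  nondegenerate interval containing \<open>t\<close> computes it.\<close>

lemma maximal_mild_solution_eq:
  assumes PS: "P = product_semigroup S" and g: "g \<in> LC U"
    and vanish: "bc = Dirichlet \<Longrightarrow> \<forall>t. \<forall>x\<in>frontier U. g t x 0 = 0" and z: "z \<in> X"
    and u: "mild g z T u" and "0 < T" and t: "t \<in> {0..T}"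
  shows "maximal_mild_solution U bc S g z t = u t"
proof -
  have gS: "g \<in> SC U" using g by (simp add: LC_def)
  note iff = mild_solution_iff_mild [OF PS gS vanish]
  show ?thesis
    unfolding maximal_mild_solution_def
  proof (rule the_equality)
    show "\<exists>\<delta> v. 0 < \<delta> \<and> t \<in> {0..\<delta>} \<and> mild_solution U bc S g z \<delta> v \<and> v t = u t"
      using u t \<open>0 < T\<close> iff by blast
  next
    fix y assume "\<exists>\<delta> v. 0 < \<delta> \<and> t \<in> {0..\<delta>} \<and> mild_solution U bc S g z \<delta> v \<and> v t = y"
    then obtain \<delta> v where v: "t \<in> {0..\<delta>}" "mild g z \<delta> v" "v t = y" using iff by blast
    show "y = u t" using mild_unique [OF g vanish z v(2) u v(1) t] v(3) by simp
  qed
qed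

text \<open>While the norm of \<open>w\<close> is at most \<open>j\<close>, clipping does nothing
  and \<open>w\<close> solves the original equation, so that \<open>close\<close> applies. At a
  first time with norm \<open>j\<close> the norm would then be at most (j - 1) + \<epsilon>, which
  is less than \<open>j\<close>.\<close>

lemma truncated_eventually_mild:
  assumes u: "\<And>t. t \<in> {0..T} \<Longrightarrow> u t \<in> X" "\<And>t. t \<in> {0..T} \<Longrightarrow> Xnorm U (u t) + 1 \<le> real j"
    and z: "z \<in> X"
    and w: "\<And>t. t \<in> {0..T} \<Longrightarrow> w t \<in> X" "norm_continuous_on U {0..T} w"
      "\<And>t. t \<in> {0..T} \<Longrightarrow> w t = P t z + duhamel t (\<lambda>s. nemytskii U g s (clip (real j) (w s)))"
    and start: "Xnorm U z < real j" and T: "0 \<le> T"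
    and close: "\<And>T0. T0 \<in> {0..T} \<Longrightarrow> mild g z T0 w \<Longrightarrow> (\<forall>t\<in>{0..T0}. Xnorm U (w t) \<le> real j) \<Longrightarrow>
      (\<forall>t\<in>{0..T0}. Xnorm U (w t - u t) \<le> \<epsilon>)"
    and \<epsilon>: "\<epsilon> < 1"
  shows "mild g z T w \<and> (\<forall>t\<in>{0..T}. Xnorm U (w t - u t) \<le> \<epsilon>)"
proof -
  let ?\<psi> = "\<lambda>t. Xnorm U (w t)"
  have mild: "mild g z T0 w" if T0: "T0 \<in> {0..T}" and le: "\<forall>t\<in>{0..T0}. ?\<psi> t \<le> real j" for T0
  proof -
    have sub: "{0..T0} \<subseteq> {0..T}" using T0 by auto
    have "clip (real j) (w s) = w s" if "s \<in> {0..T0}" for s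
    proof (rule clip_eq)
      fix x
      have "w s \<in> X" using w(1) that sub by blast
      from l1_norm_le_Xnorm [OF this, of x] le that show "l1_norm (w s x) \<le> real j" by fastforce
    qed
    then have "w t = P t z + duhamel t (\<lambda>s. nemytskii U g s (w s))" if "t \<in> {0..T0}" for t
      using w(3) [of t] that sub duhamel_cong [of t "\<lambda>s. nemytskii U g s (clip (real j) (w s))" "\<lambda>s. nemytskii U g s (w s)"]
      by auto
    then show ?thesis
      unfolding mild_def using w(1) sub norm_continuous_on_subset [OF w(2) sub] by blast
  qed
  have \<psi>: "continuous_on {0..T} ?\<psi>"
    using norm_continuous_on_Xnorm [OF w(1,2) bc_space_zero norm_continuous_const] by simp
  have \<psi>0: "?\<psi> 0 < real j" using w(3) [of 0] T start z by (simp add: duhamel_0 P_0)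
  have bound: "\<forall>t\<in>{0..T}. ?\<psi> t \<le> real j"
  proof (rule ccontr)
    assume "\<not> ?thesis"
    then obtain t1 where t1: "t1 \<in> {0..T}" "real j \<le> ?\<psi> t1" by force
    define A where "A = {0..T} \<inter> ?\<psi> -` {real j..}"
    have "closed A" unfolding A_def by (rule continuous_closed_preimage [OF \<psi>]) auto
    moreover have "bounded A" unfolding A_def by (rule bounded_subset [of "{0..T}"]) auto
    ultimately have "compact A" by (simp add: compact_eq_bounded_closed)
    moreover have "A \<noteq> {}" using t1 by (auto simp: A_def)
    ultimately obtain t0 where t0: "t0 \<in> A" "\<And>t. t \<in> A \<Longrightarrow> t0 \<le> t" by (meson compact_attains_inf)
    have t0T: "t0 \<in> {0..T}" "real j \<le> ?\<psi> t0" using t0(1) by (auto simp: A_def)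
    \<comment> \<open>By the intermediate value theorem, a value above \<open>j\<close> at
      \<open>t0\<close> would be preceded by a time with value exactly \<open>j\<close>, against the
      minimality of \<open>t0\<close>.\<close>
    have "?\<psi> t0 \<le> real j"
    proof (rule ccontr)
      assume gt: "\<not> ?thesis"
      have "\<exists>x\<ge>0. x \<le> t0 \<and> ?\<psi> x = real j"
        using \<psi>0 gt t0T by (intro IVT' continuous_on_subset [OF \<psi>]) auto
      then obtain x where x: "0 \<le> x" "x \<le> t0" "?\<psi> x = real j" by blast
      then have "x \<in> A" using t0T by (auto simp: A_def)
      with t0(2) x gt show False by force
    qed
    moreover have "?\<psi> t \<le> real j" if "t \<in> {0..<t0}" for t
      using t0(2) [of t] that t0T by (force simp: A_def)
    ultimately have le: "\<forall>t\<in>{0..t0}. ?\<psi> t \<le> real j" by (metis atLeastAtMost_iff atLeastLessThan_iff order_le_less)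
    have "Xnorm U (w t0 - u t0) \<le> \<epsilon>" using close [OF t0T(1) mild [OF t0T(1) le] le] t0T(1) by simp
    moreover have "?\<psi> t0 \<le> Xnorm U (w t0 - u t0) + Xnorm U (u t0)"
      using Xnorm_triangle [OF bc_space_diff [OF w(1) u(1)] u(1), OF t0T(1) t0T(1) t0T(1)] by simp
    ultimately show False using u(2) [OF t0T(1)] t0T(2) \<epsilon> by linarith
  qed
  have TT: "T \<in> {0..T}" using T by simp
  show ?thesis using mild [OF TT bound] close [OF TT mild [OF TT bound] bound] by blast
qed

end

text \<open>The first conjunct belongs to the notion of convergence: where no mild solution exists,
  \<open>maximal_mild_solution\<close> is an unspecified value, and the second conjunct alone would
  not speak about solutions.\<close>

theorem theorem4p8:
  fixes U :: "(real ^ 'm) set"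
    and bc :: bdry_cond
    and \<alpha> :: "'n::finite \<Rightarrow> real ^ 'm \<Rightarrow> real"
    and S :: "'n \<Rightarrow> real \<Rightarrow> (real ^ 'm \<Rightarrow> real) \<Rightarrow> real ^ 'm \<Rightarrow> real"
    and E :: "(real \<Rightarrow> real ^ 'm \<Rightarrow> real ^ 'n \<Rightarrow> real ^ 'n) set"
    and f :: "real \<Rightarrow> real ^ 'm \<Rightarrow> real ^ 'n \<Rightarrow> real ^ 'n"
    and fs :: "nat \<Rightarrow> real \<Rightarrow> real ^ 'm \<Rightarrow> real ^ 'n \<Rightarrow> real ^ 'n"
    and z :: "real ^ 'm \<Rightarrow> real ^ 'n"
    and zs :: "nat \<Rightarrow> real ^ 'm \<Rightarrow> real ^ 'n"
    and T :: real
  assumes U: "bounded U" "open U" "connected U" "U \<noteq> {}" "C1_boundary U"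
    and \<alpha>: "\<And>i. boundary_coeff U bc (\<alpha> i)"
    and S: "\<And>i. heat_semigroup U bc (\<alpha> i) (S i)"
    and E: "E \<subseteq> LC U" "L1loc_equicontinuous_m_bounds U E"
    and vanish: "bc = Dirichlet \<Longrightarrow> \<forall>g\<in>insert f E. \<forall>t. \<forall>x\<in>frontier U. g t x 0 = 0"
    and fs: "\<forall>n\<ge>1. fs n \<in> E"
    and fs_lim: "limitin
        (subtopology (sigma_topology U bc S (theta1 U E) (theta2 U bc S E) (radius U E)) (LC U))
        fs f sequentially"
    and zs: "\<forall>n\<ge>1. zs n \<in> bc_space U bc"
    and z: "z \<in> bc_space U bc"
    and zs_lim: "(\<lambda>n. Xnorm U (zs n - z)) \<longlonglongrightarrow> 0"
    and T: "0 \<le> T" "{0..T} \<subseteq> mild_interval U bc S f z"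
  shows "(\<forall>\<^sub>F n in sequentially. {0..T} \<subseteq> mild_interval U bc S (fs n) (zs n)) \<and>
    (\<lambda>n. SUP t\<in>{0..T}. Xnorm U (maximal_mild_solution U bc S (fs n) (zs n) t
                             - maximal_mild_solution U bc S f z t)) \<longlonglongrightarrow> 0"
proof -
  interpret bounded_domain U using U by unfold_locales auto
  interpret heat_flow U bc "product_semigroup S" by (rule heat_flow_product_semigroup [OF S])
  have fLC: "f \<in> LC U" by (rule sigma_limitD(1) [OF fs_lim])
  then have fSC: "f \<in> SC U" by (simp add: LC_def)
  have van_f: "bc = Dirichlet \<Longrightarrow> \<forall>t. \<forall>x\<in>frontier U. f t x 0 = 0" using vanish by simp
  have n: "fs n \<in> E" "fs n \<in> LC U" "fs n \<in> SC U" "zs n \<in> bc_space U bc"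
    "bc = Dirichlet \<Longrightarrow> \<forall>t. \<forall>x\<in>frontier U. fs n t x 0 = 0" if "1 \<le> n" for n
    using that fs zs E(1) vanish by (auto simp: LC_def)
  have "T \<in> mild_interval U bc S f z" using T by auto
  \<comment> \<open>The comparison takes place on [0, T1], which contains [0, T] and is
    nondegenerate even if T = 0.\<close>
  then obtain T1 u where T1: "0 < T1" "T \<le> T1" and "mild_solution U bc S f z T1 u"
    by (auto simp: mild_interval_def)
  then have u: "mild f z T1 u" by (simp add: mild_solution_iff_mild [OF refl fSC van_f])
  then have uX: "\<And>t. t \<in> {0..T1} \<Longrightarrow> u t \<in> X" and uc: "norm_continuous_on U {0..T1} u"
    by (auto simp: mild_def)
  obtain j0 :: nat where j0: "\<And>t. t \<in> {0..T1} \<Longrightarrow> Xnorm U (u t) \<le> real j0"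
    using norm_continuous_bounded [OF uX uc] by blast
  \<comment> \<open>One more than a bound for \<open>u\<close>, so that \<open>u\<close> stays at
    distance 1 below the truncation level.\<close>
  define j where "j = j0 + 1"
  have j: "1 \<le> j" "Xnorm U (u t) + 1 \<le> real j" if "t \<in> {0..T1}" for t
    using j0 [OF that] by (simp_all add: j_def)
  have j1: "1 \<le> j" by (simp add: j_def)
  have "u 0 = z" using u T1(1) z by (auto simp: mild_def duhamel_0 P_0)
  then have zj: "Xnorm U z + 1 \<le> real j" using j(2) [of 0] T1(1) by simp
  define Q where "Q n w \<longleftrightarrow> (\<forall>t\<in>{0..T1}. w t \<in> X) \<and> norm_continuous_on U {0..T1} w \<and>
      (\<forall>t\<in>{0..T1}. w t = product_semigroup S t (zs n) + duhamel t (\<lambda>s. nemytskii U (fs n) s (clip (real j) (w s))))"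
    for n w
  have ex: "\<exists>w. Q n w" if "1 \<le> n" for n
    unfolding Q_def by (rule truncated_mild_solution_exists) (use n [OF that] in auto)
  \<comment> \<open>The choice is meaningful for \<open>n\<close> at least 1, where the hypotheses
    on \<open>fs n\<close> and \<open>zs n\<close> begin.\<close>
  define w where "w n = (SOME w. Q n w)" for n
  have "Q n (w n)" if "1 \<le> n" for n unfolding w_def by (rule someI_ex [OF ex [OF that]])
  then have w: "\<And>n t. 1 \<le> n \<Longrightarrow> t \<in> {0..T1} \<Longrightarrow> w n t \<in> X"
    "\<And>n. 1 \<le> n \<Longrightarrow> norm_continuous_on U {0..T1} (w n)"
    "\<And>n t. 1 \<le> n \<Longrightarrow> t \<in> {0..T1} \<Longrightarrow>
      w n t = product_semigroup S t (zs n) + duhamel t (\<lambda>s. nemytskii U (fs n) s (clip (real j) (w n s)))"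
    unfolding Q_def by blast+
  have conv: "\<forall>\<^sub>F k in sequentially. 1 \<le> k \<and> mild (fs k) (zs k) T1 (w k) \<and>
      (\<forall>t\<in>{0..T1}. Xnorm U (w k t - u t) \<le> \<epsilon>)" if \<epsilon>: "0 < \<epsilon>" "\<epsilon> < 1" for \<epsilon>
  proof -
    have uj: "Xnorm U (u t) \<le> real j" if "t \<in> {0..T1}" for t using j(2) [OF that] by simp
    have "\<forall>\<^sub>F k in sequentially. Xnorm U (zs k - z) < 1"
      using zs_lim by (rule order_tendstoD) simp
    moreover have "\<forall>\<^sub>F k in sequentially. \<forall>T0 w. T0 \<in> {0..T1} \<longrightarrow> mild (fs k) (zs k) T0 w \<longrightarrow>
        (\<forall>t\<in>{0..T0}. Xnorm U (w t) \<le> real j) \<longrightarrow> (\<forall>t\<in>{0..T0}. Xnorm U (w t - u t) \<le> \<epsilon>)"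
      by (rule mild_convergence_while_bounded [OF refl E vanish fs fs_lim zs z zs_lim u less_imp_le [OF T1(1)] j1 uj \<epsilon>(1)])
    moreover have "\<forall>\<^sub>F k in sequentially. 1 \<le> (k::nat)" by (rule eventually_ge_at_top)
    ultimately show ?thesis
    proof eventually_elim
      case (elim k)
      \<comment> \<open>\<open>zs k\<close> is closer than 1 to \<open>z\<close>, and the norm of
        \<open>z\<close> is at most j - 1; hence the truncated solution starts strictly below the
        level.\<close>
      have "Xnorm U (zs k) \<le> Xnorm U (zs k - z) + Xnorm U z"
        using Xnorm_triangle [OF bc_space_diff [OF n(4) [OF elim(3)] z] z] by simp
      then have "Xnorm U (zs k) < real j" using elim(1) zj by linarith
      then have "mild (fs k) (zs k) T1 (w k) \<and> (\<forall>t\<in>{0..T1}. Xnorm U (w k t - u t) \<le> \<epsilon>)"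
      proof (intro truncated_eventually_mild [where j = j])
        fix T0
        assume "T0 \<in> {0..T1}" "mild (fs k) (zs k) T0 (w k)" "\<forall>t\<in>{0..T0}. Xnorm U (w k t) \<le> real j"
        then show "\<forall>t\<in>{0..T0}. Xnorm U (w k t - u t) \<le> \<epsilon>" using elim(2) by blast
      qed (assumption | (rule uX j(2) n(4) [OF elim(3)] w(1) [OF elim(3)] w(2) [OF elim(3)]
          w(3) [OF elim(3)] \<epsilon>(2) less_imp_le [OF T1(1)]; assumption))+
      then show ?case using elim(3) by simp
    qed
  qed
  have sub: "{0..T} \<subseteq> {0..T1}" using T1(2) by auto
  show ?thesis
  proof
    show "\<forall>\<^sub>F k in sequentially. {0..T} \<subseteq> mild_interval U bc S (fs k) (zs k)"
      using conv [of "1 / 2", simplified]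
    proof eventually_elim
      case (elim k)
      then have "mild_solution U bc S (fs k) (zs k) T1 (w k)"
        by (simp add: mild_solution_iff_mild [OF refl n(3,5)])
      then show ?case using T1(1) sub unfolding mild_interval_def by blast
    qed
    show "(\<lambda>n. SUP t\<in>{0..T}. Xnorm U (maximal_mild_solution U bc S (fs n) (zs n) t
                             - maximal_mild_solution U bc S f z t)) \<longlonglongrightarrow> 0"
    proof (rule tendstoI)
      fix \<epsilon> :: real assume "0 < \<epsilon>"
      \<comment> \<open>Below 1 for the exit argument, and strictly below \<epsilon> because a
        supremum inherits only the weak inequality.\<close>
      define \<epsilon>0 where "\<epsilon>0 = min \<epsilon> 1 / 2"
      have \<epsilon>0: "0 < \<epsilon>0" "\<epsilon>0 < 1" "\<epsilon>0 < \<epsilon>" using \<open>0 < \<epsilon>\<close> by (auto simp: \<epsilon>0_def)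
      show "\<forall>\<^sub>F k in sequentially. dist (SUP t\<in>{0..T}. Xnorm U (maximal_mild_solution U bc S (fs k) (zs k) t
                             - maximal_mild_solution U bc S f z t)) 0 < \<epsilon>"
        using conv [OF \<epsilon>0(1,2)]
      proof eventually_elim
        case (elim k)
        let ?D = "\<lambda>t. Xnorm U (maximal_mild_solution U bc S (fs k) (zs k) t - maximal_mild_solution U bc S f z t)"
        have k: "1 \<le> k" "mild (fs k) (zs k) T1 (w k)" using elim by auto
        have D: "?D t = Xnorm U (w k t - u t)" if "t \<in> {0..T}" for t
          using maximal_mild_solution_eq [OF refl fLC van_f z u T1(1), of t]
            maximal_mild_solution_eq [OF refl n(2,5) n(4) k(2) T1(1), of t] that sub k(1) by auto
        have D_le: "?D t \<le> \<epsilon>0" if "t \<in> {0..T}" for t using D [OF that] elim that sub by auto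
        \<comment> \<open>The value at time 0 bounds the supremum from below, so that its distance
          to 0 is the supremum itself.\<close>
        have D0: "0 \<le> ?D 0"
          using D [of 0] T(1) T1(1) Xnorm_nonneg [OF bc_space_diff [OF w(1) [OF k(1)] uX], of 0 0] by simp
        have "(SUP t\<in>{0..T}. ?D t) \<le> \<epsilon>0" using T(1) D_le by (intro cSUP_least) auto
        moreover have "?D 0 \<le> (SUP t\<in>{0..T}. ?D t)"
          using T(1) D_le by (intro cSUP_upper bdd_aboveI2) auto
        ultimately show ?case using D0 \<epsilon>0(3) by (simp add: dist_real_def)
      qed
    qed
  qed
qed

end
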